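(* Let $\mathcal{A}=\mathcal{A}(a,r)$ be a full rank hyperplane arrangement. Then the corresponding hypertoric variety $\mathfrak{M}_{\mathcal{A}}$ (over $\mathbb{C}$) has a well-poised embedding.
   Context: Let $N,M$ be mutually dual lattices of finite rank, $a=(a_1,\dots,a_d)\in N^d$ with each $a_i\ne0$, $r=(r_1,\dots,r_d)\in\mathbb{Z}^d$, and $\mathcal{A}(a,r)=\{H_{a_i,r_i}\}$, $H_{a_i,r_i}=\{u\in M_{\mathbb{R}}:\langle a_i,u\rangle=r_i\}$. The arrangement is of full rank, with exact sequence $0\to\Lambda\xrightarrow{i}\mathbb{Z}^d\xrightarrow{a}N\to0$, where $a(e_i)=a_i$ (so $a$ is surjective). Let $L_{\mathcal{A}_0}\subseteq\mathbb{A}^d$ be the linear subspace cut out by all linear forms $\sum_ic_it_i$ with $\sum_ic_ia_i=0$. Let $T^*\mathbb{A}^d\cong\mathbb{A}^{2d}$ with coordinates $x_1,\dots,x_d,y_1,\dots,y_d$. The moment map $\mu_{\mathcal{A}}:T^*\mathbb{A}^d\to\mathbb{A}^d/L_{\mathcal{A}_0}$ is the map $(x,y)\mapsto(x_1y_1,\dots,x_dy_d)$ followed by the quotient map, so the total space $\mu_{\mathcal{A}}^{-1}(0)$ is cut out by the ideal generated by all $\sum_ic_ix_iy_i$ with $\sum_ic_ia_i=0$. The torus $G_{\mathcal{A}}=\mathrm{Spec}\,\mathbb{C}[\Lambda^*]$ acts on $T^*\mathbb{A}^d$ via the inclusion $\Lambda\to\mathbb{Z}^d\to\mathbb{Z}^d\oplus\mathbb{Z}^d$,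 $e_i\mapsto e_i^+-e_i^-$ of cocharacter lattices, i.e. $x_i$ has weight $i^*(e_i^* )\in\Lambda^*$ and $y_i$ has weight $-i^*(e_i^* )$; it preserves $\mu_{\mathcal{A}}^{-1}(0)$. With $\alpha=i^*(r)\in\Lambda^*$, the hypertoric variety is the GIT quotient $\mathfrak{M}_{\mathcal{A}}=\mu_{\mathcal{A}}^{-1}(0)/\!/_\alpha G_{\mathcal{A}}=\mathrm{Proj}\bigoplus_{k\ge0}R_{k\alpha}$, where $R$ is the coordinate ring of $\mu_{\mathcal{A}}^{-1}(0)$ and $R_{k\alpha}$ its weight-$k\alpha$ part. Well-poised: for $w$ real, $\mathrm{in}_w(f)$ is the sum of terms of $f$ of minimal $w$-weight, $\mathrm{in}_w(I)=\langle\mathrm{in}_w(f):f\in I\rangle$, and $\mathrm{Trop}(I)$ is the set of $w$ such that $\mathrm{in}_w(I)$ contains no monomial. A prime ideal $I$ of a polynomial ring over $\mathbb{C}$ containing no variable is well-poised if $\mathrm{in}_w(I)$ is prime for every $w\in\mathrm{Trop}(I)$. A variety $Z$ projective over an affine variety has a well-poised embedding if $Z\cong\mathrm{Proj}\,\mathbb{C}[z_1,\dots,z_p,y_0,\dots,y_q]/J$, where $\deg z_i=0$, $\deg y_j=1$, and $J$ is a homogeneous well-poised prime ideal containing no variable (i.e. $Z$ is a closed subvariety of $\mathbb{A}^p\times\mathbb{P}^q$ with well-poised ideal). *)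

theory Defs
  imports
    "HOL-Analysis.Abstract_Topology"
    "HOL-Library.Poly_Mapping"
    "HOL-Algebra.Free_Abelian_Groups"
    "HOL-Algebra.Elementary_Groups"
    "HOL-Algebra.QuotRing"
    "HOL-Algebra.UnivPoly"
    Complex_Main
begin

section \<open>Polynomial rings over the complex numbers\<close>

type_synonym 'v mon = "'v \<Rightarrow>\<^sub>0 nat"
type_synonym 'v cpoly = "'v mon \<Rightarrow>\<^sub>0 complex"

definition mono :: "'v mon \<Rightarrow> 'v cpoly" where
  "mono m = Poly_Mapping.single m 1"

definition var :: "'v \<Rightarrow> 'v cpoly" where
  "var v = mono (Poly_Mapping.single v 1)"

definition const :: "complex \<Rightarrow> 'v cpoly" where
  "const c = Poly_Mapping.single 0 c"

definition mons :: "'v set \<Rightarrow> 'v mon set" where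
  "mons V = {m. Poly_Mapping.keys m \<subseteq> V}"

definition poly_ring :: "'v set \<Rightarrow> 'v cpoly ring" where
  "poly_ring V =
     \<lparr>carrier = {f. Poly_Mapping.keys f \<subseteq> mons V}, mult = (*), one = 1, zero = 0, add = (+)\<rparr>"

lemma cring_poly_ring: "cring (poly_ring V)"
proof -
  have mult_closed: "Poly_Mapping.keys (f * g) \<subseteq> mons V"
    if "Poly_Mapping.keys f \<subseteq> mons V" "Poly_Mapping.keys g \<subseteq> mons V" for f g :: "'a cpoly"
  proof
    fix m assume "m \<in> Poly_Mapping.keys (f * g)"
    then obtain k l where m: "m = k + l" and "k \<in> Poly_Mapping.keys f" "l \<in> Poly_Mapping.keys g"
      using keys_mult[of f g] by blast
    then have "Poly_Mapping.keys k \<subseteq> V" "Poly_Mapping.keys l \<subseteq> V"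
      using that by (auto simp: mons_def)
    then show "m \<in> mons V"
      using Poly_Mapping.keys_add[of k l] m by (auto simp: mons_def)
  qed
  show ?thesis
  proof (rule cringI)
    show "abelian_group (poly_ring V)"
    proof (rule abelian_groupI)
      fix f assume f: "f \<in> carrier (poly_ring V)"
      show "\<exists>g\<in>carrier (poly_ring V). g \<oplus>\<^bsub>poly_ring V\<^esub> f = \<zero>\<^bsub>poly_ring V\<^esub>"
        using f by (intro bexI[of _ "- f"]) (auto simp: poly_ring_def)
    next
      fix f g assume "f \<in> carrier (poly_ring V)" "g \<in> carrier (poly_ring V)"
      then show "f \<oplus>\<^bsub>poly_ring V\<^esub> g \<in> carrier (poly_ring V)"
        using Poly_Mapping.keys_add[of f g] by (auto simp: poly_ring_def)
    qed (auto simp: poly_ring_def add.assoc add.commute)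
    show "comm_monoid (poly_ring V)"
      by (rule comm_monoidI)
         (use mult_closed in \<open>auto simp: poly_ring_def mult.assoc mult.commute mons_def\<close>)
  qed (auto simp: poly_ring_def distrib_right)
qed


section \<open>Initial ideals and well-poised ideals\<close>

definition mon_weight :: "('v \<Rightarrow> real) \<Rightarrow> 'v mon \<Rightarrow> real" where
  "mon_weight w m = (\<Sum>v\<in>Poly_Mapping.keys m. real (Poly_Mapping.lookup m v) * w v)"

definition initial_form :: "('v \<Rightarrow> real) \<Rightarrow> 'v cpoly \<Rightarrow> 'v cpoly" where
  "initial_form w f =
     (\<Sum>m | m \<in> Poly_Mapping.keys f \<and> (\<forall>m'\<in>Poly_Mapping.keys f. mon_weight w m \<le> mon_weight w m').
        Poly_Mapping.single m (Poly_Mapping.lookup f m))"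

definition initial_ideal :: "'v set \<Rightarrow> ('v \<Rightarrow> real) \<Rightarrow> 'v cpoly set \<Rightarrow> 'v cpoly set" where
  "initial_ideal V w I = genideal (poly_ring V) (initial_form w ` I)"

text \<open>Only the values of a weight on \<open>V\<close> matter, so weights are left unrestricted elsewhere.\<close>

definition Trop :: "'v set \<Rightarrow> 'v cpoly set \<Rightarrow> ('v \<Rightarrow> real) set" where
  "Trop V I = {w. \<forall>m\<in>mons V. mono m \<notin> initial_ideal V w I}"

definition well_poised :: "'v set \<Rightarrow> 'v cpoly set \<Rightarrow> bool" where
  "well_poised V I \<longleftrightarrow>
     primeideal I (poly_ring V) \<and> (\<forall>v\<in>V. var v \<notin> I) \<and>
     (\<forall>w\<in>Trop V I. primeideal (initial_ideal V w I) (poly_ring V))"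


section \<open>Ringed spaces over the complex numbers\<close>

text \<open>
  The field \<open>scal\<close> is the structure map from the complex numbers to the sections over an open
  set.  Isomorphisms of ringed spaces automatically induce isomorphisms of local rings, so for
  schemes the following notion is isomorphism of schemes over the complex numbers.
\<close>

record ('p, 's) cspace =
  top_of :: "'p topology"
  sections :: "'p set \<Rightarrow> 's ring"
  restr :: "'p set \<Rightarrow> 'p set \<Rightarrow> 's \<Rightarrow> 's"
  scal :: "'p set \<Rightarrow> complex \<Rightarrow> 's"

definition cspace_isomorphic :: "('p, 's) cspace \<Rightarrow> ('q, 't) cspace \<Rightarrow> bool" where
  "cspace_isomorphic X Y \<longleftrightarrow>
     (\<exists>f \<phi>. homeomorphic_map (top_of X) (top_of Y) f \<and>
        (let pre = (\<lambda>V. {x \<in> topspace (top_of X). f x \<in> V}) in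
          (\<forall>V. openin (top_of Y) V \<longrightarrow>
             \<phi> V \<in> ring_iso (sections Y V) (sections X (pre V)) \<and>
             (\<forall>c. \<phi> V (scal Y V c) = scal X (pre V) c)) \<and>
          (\<forall>V W. openin (top_of Y) V \<and> openin (top_of Y) W \<and> W \<subseteq> V \<longrightarrow>
             (\<forall>s\<in>carrier (sections Y V).
                \<phi> W (restr Y V W s) = restr X (pre V) (pre W) (\<phi> V s)))))"


section \<open>Proj of a graded ring\<close>

text \<open>A grading of \<open>S\<close> is given by its graded pieces \<open>A n\<close>.\<close>

definition homog_elems :: "(nat \<Rightarrow> 'a set) \<Rightarrow> 'a set" where
  "homog_elems A = (\<Union>n. A n)"

definition homogeneous_ideal :: "('a, 'm) ring_scheme \<Rightarrow> (nat \<Rightarrow> 'a set) \<Rightarrow> 'a set \<Rightarrow> bool" where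
  "homogeneous_ideal S A I \<longleftrightarrow> ideal I S \<and> I = genideal S (I \<inter> homog_elems A)"

definition Proj_points :: "('a, 'm) ring_scheme \<Rightarrow> (nat \<Rightarrow> 'a set) \<Rightarrow> 'a set set" where
  "Proj_points S A =
     {P. primeideal P S \<and> homogeneous_ideal S A P \<and> \<not> (\<Union>n\<in>{1..}. A n) \<subseteq> P}"

definition Proj_open :: "('a, 'm) ring_scheme \<Rightarrow> (nat \<Rightarrow> 'a set) \<Rightarrow> 'a set set \<Rightarrow> bool" where
  "Proj_open S A U \<longleftrightarrow> (\<exists>T\<subseteq>carrier S. U = {P \<in> Proj_points S A. \<not> T \<subseteq> P})"

definition Proj_topology :: "('a, 'm) ring_scheme \<Rightarrow> (nat \<Rightarrow> 'a set) \<Rightarrow> 'a set topology" where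
  "Proj_topology S A = topology (Proj_open S A)"

lemma istopology_Proj_open: "istopology (Proj_open S A)"
  unfolding istopology_def
proof (intro conjI allI impI)
  fix U V assume "Proj_open S A U" "Proj_open S A V"
  then obtain T T' where T: "T \<subseteq> carrier S" "U = {P \<in> Proj_points S A. \<not> T \<subseteq> P}"
    and T': "T' \<subseteq> carrier S" "V = {P \<in> Proj_points S A. \<not> T' \<subseteq> P}"
    by (auto simp: Proj_open_def)
  define TT where "TT = {x \<otimes>\<^bsub>S\<^esub> y | x y. x \<in> T \<and> y \<in> T'} \<inter> carrier S"
  have "\<not> TT \<subseteq> P \<longleftrightarrow> \<not> T \<subseteq> P \<and> \<not> T' \<subseteq> P" if "P \<in> Proj_points S A" for P
  proof -
    interpret primeideal P S using that by (simp add: Proj_points_def)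
    show ?thesis
    proof
      assume "\<not> TT \<subseteq> P"
      then obtain x y where "x \<in> T" "y \<in> T'" and xy: "x \<otimes>\<^bsub>S\<^esub> y \<notin> P"
        unfolding TT_def by blast
      moreover have "x \<notin> P"
        using xy I_r_closed[of x y] T'(1) \<open>y \<in> T'\<close> by blast
      moreover have "y \<notin> P"
        using xy I_l_closed[of y x] T(1) \<open>x \<in> T\<close> by blast
      ultimately show "\<not> T \<subseteq> P \<and> \<not> T' \<subseteq> P" by blast
    next
      assume "\<not> T \<subseteq> P \<and> \<not> T' \<subseteq> P"
      then obtain x y where xy: "x \<in> T" "x \<notin> P" "y \<in> T'" "y \<notin> P" by blast
      then have "x \<in> carrier S" "y \<in> carrier S" using T(1) T'(1) by auto
      then have "x \<otimes>\<^bsub>S\<^esub> y \<in> TT" "x \<otimes>\<^bsub>S\<^esub> y \<notin> P"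
        using xy I_prime[of x y] m_closed[of x y] unfolding TT_def by auto
      then show "\<not> TT \<subseteq> P" by blast
    qed
  qed
  then have "U \<inter> V = {P \<in> Proj_points S A. \<not> TT \<subseteq> P}"
    using T T' by blast
  moreover have "TT \<subseteq> carrier S" by (simp add: TT_def)
  ultimately show "Proj_open S A (U \<inter> V)" unfolding Proj_open_def by blast
next
  fix K assume "\<forall>U\<in>K. Proj_open S A U"
  then obtain t where t: "\<And>U. U \<in> K \<Longrightarrow> t U \<subseteq> carrier S \<and> U = {P \<in> Proj_points S A. \<not> t U \<subseteq> P}"
    unfolding Proj_open_def Ball_def by metis
  have "\<Union>K = {P \<in> Proj_points S A. \<not> (\<Union>U\<in>K. t U) \<subseteq> P}"
  proof -
    have "P \<in> U \<longleftrightarrow> P \<in> Proj_points S A \<and> \<not> t U \<subseteq> P" if "U \<in> K" for P U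
      using t[OF that] by blast
    then show ?thesis by blast
  qed
  moreover have "(\<Union>U\<in>K. t U) \<subseteq> carrier S" using t by blast
  ultimately show "Proj_open S A (\<Union>K)" unfolding Proj_open_def by blast
qed

text \<open>
  \<open>hfrac S A P a b\<close> is the fraction \<open>a / b\<close> in the homogeneous localization of \<open>S\<close> at \<open>P\<close>,
  as the set of all pairs representing it.
\<close>

definition hpairs :: "(nat \<Rightarrow> 'a set) \<Rightarrow> 'a set \<Rightarrow> ('a \<times> 'a) set" where
  "hpairs A P = {(a, b). (\<exists>n. a \<in> A n \<and> b \<in> A n) \<and> b \<notin> P}"

definition hfrac ::
    "('a, 'm) ring_scheme \<Rightarrow> (nat \<Rightarrow> 'a set) \<Rightarrow> 'a set \<Rightarrow> 'a \<Rightarrow> 'a \<Rightarrow> ('a \<times> 'a) set" where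
  "hfrac S A P a b =
     {(a', b') \<in> hpairs A P. \<exists>u\<in>homog_elems A - P.
        u \<otimes>\<^bsub>S\<^esub> (a \<otimes>\<^bsub>S\<^esub> b') = u \<otimes>\<^bsub>S\<^esub> (a' \<otimes>\<^bsub>S\<^esub> b)}"

definition homog_localization ::
    "('a, 'm) ring_scheme \<Rightarrow> (nat \<Rightarrow> 'a set) \<Rightarrow> 'a set \<Rightarrow> ('a \<times> 'a) set ring" where
  "homog_localization S A P =
     \<lparr>carrier = (\<lambda>(a, b). hfrac S A P a b) ` hpairs A P,
      mult = (\<lambda>X Y. \<Union>(a, b)\<in>X. \<Union>(c, d)\<in>Y. hfrac S A P (a \<otimes>\<^bsub>S\<^esub> c) (b \<otimes>\<^bsub>S\<^esub> d)),
      one = hfrac S A P \<one>\<^bsub>S\<^esub> \<one>\<^bsub>S\<^esub>,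
      zero = hfrac S A P \<zero>\<^bsub>S\<^esub> \<one>\<^bsub>S\<^esub>,
      add = (\<lambda>X Y. \<Union>(a, b)\<in>X. \<Union>(c, d)\<in>Y.
               hfrac S A P ((a \<otimes>\<^bsub>S\<^esub> d) \<oplus>\<^bsub>S\<^esub> (c \<otimes>\<^bsub>S\<^esub> b)) (b \<otimes>\<^bsub>S\<^esub> d))\<rparr>"

definition Proj_sections ::
    "('a, 'm) ring_scheme \<Rightarrow> (nat \<Rightarrow> 'a set) \<Rightarrow> 'a set set \<Rightarrow> ('a set \<Rightarrow> ('a \<times> 'a) set) ring" where
  "Proj_sections S A U =
     \<lparr>carrier = {s \<in> (\<Pi>\<^sub>E P\<in>U. carrier (homog_localization S A P)).
        \<forall>P\<in>U. \<exists>V n a b. Proj_open S A V \<and> P \<in> V \<and> V \<subseteq> U \<and> a \<in> A n \<and> b \<in> A n \<and>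
          (\<forall>Q\<in>V. b \<notin> Q \<and> s Q = hfrac S A Q a b)},
      mult = (\<lambda>s t. \<lambda>P\<in>U. s P \<otimes>\<^bsub>homog_localization S A P\<^esub> t P),
      one = (\<lambda>P\<in>U. \<one>\<^bsub>homog_localization S A P\<^esub>),
      zero = (\<lambda>P\<in>U. \<zero>\<^bsub>homog_localization S A P\<^esub>),
      add = (\<lambda>s t. \<lambda>P\<in>U. s P \<oplus>\<^bsub>homog_localization S A P\<^esub> t P)\<rparr>"

text \<open>The last argument is the structure map from the complex numbers to \<open>A 0\<close>.\<close>

definition Proj ::
    "('a, 'm) ring_scheme \<Rightarrow> (nat \<Rightarrow> 'a set) \<Rightarrow> (complex \<Rightarrow> 'a) \<Rightarrow>
      ('a set, 'a set \<Rightarrow> ('a \<times> 'a) set) cspace" where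
  "Proj S A \<iota> =
     \<lparr>top_of = Proj_topology S A,
      sections = Proj_sections S A,
      restr = (\<lambda>U V s. restrict s V),
      scal = (\<lambda>U c. \<lambda>P\<in>U. hfrac S A P (\<iota> c) \<one>\<^bsub>S\<^esub>)\<rparr>"


section \<open>Well-poised embeddings\<close>

text \<open>
  \<open>Inl i\<close> stands for the variable \<open>z\<^sub>i\<close> of degree 0, \<open>Inr j\<close> for the variable \<open>y\<^sub>j\<close> of degree 1.
\<close>

definition zy_vars :: "nat \<Rightarrow> nat \<Rightarrow> (nat + nat) set" where
  "zy_vars p q = Inl ` {1..p} \<union> Inr ` {0..q}"

definition y_degree :: "(nat + nat) mon \<Rightarrow> nat" where
  "y_degree m = (\<Sum>v\<in>Poly_Mapping.keys m.
     (case v of Inl i \<Rightarrow> 0 | Inr j \<Rightarrow> Poly_Mapping.lookup m v))"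

definition zy_grading :: "nat \<Rightarrow> nat \<Rightarrow> nat \<Rightarrow> (nat + nat) cpoly set" where
  "zy_grading p q n =
     {f \<in> carrier (poly_ring (zy_vars p q)). \<forall>m\<in>Poly_Mapping.keys f. y_degree m = n}"

definition Proj_mod :: "nat \<Rightarrow> nat \<Rightarrow> (nat + nat) cpoly set \<Rightarrow>
    ((nat + nat) cpoly set set,
     (nat + nat) cpoly set set \<Rightarrow> ((nat + nat) cpoly set \<times> (nat + nat) cpoly set) set) cspace" where
  "Proj_mod p q J =
     (let P = poly_ring (zy_vars p q) in
       Proj (P Quot J) (\<lambda>n. (\<lambda>f. J +>\<^bsub>P\<^esub> f) ` zy_grading p q n) (\<lambda>c. J +>\<^bsub>P\<^esub> const c))"

definition has_well_poised_embedding :: "('p, 's) cspace \<Rightarrow> bool" where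
  "has_well_poised_embedding Z \<longleftrightarrow>
     (\<exists>p q J. homogeneous_ideal (poly_ring (zy_vars p q)) (zy_grading p q) J \<and>
        well_poised (zy_vars p q) J \<and> cspace_isomorphic Z (Proj_mod p q J))"


section \<open>Hyperplane arrangements and hypertoric varieties\<close>

text \<open>
  Lattices are written multiplicatively.  The arrangement consists of the hyperplanes
  \<open>hyperplane N (a i) (r i)\<close> for \<open>i < d\<close>; the same hyperplane may occur repeatedly, and all
  constructions depend on the data \<open>d\<close>, \<open>a\<close>, \<open>r\<close> rather than on the set of hyperplanes.
\<close>

definition finite_rank_lattice :: "'n monoid \<Rightarrow> bool" where
  "finite_rank_lattice N \<longleftrightarrow> comm_group N \<and> (\<exists>n. N \<cong> free_Abelian_group {..<n::nat})"

definition dual_lattice :: "'n monoid \<Rightarrow> ('n \<Rightarrow> int) set" where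
  "dual_lattice N = hom N integer_group"

text \<open>The real vector space spanned by the dual lattice is the space of additive maps to the reals.\<close>

definition hyperplane :: "'n monoid \<Rightarrow> 'n \<Rightarrow> int \<Rightarrow> ('n \<Rightarrow> real) set" where
  "hyperplane N v s =
     {u. u \<in> extensional (carrier N) \<and>
         (\<forall>x\<in>carrier N. \<forall>y\<in>carrier N. u (x \<otimes>\<^bsub>N\<^esub> y) = u x + u y) \<and> u v = real_of_int s}"

definition arr_map :: "'n monoid \<Rightarrow> nat \<Rightarrow> (nat \<Rightarrow> 'n) \<Rightarrow> (nat \<Rightarrow> int) \<Rightarrow> 'n" where
  "arr_map N d a c = finprod N (\<lambda>i. a i [^]\<^bsub>N\<^esub> c i) {..<d}"

definition full_rank :: "'n monoid \<Rightarrow> nat \<Rightarrow> (nat \<Rightarrow> 'n) \<Rightarrow> bool" where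
  "full_rank N d a \<longleftrightarrow> arr_map N d a ` ({..<d} \<rightarrow>\<^sub>E UNIV) = carrier N"

definition Lambda :: "'n monoid \<Rightarrow> nat \<Rightarrow> (nat \<Rightarrow> 'n) \<Rightarrow> (nat \<Rightarrow> int) set" where
  "Lambda N d a = {l \<in> {..<d} \<rightarrow>\<^sub>E UNIV. arr_map N d a l = \<one>\<^bsub>N\<^esub>}"

text \<open>
  \<open>i_star N d a c\<close> is the restriction to \<open>Lambda N d a\<close> of the functional on \<open>\<int>\<^sup>d\<close> with
  coordinates \<open>c\<close>, an element of the character lattice of the torus.
\<close>

definition i_star ::
    "'n monoid \<Rightarrow> nat \<Rightarrow> (nat \<Rightarrow> 'n) \<Rightarrow> (nat \<Rightarrow> int) \<Rightarrow> (nat \<Rightarrow> int) \<Rightarrow> int" where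
  "i_star N d a c = (\<lambda>l\<in>Lambda N d a. \<Sum>i<d. c i * l i)"

text \<open>In the coordinate ring of \<open>T\<^sup>*\<bbbA>\<^sup>d\<close>, \<open>Inl i\<close> stands for \<open>x\<^sub>i\<close> and \<open>Inr i\<close> for \<open>y\<^sub>i\<close>.\<close>

definition xy_ring :: "nat \<Rightarrow> (nat + nat) cpoly ring" where
  "xy_ring d = poly_ring (Inl ` {..<d} \<union> Inr ` {..<d})"

text \<open>
  A complex relation \<open>\<Sum>\<^sub>i c\<^sub>i a\<^sub>i = 0\<close> in the complexification of \<open>N\<close> is tested by pairing
  with the dual lattice.
\<close>

definition linear_relations :: "'n monoid \<Rightarrow> nat \<Rightarrow> (nat \<Rightarrow> 'n) \<Rightarrow> (nat \<Rightarrow> complex) set" where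
  "linear_relations N d a = {c. \<forall>u\<in>dual_lattice N. (\<Sum>i<d. c i * of_int (u (a i))) = 0}"

definition moment_ideal :: "'n monoid \<Rightarrow> nat \<Rightarrow> (nat \<Rightarrow> 'n) \<Rightarrow> (nat + nat) cpoly set" where
  "moment_ideal N d a = genideal (xy_ring d)
     ((\<lambda>c. \<Sum>i<d. const (c i) * var (Inl i) * var (Inr i)) ` linear_relations N d a)"

definition moment_ring :: "'n monoid \<Rightarrow> nat \<Rightarrow> (nat \<Rightarrow> 'n) \<Rightarrow> (nat + nat) cpoly set ring" where
  "moment_ring N d a = xy_ring d Quot moment_ideal N d a"

definition torus_weight ::
    "'n monoid \<Rightarrow> nat \<Rightarrow> (nat \<Rightarrow> 'n) \<Rightarrow> (nat + nat) mon \<Rightarrow> (nat \<Rightarrow> int) \<Rightarrow> int" where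
  "torus_weight N d a m =
     i_star N d a (\<lambda>i. int (Poly_Mapping.lookup m (Inl i)) - int (Poly_Mapping.lookup m (Inr i)))"

definition weight_part ::
    "'n monoid \<Rightarrow> nat \<Rightarrow> (nat \<Rightarrow> 'n) \<Rightarrow> ((nat \<Rightarrow> int) \<Rightarrow> int) \<Rightarrow> (nat + nat) cpoly set set" where
  "weight_part N d a \<chi> =
     (\<lambda>f. moment_ideal N d a +>\<^bsub>xy_ring d\<^esub> f) `
       {f \<in> carrier (xy_ring d). \<forall>m\<in>Poly_Mapping.keys f. torus_weight N d a m = \<chi>}"

text \<open>
  The direct sum of the pieces \<open>R\<^bsub>k\<alpha>\<^esub>\<close> over all \<open>k\<close> is an external one (for \<open>\<alpha> = 0\<close> all the
  pieces coincide).  It is realized as the subring of the univariate polynomial ring over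
  \<open>R\<close> in which the coefficient of degree \<open>k\<close> lies in \<open>R\<^bsub>k\<alpha>\<^esub>\<close>.
\<close>

definition section_pieces ::
    "'n monoid \<Rightarrow> nat \<Rightarrow> (nat \<Rightarrow> 'n) \<Rightarrow> (nat \<Rightarrow> int) \<Rightarrow> nat \<Rightarrow> (nat + nat) cpoly set set" where
  "section_pieces N d a r k = weight_part N d a (\<lambda>l\<in>Lambda N d a. int k * i_star N d a r l)"

definition section_ring ::
    "'n monoid \<Rightarrow> nat \<Rightarrow> (nat \<Rightarrow> 'n) \<Rightarrow> (nat \<Rightarrow> int) \<Rightarrow>
      ((nat + nat) cpoly set, nat \<Rightarrow> (nat + nat) cpoly set) up_ring" where
  "section_ring N d a r =
     (UP (moment_ring N d a))
       \<lparr>carrier := {f \<in> carrier (UP (moment_ring N d a)). \<forall>k. f k \<in> section_pieces N d a r k}\<rparr>"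

definition section_grading ::
    "'n monoid \<Rightarrow> nat \<Rightarrow> (nat \<Rightarrow> 'n) \<Rightarrow> (nat \<Rightarrow> int) \<Rightarrow>
      nat \<Rightarrow> (nat \<Rightarrow> (nat + nat) cpoly set) set" where
  "section_grading N d a r k =
     {f \<in> carrier (section_ring N d a r). \<forall>j. j \<noteq> k \<longrightarrow> f j = \<zero>\<^bsub>moment_ring N d a\<^esub>}"

definition hypertoric_variety where
  "hypertoric_variety N d a r =
     Proj (section_ring N d a r) (section_grading N d a r)
       (\<lambda>c. up_ring.monom (UP (moment_ring N d a))
              (moment_ideal N d a +>\<^bsub>xy_ring d\<^esub> const c) 0)"

end

theory Submission
  imports Defs
    "HOL-Library.Product_Plus"
    "HOL-Algebra.Subrings"
    "HOL-Computational_Algebra.Polynomial"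
begin

text \<open>
  Write \<open>t\<^sub>i = x\<^sub>i y\<^sub>i\<close>.  On the zero fibre of the moment map the \<open>t\<^sub>i\<close> become linear forms \<open>l\<^sub>i\<close> in a
  basis chosen among them, and none of these forms is zero because \<open>a\<^sub>i \<noteq> 0\<close>.  Under the torus of
  dimension \<open>d\<close> a monomial in the variables \<open>x\<^sub>i\<close> and \<open>y\<^sub>i\<close> has a weight \<open>c\<close>, and substituting characters
  \<open>\<chi>\<^sub>i\<close> for \<open>x\<^sub>i\<close> and \<open>l\<^sub>i \<chi>\<^sub>i\<^bsup>-1\<^esup>\<close> for \<open>y\<^sub>i\<close> turns it into \<open>\<chi>\<^sup>c\<close> times the power of the forms
  given by its exponents in the \<open>y\<^sub>i\<close>.  So a polynomial lies in the moment ideal if and only if for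
  every weight the sum of its coefficients, each multiplied by such a power, vanishes
  (\<open>moment_ideal_eq\<close>).

  The sections of the multiples of \<open>\<alpha>\<close> are spanned by monomials whose exponents form a finitely
  generated monoid, and some Veronese submonoid is generated in degrees zero and one
  (\<open>exists_degree_one_generators\<close>).  Its generators are the coordinates of the embedding.  Passing to
  a Veronese subring does not change Proj (\<open>Proj_isomorphic\<close>), so the image is the hypertoric variety.
  Its ideal \<open>J\<close> has the same description as the moment ideal: certain sums over the fibres of a
  character \<open>\<Gamma>\<close> vanish, in which a monomial \<open>m\<close> is weighted with the power \<open>l\<^bsup>b(m)\<^esup>\<close> of the linear forms.
  Every ideal described in this way is the kernel of a homomorphism to an integral domain, hence
  prime (\<open>fibre_ideal_prime\<close>).

  It remains to see that for \<open>w\<close> in the tropical variety the initial ideal of \<open>J\<close> has such a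
  description as well (\<open>initial_ideal_eq\<close>).  The initial ideal contains no monomial.  Applied to the
  binomials in \<open>J\<close>, this forces the weight of a monomial to be, on each fibre of \<open>\<Gamma>\<close>, the weight
  of its exponents \<open>b(m)\<close> up to a constant, where \<open>t\<^sub>i\<close> has some weight \<open>\<tau>\<^sub>i\<close>.  Choose the basis among the
  \<open>t\<^sub>i\<close> of largest total weight, by the greedy algorithm; then all terms of \<open>l\<^sub>i\<close> have weight at
  least \<open>\<tau>\<^sub>i\<close>.  Applied to the relation expressing \<open>t\<^sub>i\<close> in the basis, the absence of monomials
  shows that the part of \<open>l\<^sub>i\<close> of weight \<open>\<tau>\<^sub>i\<close> is nonzero.  The initial ideal is the ideal described by
  these leading forms.  One inclusion is seen by taking lightest terms.  For the other, an element
  of the ideal of the leading forms has to be completed by heavier terms to an element of \<open>J\<close>, and this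
  is possible since each fibre contains a monomial with least exponents \<open>b\<close>, by whose power of the
  forms one may divide.
\<close>

abbreviation supp :: "('a \<Rightarrow>\<^sub>0 'b::zero) \<Rightarrow> 'a set" where "supp \<equiv> Poly_Mapping.keys"
abbreviation coef :: "('a \<Rightarrow>\<^sub>0 'b::zero) \<Rightarrow> 'a \<Rightarrow> 'b" where "coef \<equiv> Poly_Mapping.lookup"
abbreviation single :: "'a \<Rightarrow> 'b \<Rightarrow> ('a \<Rightarrow>\<^sub>0 'b::zero)" where "single \<equiv> Poly_Mapping.single"

section \<open>Evaluation homomorphisms on monoid algebras\<close>

lemma sum_terms: "(\<Sum>m\<in>supp f. single m (coef f m)) = (f :: 'm \<Rightarrow>\<^sub>0 'b::comm_monoid_add)"
  by (rule poly_mapping_eqI) (simp add: lookup_sum lookup_single when_def in_keys_iff)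

lemma additive_sum:
  fixes F :: "'a::comm_monoid_add \<Rightarrow> 'b::comm_monoid_add"
  assumes "F 0 = 0" "\<And>x y. F (x + y) = F x + F y"
  shows "F (sum g A) = (\<Sum>a\<in>A. F (g a))"
  by (induction A rule: infinite_finite_induct) (auto simp: assms)

definition eval_pm :: "('c::zero \<Rightarrow> 'e) \<Rightarrow> ('m \<Rightarrow> 'e) \<Rightarrow> ('m \<Rightarrow>\<^sub>0 'c) \<Rightarrow> 'e::comm_ring_1" where
  "eval_pm \<iota> e f = (\<Sum>m\<in>supp f. \<iota> (coef f m) * e m)"

locale evaluation =
  fixes \<iota> :: "'c::comm_ring_1 \<Rightarrow> 'e::comm_ring_1" and e :: "'m::comm_monoid_add \<Rightarrow> 'e"
  assumes \<iota>_0: "\<iota> 0 = 0" and \<iota>_1: "\<iota> 1 = 1" and \<iota>_add: "\<iota> (x + y) = \<iota> x + \<iota> y"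
    and \<iota>_mult: "\<iota> (x * y) = \<iota> x * \<iota> y"
    and e_0: "e 0 = 1" and e_add: "e (m + n) = e m * e n"
begin

lemma ev_0 [simp]: "eval_pm \<iota> e 0 = 0"
  by (simp add: eval_pm_def)

lemma ev_term [simp]: "eval_pm \<iota> e (single m c) = \<iota> c * e m"
  by (simp add: eval_pm_def \<iota>_0)

lemma ev_1 [simp]: "eval_pm \<iota> e 1 = 1"
  using ev_term[of 0 1] by (simp add: \<iota>_1 e_0)

lemma ev_add [simp]: "eval_pm \<iota> e (f + g) = eval_pm \<iota> e f + eval_pm \<iota> e g"
  unfolding eval_pm_def
  by (rule setsum_keys_plus_distrib) (auto simp: \<iota>_0 \<iota>_add distrib_right)

lemma ev_sum: "eval_pm \<iota> e (sum g A) = (\<Sum>a\<in>A. eval_pm \<iota> e (g a))"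
  by (rule additive_sum) auto

lemma ev_uminus [simp]: "eval_pm \<iota> e (- f) = - eval_pm \<iota> e f"
  using ev_add[of f "- f"] by (simp add: eq_neg_iff_add_eq_0 add.commute del: ev_add)

lemma ev_diff [simp]: "eval_pm \<iota> e (f - g) = eval_pm \<iota> e f - eval_pm \<iota> e g"
  using ev_add[of f "- g"] by (simp del: ev_add)

lemma ev_mult [simp]: "eval_pm \<iota> e (f * g) = eval_pm \<iota> e f * eval_pm \<iota> e g"
proof -
  have "f * g = (\<Sum>m\<in>supp f. single m (coef f m)) * (\<Sum>n\<in>supp g. single n (coef g n))"
    by (simp add: sum_terms)
  also have "\<dots> = (\<Sum>m\<in>supp f. \<Sum>n\<in>supp g. single (m + n) (coef f m * coef g n))"
    by (simp add: sum_product mult_single)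
  finally have "eval_pm \<iota> e (f * g)
      = (\<Sum>m\<in>supp f. \<Sum>n\<in>supp g. \<iota> (coef f m * coef g n) * e (m + n))"
    by (simp add: ev_sum)
  also have "\<dots> = eval_pm \<iota> e f * eval_pm \<iota> e g"
    by (simp add: eval_pm_def sum_product \<iota>_mult e_add mult_ac)
  finally show ?thesis .
qed

lemma ev_power [simp]: "eval_pm \<iota> e (f ^ n) = eval_pm \<iota> e f ^ n"
  by (induction n) auto

lemma ev_prod: "eval_pm \<iota> e (prod g A) = (\<Prod>a\<in>A. eval_pm \<iota> e (g a))"
  by (induction A rule: infinite_finite_induct) auto

end

lemma const_0 [simp]: "const 0 = 0" and const_1 [simp]: "const 1 = 1"
  by (simp_all add: const_def)

lemma const_add: "const (x + y) = const x + const y"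
  by (simp add: const_def single_add)

lemma const_mult: "const (x * y) = const x * const y"
  by (simp add: const_def mult_single)

lemma const_uminus: "const (- x) = - const x"
  by (simp add: const_def single_uminus)

lemma const_sum: "const (sum f A) = (\<Sum>a\<in>A. const (f a))"
  by (rule additive_sum) (auto simp: const_add)

lemma const_eq_0_iff [simp]: "const c = 0 \<longleftrightarrow> c = 0"
  using const_def by (metis single_zero lookup_single_eq lookup_zero)

lemma mono_0 [simp]: "mono 0 = 1" and mono_add: "mono (m + n) = mono m * mono n"
  by (simp_all add: mono_def mult_single)

lemma const_times_mono: "const c * mono m = single m c"
  by (simp add: const_def mono_def mult_single)

section \<open>Ideals of polynomial rings\<close>

lemma zero_mons [simp]: "0 \<in> mons V"
  by (simp add: mons_def)

lemma mons_add: "m \<in> mons V \<Longrightarrow> n \<in> mons V \<Longrightarrow> m + n \<in> mons V"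
  using Poly_Mapping.keys_add[of m n] by (auto simp: mons_def)

lemma mons_sum: "(\<And>a. a \<in> A \<Longrightarrow> g a \<in> mons V) \<Longrightarrow> sum g A \<in> mons V"
  by (induction A rule: infinite_finite_induct) (auto intro: mons_add)

lemma poly_ring_simps [simp]:
  "x \<otimes>\<^bsub>poly_ring V\<^esub> y = x * y" "x \<oplus>\<^bsub>poly_ring V\<^esub> y = x + y" "\<one>\<^bsub>poly_ring V\<^esub> = 1" "\<zero>\<^bsub>poly_ring V\<^esub> = 0"
  by (simp_all add: poly_ring_def)

lemma in_poly_ring_iff: "f \<in> carrier (poly_ring V) \<longleftrightarrow> supp f \<subseteq> mons V"
  by (simp add: poly_ring_def)

lemma term_in_poly_ring [simp]: "m \<in> mons V \<Longrightarrow> single m c \<in> carrier (poly_ring V)"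
  by (simp add: in_poly_ring_iff)

lemma poly_ring_add: "f \<in> carrier (poly_ring V) \<Longrightarrow> g \<in> carrier (poly_ring V) \<Longrightarrow> f + g \<in> carrier (poly_ring V)"
  using abelian_groupE(1)[OF abelian_group.intro] cring.axioms(1)[OF cring_poly_ring, of V]
    ring.ring_simprules(1)[of "poly_ring V" f g] by simp

lemma poly_ring_mult: "f \<in> carrier (poly_ring V) \<Longrightarrow> g \<in> carrier (poly_ring V) \<Longrightarrow> f * g \<in> carrier (poly_ring V)"
  using cring.axioms(1)[OF cring_poly_ring, of V] ring.ring_simprules(5)[of "poly_ring V" f g] by simp

lemma poly_ring_uminus: "f \<in> carrier (poly_ring V) \<Longrightarrow> - f \<in> carrier (poly_ring V)"
  by (simp add: in_poly_ring_iff)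

lemma poly_ring_diff: "f \<in> carrier (poly_ring V) \<Longrightarrow> g \<in> carrier (poly_ring V) \<Longrightarrow> f - g \<in> carrier (poly_ring V)"
  using poly_ring_add[of f V "- g"] poly_ring_uminus[of g V] by simp

lemma poly_ring_01 [simp]: "0 \<in> carrier (poly_ring V)" "1 \<in> carrier (poly_ring V)"
  by (auto simp: in_poly_ring_iff)

lemma poly_ring_sum: "(\<And>a. a \<in> A \<Longrightarrow> g a \<in> carrier (poly_ring V)) \<Longrightarrow> sum g A \<in> carrier (poly_ring V)"
  by (induction A rule: infinite_finite_induct) (auto intro: poly_ring_add)

lemma poly_ring_prod: "(\<And>a. a \<in> A \<Longrightarrow> g a \<in> carrier (poly_ring V)) \<Longrightarrow> prod g A \<in> carrier (poly_ring V)"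
  by (induction A rule: infinite_finite_induct) (auto intro: poly_ring_mult)

lemma poly_ring_power: "f \<in> carrier (poly_ring V) \<Longrightarrow> f ^ n \<in> carrier (poly_ring V)"
  by (induction n) (auto intro: poly_ring_mult)

lemma const_in_poly_ring [simp]: "const c \<in> carrier (poly_ring V)"
  by (simp add: const_def)

lemma mono_in_poly_ring [simp]: "m \<in> mons V \<Longrightarrow> mono m \<in> carrier (poly_ring V)"
  by (simp add: mono_def)

lemma var_in_poly_ring [simp]: "v \<in> V \<Longrightarrow> var v \<in> carrier (poly_ring V)"
  by (simp add: var_def mons_def)

lemma a_inv_poly_ring: "f \<in> carrier (poly_ring V) \<Longrightarrow> \<ominus>\<^bsub>poly_ring V\<^esub> f = - f"
  using cring_poly_ring[of V]
  by (metis abelian_group.minus_equality cring.axioms(1) poly_ring_simps(2,4) poly_ring_uminus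
      ring_def add.left_inverse)

lemma poly_ring_idealI:
  assumes "I \<subseteq> carrier (poly_ring V)" "0 \<in> I" "\<And>f g. f \<in> I \<Longrightarrow> g \<in> I \<Longrightarrow> f + g \<in> I"
    and mult: "\<And>f g. f \<in> I \<Longrightarrow> g \<in> carrier (poly_ring V) \<Longrightarrow> g * f \<in> I"
  shows "ideal I (poly_ring V)"
proof (rule idealI)
  show "ring (poly_ring V)" using cring_poly_ring cring.axioms(1) by blast
  have "- f \<in> I" if "f \<in> I" for f
    using mult[OF that, of "- 1"] poly_ring_uminus[of 1 V] by simp
  then show "subgroup I (add_monoid (poly_ring V))"
    using assms a_inv_poly_ring[of _ V, unfolded a_inv_def]
    by unfold_locales (auto simp: subset_iff)
qed (use mult in \<open>auto simp: mult.commute\<close>)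

lemma poly_ring_idealD:
  assumes "ideal I (poly_ring V)"
  shows "I \<subseteq> carrier (poly_ring V)" "0 \<in> I" "\<And>f g. f \<in> I \<Longrightarrow> g \<in> I \<Longrightarrow> f + g \<in> I"
    "\<And>f g. f \<in> I \<Longrightarrow> g \<in> carrier (poly_ring V) \<Longrightarrow> g * f \<in> I"
    "\<And>f. f \<in> I \<Longrightarrow> - f \<in> I" "\<And>f g. f \<in> I \<Longrightarrow> g \<in> I \<Longrightarrow> f - g \<in> I"
    "\<And>A h. (\<And>a. a \<in> A \<Longrightarrow> h a \<in> I) \<Longrightarrow> sum h A \<in> I"
proof -
  interpret ideal I "poly_ring V" by fact
  show sub: "I \<subseteq> carrier (poly_ring V)" using a_subset .
  show z: "0 \<in> I" using additive_subgroup.zero_closed[OF is_additive_subgroup] by simp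
  show add: "f + g \<in> I" if "f \<in> I" "g \<in> I" for f g
    using additive_subgroup.a_closed[OF is_additive_subgroup that] by simp
  show mult: "g * f \<in> I" if "f \<in> I" "g \<in> carrier (poly_ring V)" for f g
    using I_l_closed[OF that] by simp
  show neg: "- f \<in> I" if "f \<in> I" for f
    using mult[OF that, of "- 1"] poly_ring_uminus[of 1 V] by simp
  show "f - g \<in> I" if "f \<in> I" "g \<in> I" for f g
    using add[OF that(1) neg[OF that(2)]] by simp
  show "sum h A \<in> I" if "\<And>a. a \<in> A \<Longrightarrow> h a \<in> I" for A and h :: "'b \<Rightarrow> _"
    using that by (induction A rule: infinite_finite_induct) (auto intro: z add)
qed

lemma genideal_mem:
  assumes "S \<subseteq> carrier (poly_ring V)" "f \<in> S" shows "f \<in> genideal (poly_ring V) S"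
  using ring.genideal_self[OF cring.axioms(1)[OF cring_poly_ring] assms(1)] assms(2) by blast

lemma genideal_le:
  assumes "ideal I (poly_ring V)" "S \<subseteq> I" shows "genideal (poly_ring V) S \<subseteq> I"
  using assms by (auto simp: genideal_def)

lemma genideal_is_ideal: "S \<subseteq> carrier (poly_ring V) \<Longrightarrow> ideal (genideal (poly_ring V) S) (poly_ring V)"
  using ring.genideal_ideal[OF cring.axioms(1)[OF cring_poly_ring]] .

lemma kernel_primeideal:
  fixes \<phi> :: "'v cpoly \<Rightarrow> 'e::idom"
  assumes "\<phi> 1 = 1" "\<And>f g. \<phi> (f + g) = \<phi> f + \<phi> g" "\<And>f g. \<phi> (f * g) = \<phi> f * \<phi> g"
  shows "primeideal {f \<in> carrier (poly_ring V). \<phi> f = 0} (poly_ring V)"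
proof (rule primeidealI)
  have "\<phi> 0 = 0" using assms(2)[of 0 0] by (metis add.right_neutral add_cancel_right_right)
  then show "ideal {f \<in> carrier (poly_ring V). \<phi> f = 0} (poly_ring V)"
    by (intro poly_ring_idealI) (auto simp: assms intro: poly_ring_add poly_ring_mult)
  show "carrier (poly_ring V) \<noteq> {f \<in> carrier (poly_ring V). \<phi> f = 0}"
    using assms(1) poly_ring_01(2)[of V] by (metis (mono_tags, lifting) mem_Collect_eq zero_neq_one)
qed (use cring_poly_ring assms in auto)

section \<open>Parts of a polynomial\<close>

definition part :: "('m \<Rightarrow> bool) \<Rightarrow> ('m \<Rightarrow>\<^sub>0 'c) \<Rightarrow> ('m \<Rightarrow>\<^sub>0 'c::comm_monoid_add)" where
  "part P f = (\<Sum>m | m \<in> supp f \<and> P m. single m (coef f m))"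

lemma coef_part: "coef (part P f) m = (if P m then coef f m else 0)"
  by (auto simp: part_def lookup_sum lookup_single when_def in_keys_iff)

lemma supp_part: "supp (part P f) = {m \<in> supp f. P m}"
  by (auto simp: in_keys_iff coef_part split: if_splits)

lemma part_zero [simp]: "part P 0 = 0"
  by (simp add: part_def)

lemma sum_parts: "(\<Sum>x\<in>h ` supp f. part (\<lambda>m. h m = x) f) = f"
  by (rule poly_mapping_eqI) (auto simp: lookup_sum coef_part in_keys_iff)

lemma part_in_poly_ring: "f \<in> carrier (poly_ring V) \<Longrightarrow> part P f \<in> carrier (poly_ring V)"
  by (auto simp: in_poly_ring_iff supp_part)

lemma initial_form_eq_part:
  "initial_form w f = part (\<lambda>m. \<forall>m'\<in>supp f. mon_weight w m \<le> mon_weight w m') f"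
  by (simp add: initial_form_def part_def)

lemma mon_weight_add: "mon_weight w (m + n) = mon_weight w m + mon_weight w n"
  unfolding mon_weight_def
  by (rule setsum_keys_plus_distrib) (auto simp: distrib_right)

lemma mon_weight_0 [simp]: "mon_weight w 0 = 0"
  by (simp add: mon_weight_def)

lemma mon_weight_sum: "mon_weight w (sum g A) = (\<Sum>a\<in>A. mon_weight w (g a))"
  by (rule additive_sum) (auto simp: mon_weight_add)

lemma mon_weight_term [simp]: "mon_weight w (single v n) = real n * w v"
  by (simp add: mon_weight_def)

section \<open>Linear forms presenting a space of relations\<close>

text \<open>
  Relations are functions on all of \<open>nat\<close>; by the last clause only their first \<open>d\<close> values count.
\<close>

definition relation_space :: "nat \<Rightarrow> (nat \<Rightarrow> complex) set \<Rightarrow> bool" where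
  "relation_space d W \<longleftrightarrow> (\<lambda>_. 0) \<in> W \<and> (\<forall>x\<in>W. \<forall>y\<in>W. \<forall>c. (\<lambda>i. x i + c * y i) \<in> W) \<and>
     (\<forall>x y. (\<forall>i<d. x i = y i) \<longrightarrow> x \<in> W \<longrightarrow> y \<in> W)"

text \<open>
  For vectors \<open>t\<^sub>0, \<dots>, t\<^bsub>d-1\<^esub>\<close> whose linear relations are exactly the elements of \<open>W\<close>, the \<open>t\<^sub>j\<close> with
  \<open>j \<in> K\<close> form a basis of the span, and \<open>c i\<close> is the coordinate vector of \<open>t\<^sub>i\<close>.
\<close>

definition presents :: "nat \<Rightarrow> (nat \<Rightarrow> complex) set \<Rightarrow> nat set \<Rightarrow> (nat \<Rightarrow> nat \<Rightarrow> complex) \<Rightarrow> bool" where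
  "presents d W K c \<longleftrightarrow> K \<subseteq> {..<d} \<and> (\<forall>j\<in>K. \<forall>k. c j k = (if k = j then 1 else 0)) \<and>
     (\<forall>i<d. \<forall>k. k \<notin> K \<longrightarrow> c i k = 0) \<and>
     (\<forall>x. x \<in> W \<longleftrightarrow> (\<forall>j\<in>K. (\<Sum>i<d. x i * c i j) = 0))"

lemma relation_spaceD:
  assumes "relation_space d W"
  shows "(\<lambda>_. 0) \<in> W" "\<And>x y c. x \<in> W \<Longrightarrow> y \<in> W \<Longrightarrow> (\<lambda>i. x i + c * y i) \<in> W"
    "\<And>x y. x \<in> W \<Longrightarrow> (\<And>i. i < d \<Longrightarrow> x i = y i) \<Longrightarrow> y \<in> W"
  using assms unfolding relation_space_def by blast+

lemma relation_space_sum: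
  assumes "relation_space d W" "finite A" "\<And>a. a \<in> A \<Longrightarrow> f a \<in> W"
  shows "(\<lambda>i. \<Sum>a\<in>A. g a * f a i) \<in> W"
  using assms(2,3)
proof (induction A rule: finite_induct)
  case empty then show ?case using relation_spaceD(1)[OF assms(1)] by simp
next
  case (insert a A)
  then have "(\<lambda>i. (\<Sum>a\<in>A. g a * f a i) + g a * f a i) \<in> W"
    by (intro relation_spaceD(2)[OF assms(1)]) auto
  then show ?case using insert by (simp add: add.commute)
qed

text \<open>
  The greedy basis of a matroid has largest weight: run through the indices in order of decreasing
  \<open>\<tau>\<close> and keep \<open>t\<^sub>i\<close> unless it is a combination of those kept before.  A discarded
  \<open>t\<^sub>i\<close> is then a combination of kept elements that precede it, hence of weight at least \<open>\<tau> i\<close>.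
\<close>

lemma exists_presentation:
  fixes \<tau> :: "nat \<Rightarrow> real"
  assumes W: "relation_space d W"
  obtains K c where "presents d W K c" "\<And>i j. i < d \<Longrightarrow> c i j \<noteq> 0 \<Longrightarrow> \<tau> i \<le> \<tau> j"
proof -
  define unit where "unit = (\<lambda>i k::nat. if k = i then 1 else (0::complex))"
  define indep where "indep K = (\<forall>x\<in>W. (\<forall>k. k \<notin> K \<longrightarrow> x k = 0) \<longrightarrow> (\<forall>k. x k = 0))" for K
  define rep where "rep K i v \<longleftrightarrow> (\<forall>k. k \<notin> K \<longrightarrow> v k = 0) \<and> (\<forall>k. v k \<noteq> 0 \<longrightarrow> \<tau> i \<le> \<tau> k)
     \<and> (\<lambda>k. unit i k + (- 1) * v k) \<in> W" for K i v
  have self: "rep K i (unit i)" if "i \<in> K" for K i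
    using that relation_spaceD(1)[OF W] by (auto simp: rep_def unit_def)
  have "\<exists>K\<subseteq>T. indep K \<and> (\<forall>i\<in>T. \<exists>v. rep K i v)" if "finite T" for T
    using that
  proof (induction T rule: finite_ranking_induct[where f = "\<lambda>i. - \<tau> i"])
    case empty then show ?case by (auto simp: indep_def)
  next
    case (insert x S)
    then obtain K where K: "K \<subseteq> S" "indep K" and rep: "\<And>i. i \<in> S \<Longrightarrow> \<exists>v. rep K i v" by blast
    have \<tau>x: "\<tau> x \<le> \<tau> y" if "y \<in> S" for y using insert that by auto
    show ?case
    proof (cases "\<exists>v. rep K x v")
      case True then show ?thesis using K rep by (intro exI[of _ K]) auto
    next
      case False
      have "indep (insert x K)"
        unfolding indep_def
      proof (intro ballI impI)
        fix z assume z: "z \<in> W" "\<forall>k. k \<notin> insert x K \<longrightarrow> z k = 0"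
        have "z x = 0"
        proof (rule ccontr)
          assume nz: "z x \<noteq> 0"
          define v where "v k = (if k = x then 0 else - z k / z x)" for k
          have "(\<lambda>k. 0 + (1 / z x) * z k) \<in> W"
            by (rule relation_spaceD(2)[OF W relation_spaceD(1)[OF W] z(1)])
          moreover have "(\<lambda>k. 0 + (1 / z x) * z k) = (\<lambda>k. unit x k + (- 1) * v k)"
            using nz by (auto simp: v_def unit_def)
          moreover have "\<tau> x \<le> \<tau> k" if "v k \<noteq> 0" for k
            using that z(2) K(1) \<tau>x by (auto simp: v_def split: if_splits)
          ultimately have "rep K x v" using z(2) by (auto simp: rep_def v_def)
          then show False using False by blast
        qed
        then have "\<forall>k. k \<notin> K \<longrightarrow> z k = 0" using z(2) by auto
        then show "\<forall>k. z k = 0" using K(2) z(1) unfolding indep_def by blast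
      qed
      moreover have "\<exists>v. rep (insert x K) i v" if "i \<in> insert x S" for i
      proof (cases "i = x")
        case True then show ?thesis using self by blast
      next
        case False
        then obtain v where "rep K i v" using rep \<open>i \<in> insert x S\<close> by blast
        then have "rep (insert x K) i v" unfolding rep_def by blast
        then show ?thesis by blast
      qed
      ultimately show ?thesis using K(1) by (intro exI[of _ "insert x K"]) auto
    qed
  qed
  from this[of "{..<d}"] obtain K where K: "K \<subseteq> {..<d}" "indep K"
    and ex: "\<And>i. i < d \<Longrightarrow> \<exists>v. rep K i v" by auto
  define c where "c i = (if i \<in> K then unit i else (SOME v. rep K i v))" for i
  have c: "rep K i (c i)" if "i < d" for i
    using self[of i K] someI_ex[OF ex[OF that]] by (simp add: c_def)
  have iff: "x \<in> W \<longleftrightarrow> (\<forall>j\<in>K. (\<Sum>i<d. x i * c i j) = 0)" for x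
  proof -
    \<comment> \<open>modulo the relations, every vector has a unique representative supported on \<open>K\<close>\<close>
    define v where "v = (\<lambda>k. \<Sum>i<d. x i * c i k)"
    have "(\<lambda>k. \<Sum>i<d. x i * (unit i k + (- 1) * c i k)) \<in> W"
      by (rule relation_space_sum[OF W]) (use c in \<open>auto simp: rep_def\<close>)
    moreover have "(\<Sum>i<d. x i * (unit i k + (- 1) * c i k)) = x k + (- 1) * v k" if "k < d" for k
    proof -
      have "(\<Sum>i<d. x i * unit i k) = x k"
        using that by (simp add: unit_def if_distrib cong: if_cong)
      then show ?thesis by (simp add: v_def algebra_simps sum.distrib sum_subtractf)
    qed
    ultimately have diff: "(\<lambda>k. x k + (- 1) * v k) \<in> W"
      by (rule relation_spaceD(3)[OF W])
    have vK: "v k = 0" if "k \<notin> K" for k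
      unfolding v_def using c that by (intro sum.neutral) (auto simp: rep_def)
    have "x \<in> W \<longleftrightarrow> v \<in> W"
    proof
      assume "x \<in> W"
      from relation_spaceD(2)[OF W this diff, of "- 1"] show "v \<in> W" by simp
    next
      assume "v \<in> W"
      from relation_spaceD(2)[OF W diff this, of 1] show "x \<in> W" by simp
    qed
    also have "\<dots> \<longleftrightarrow> (\<forall>k. v k = 0)"
    proof
      assume "v \<in> W" then show "\<forall>k. v k = 0" using K(2) vK unfolding indep_def by blast
    next
      assume "\<forall>k. v k = 0"
      then have "v = (\<lambda>_. 0)" by auto
      then show "v \<in> W" using relation_spaceD(1)[OF W] by simp
    qed
    also have "\<dots> \<longleftrightarrow> (\<forall>j\<in>K. v j = 0)" using vK by blast
    finally show ?thesis by (simp add: v_def)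
  qed
  show ?thesis
  proof (rule that)
    have "c i k = 0" if "i < d" "k \<notin> K" for i k
      using c[OF that(1)] that(2) by (simp add: rep_def)
    then show "presents d W K c"
      unfolding presents_def using K(1) iff by (auto simp: c_def unit_def)
    show "\<tau> i \<le> \<tau> j" if "i < d" "c i j \<noteq> 0" for i j
      using c[OF that(1)] that(2) by (auto simp: rep_def)
  qed
qed

text \<open>
  The relation that expresses \<open>t\<^sub>i\<close> in the basis.
\<close>

lemma presents_unit:
  assumes P: "presents d W K c" and i: "i < d"
  shows "(\<lambda>k. (if k = i then 1 else 0) - c i k) \<in> W"
    and "(\<Sum>k<d. ((if k = i then 1 else 0) - c i k) * y k) = y i - (\<Sum>k\<in>K. c i k * y k)"
proof -
  have K: "K \<subseteq> {..<d}" "finite K" using P finite_subset by (auto simp: presents_def)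
  show sum: "(\<Sum>k<d. ((if k = i then 1 else 0) - c i k) * y k) = y i - (\<Sum>k\<in>K. c i k * y k)" for y
  proof -
    have "(\<Sum>k<d. ((if k = i then 1 else 0) - c i k) * y k)
        = (\<Sum>k<d. if k = i then y i else 0) - (\<Sum>k<d. c i k * y k)"
      unfolding sum_subtractf[symmetric] by (intro sum.cong) (auto simp: algebra_simps)
    also have "(\<Sum>k<d. c i k * y k) = (\<Sum>k\<in>K. c i k * y k)"
      using K P i by (intro sum.mono_neutral_right) (auto simp: presents_def)
    finally show ?thesis using i by simp
  qed
  have "(\<Sum>k<d. ((if k = i then 1 else 0) - c i k) * c k j) = 0" if j: "j \<in> K" for j
  proof -
    have "(\<Sum>k\<in>K. c i k * c k j) = (\<Sum>k\<in>K. if k = j then c i j else 0)"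
      using P j by (intro sum.cong) (auto simp: presents_def)
    then show ?thesis unfolding sum using j K by simp
  qed
  then show "(\<lambda>k. (if k = i then 1 else 0) - c i k) \<in> W" using P by (simp add: presents_def)
qed

definition lin_form :: "nat set \<Rightarrow> (nat \<Rightarrow> complex) \<Rightarrow> nat cpoly" where
  "lin_form K v = (\<Sum>j\<in>K. const (v j) * var j)"

lemma coef_lin_form: "finite K \<Longrightarrow> j \<in> K \<Longrightarrow> coef (lin_form K v) (single j 1) = v j"
proof -
  assume K: "finite K" "j \<in> K"
  have "coef (const c * var k) (single j 1) = (if k = j then c else 0)" for c k
    unfolding var_def const_times_mono
    by (metis lookup_single_eq lookup_single_not_eq lookup_single zero_neq_one)
  then show ?thesis using K by (simp add: lin_form_def lookup_sum)
qed

lemma lin_form_eq_0_iff: "finite K \<Longrightarrow> lin_form K v = 0 \<longleftrightarrow> (\<forall>j\<in>K. v j = 0)"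
  using coef_lin_form[of K _ v] by (auto simp: lin_form_def)

lemma lin_form_combination:
  "(\<Sum>i\<in>A. const (x i) * lin_form K (c i)) = lin_form K (\<lambda>j. \<Sum>i\<in>A. x i * c i j)"
  unfolding lin_form_def sum_distrib_left const_sum sum_distrib_right const_mult mult.assoc
  by (rule sum.swap)

lemma lin_form_unit: "finite K \<Longrightarrow> j \<in> K \<Longrightarrow> lin_form K (\<lambda>k. if k = j then 1 else 0) = var j"
  by (simp add: lin_form_def if_distrib[of const] if_distrib[of "\<lambda>x. x * _"] cong: if_cong)

definition lpow :: "nat \<Rightarrow> (nat \<Rightarrow> 'e) \<Rightarrow> nat mon \<Rightarrow> 'e::comm_ring_1" where
  "lpow d l \<beta> = (\<Prod>i<d. l i ^ coef \<beta> i)"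

lemma lpow_0 [simp]: "lpow d l 0 = 1"
  by (simp add: lpow_def)

lemma lpow_add: "lpow d l (\<beta> + \<beta>') = lpow d l \<beta> * lpow d l \<beta>'"
  by (simp add: lpow_def lookup_add power_add prod.distrib)

lemma lpow_nonzero:
  fixes l :: "nat \<Rightarrow> 'e::idom"
  shows "(\<And>i. i < d \<Longrightarrow> l i \<noteq> 0) \<Longrightarrow> lpow d l \<beta> \<noteq> 0"
  by (simp add: lpow_def)

lemma lpow_single: assumes "i < d" shows "lpow d l (single i 1) = l i"
proof -
  have "lpow d l (single i 1) = (\<Prod>k<d. if k = i then l i else 1)"
    unfolding lpow_def by (intro prod.cong) (auto simp: lookup_single when_def)
  then show ?thesis using assms by simp
qed

lemma lpow_evaluation: "evaluation const (lpow d l)"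
  by unfold_locales (auto simp: const_add const_mult lpow_add)

section \<open>Leading parts with respect to a weight\<close>

text \<open>
  The part of \<open>p\<close> of weight \<open>\<omega>\<close> is \<open>p0\<close> and all other terms are heavier.  The value \<open>p0 = 0\<close> is
  allowed and then says that all terms of \<open>p\<close> are heavier than \<open>\<omega>\<close>.
\<close>

definition leads :: "('v \<Rightarrow> real) \<Rightarrow> real \<Rightarrow> 'v cpoly \<Rightarrow> 'v cpoly \<Rightarrow> bool" where
  "leads \<tau> \<omega> p p0 \<longleftrightarrow> (\<forall>m\<in>supp p0. mon_weight \<tau> m = \<omega>) \<and> (\<forall>m\<in>supp (p - p0). \<omega> < mon_weight \<tau> m)"

lemma leads_mult:
  assumes "leads \<tau> \<alpha> p p0" "leads \<tau> \<beta> q q0"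
  shows "leads \<tau> (\<alpha> + \<beta>) (p * q) (p0 * q0)"
proof -
  have p: "\<And>m. m \<in> supp p0 \<Longrightarrow> mon_weight \<tau> m = \<alpha>" "\<And>m. m \<in> supp (p - p0) \<Longrightarrow> \<alpha> < mon_weight \<tau> m"
    and q: "\<And>m. m \<in> supp q0 \<Longrightarrow> mon_weight \<tau> m = \<beta>" "\<And>m. m \<in> supp (q - q0) \<Longrightarrow> \<beta> < mon_weight \<tau> m"
    using assms by (auto simp: leads_def)
  have eq: "p * q - p0 * q0 = (p - p0) * (q - q0) + (p - p0) * q0 + p0 * (q - q0)"
    by (simp add: algebra_simps)
  have "\<alpha> + \<beta> < mon_weight \<tau> m" if m: "m \<in> supp (p * q - p0 * q0)" for m
  proof -
    have "m \<in> supp ((p - p0) * (q - q0)) \<union> supp ((p - p0) * q0) \<union> supp (p0 * (q - q0))"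
      using m unfolding eq
      using Poly_Mapping.keys_add[of "(p - p0) * (q - q0) + (p - p0) * q0" "p0 * (q - q0)"]
        Poly_Mapping.keys_add[of "(p - p0) * (q - q0)" "(p - p0) * q0"] by auto
    then consider a b where "m = a + b" "a \<in> supp (p - p0)" "b \<in> supp (q - q0)"
      | a b where "m = a + b" "a \<in> supp (p - p0)" "b \<in> supp q0"
      | a b where "m = a + b" "a \<in> supp p0" "b \<in> supp (q - q0)"
      using keys_mult[of "p - p0" "q - q0"] keys_mult[of "p - p0" q0] keys_mult[of p0 "q - q0"] by auto
    then show ?thesis
      by cases (use p q in \<open>force simp: mon_weight_add\<close>)+
  qed
  moreover have "mon_weight \<tau> m = \<alpha> + \<beta>" if "m \<in> supp (p0 * q0)" for m
    using subsetD[OF keys_mult that] p(1) q(1) by (auto simp: mon_weight_add)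
  ultimately show ?thesis by (auto simp: leads_def)
qed

lemma leads_1: "leads \<tau> 0 1 1"
  by (simp add: leads_def)

lemma leads_power: "leads \<tau> \<alpha> p p0 \<Longrightarrow> leads \<tau> (real n * \<alpha>) (p ^ n) (p0 ^ n)"
  by (induction n) (auto simp: leads_1 distrib_right dest: leads_mult)

lemma leads_lpow:
  assumes "\<And>i. i < d \<Longrightarrow> leads \<tau> (\<tau> i) (l i) (l0 i)"
  shows "leads \<tau> (\<Sum>i<d. real (coef \<beta> i) * \<tau> i) (lpow d l \<beta>) (lpow d l0 \<beta>)"
  using assms unfolding lpow_def
  by (induction d) (auto simp: leads_1 intro!: leads_mult leads_power)

lemma leads_const: "leads \<tau> \<omega> p p0 \<Longrightarrow> leads \<tau> \<omega> (const c * p) (const c * p0)"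
  using leads_mult[of \<tau> 0 "const c" "const c" \<omega> p p0]
  by (auto simp: leads_def const_def split: if_splits)

lemma leads_sum: "(\<And>a. a \<in> A \<Longrightarrow> leads \<tau> \<omega> (p a) (p0 a)) \<Longrightarrow> leads \<tau> \<omega> (sum p A) (sum p0 A)"
  unfolding leads_def
  by (auto simp flip: sum_subtractf dest!: subsetD[OF Poly_Mapping.keys_sum])

section \<open>Ideals of monomial algebras cut out by linear relations\<close>

text \<open>
  The monomials in the variables \<open>V\<close> are sorted into fibres by a character \<open>\<Gamma>\<close>.  The map \<open>b\<close>
  gives the exponents with which \<open>d\<close> linear forms enter when a monomial is evaluated.
\<close>

locale fibred_monomials =
  fixes V :: "'v set" and d :: nat and \<Gamma> :: "'v mon \<Rightarrow> (nat \<Rightarrow>\<^sub>0 int)" and b :: "'v mon \<Rightarrow> nat mon"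
  assumes \<Gamma>_add: "\<Gamma> (m + n) = \<Gamma> m + \<Gamma> n" and b_add: "b (m + n) = b m + b n"
    and b_supp: "m \<in> mons V \<Longrightarrow> supp (b m) \<subseteq> {..<d}"
begin

lemma \<Gamma>_0 [simp]: "\<Gamma> 0 = 0" and b_0 [simp]: "b 0 = 0"
  using \<Gamma>_add[of 0 0] b_add[of 0 0] by auto

lemma \<Gamma>_sum: "\<Gamma> (sum g A) = (\<Sum>a\<in>A. \<Gamma> (g a))" and b_sum: "b (sum g A) = (\<Sum>a\<in>A. b (g a))"
  by (rule additive_sum; simp add: \<Gamma>_add b_add)+

definition fibre_sum :: "(nat \<Rightarrow> nat cpoly) \<Rightarrow> (nat \<Rightarrow>\<^sub>0 int) \<Rightarrow> 'v cpoly \<Rightarrow> nat cpoly" where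
  "fibre_sum l \<gamma> f = (\<Sum>m | m \<in> supp f \<and> \<Gamma> m = \<gamma>. const (coef f m) * lpow d l (b m))"

definition fibre_ideal :: "(nat \<Rightarrow> nat cpoly) \<Rightarrow> 'v cpoly set" where
  "fibre_ideal l = {f \<in> carrier (poly_ring V). \<forall>\<gamma>. fibre_sum l \<gamma> f = 0}"

text \<open>
  All fibre sums at once, as an element of the group algebra of the characters.  This algebra is
  an integral domain because the group of characters carries a linear order.
\<close>

definition collect :: "(nat \<Rightarrow> nat cpoly) \<Rightarrow> 'v cpoly \<Rightarrow> (nat \<Rightarrow>\<^sub>0 int) \<Rightarrow>\<^sub>0 nat cpoly" where
  "collect l = eval_pm (\<lambda>c. single 0 (const c)) (\<lambda>m. single (\<Gamma> m) (lpow d l (b m)))"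

lemma collect_evaluation:
  fixes l :: "nat \<Rightarrow> nat cpoly"
  shows "evaluation (\<lambda>c. single 0 (const c)) (\<lambda>m. single (\<Gamma> m) (lpow d l (b m)))"
  by unfold_locales (auto simp: const_add const_mult single_add mult_single \<Gamma>_add b_add lpow_add)

lemmas collect_simps =
  evaluation.ev_0[OF collect_evaluation, folded collect_def]
  evaluation.ev_1[OF collect_evaluation, folded collect_def]
  evaluation.ev_add[OF collect_evaluation, folded collect_def]
  evaluation.ev_diff[OF collect_evaluation, folded collect_def]
  evaluation.ev_mult[OF collect_evaluation, folded collect_def]
  evaluation.ev_sum[OF collect_evaluation, folded collect_def]

lemma collect_single: "collect l (single m c) = single (\<Gamma> m) (const c * lpow d l (b m))"
  unfolding collect_def by (simp add: evaluation.ev_term[OF collect_evaluation] mult_single)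

lemma coef_collect: "coef (collect l f) \<gamma> = fibre_sum l \<gamma> f"
proof -
  have "coef (collect l f) \<gamma>
      = (\<Sum>m\<in>supp f. if \<Gamma> m = \<gamma> then const (coef f m) * lpow d l (b m) else 0)"
    by (auto simp: collect_def eval_pm_def mult_single lookup_sum lookup_single when_def
        intro!: sum.cong)
  also have "\<dots> = fibre_sum l \<gamma> f"
    by (simp add: fibre_sum_def sum.inter_filter)
  finally show ?thesis .
qed

lemma fibre_sum_simps [simp]:
  "fibre_sum l \<gamma> 0 = 0"
  "fibre_sum l \<gamma> (f + g) = fibre_sum l \<gamma> f + fibre_sum l \<gamma> g"
  "fibre_sum l \<gamma> (f - g) = fibre_sum l \<gamma> f - fibre_sum l \<gamma> g"
  by (simp_all flip: coef_collect add: collect_simps lookup_add lookup_minus)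

lemma fibre_sum_sum: "fibre_sum l \<gamma> (sum h A) = (\<Sum>a\<in>A. fibre_sum l \<gamma> (h a))"
  by (rule additive_sum) auto

lemma fibre_sum_single:
  "fibre_sum l \<gamma> (single m c) = (if \<Gamma> m = \<gamma> then const c * lpow d l (b m) else 0)"
  by (simp flip: coef_collect add: collect_single lookup_single when_def)

lemma fibre_sum_part:
  "fibre_sum l \<gamma> (part P f)
    = (\<Sum>m | m \<in> supp f \<and> \<Gamma> m = \<gamma>. if P m then const (coef f m) * lpow d l (b m) else 0)"
  unfolding fibre_sum_def supp_part
  by (rule sum.mono_neutral_cong_left) (auto simp: coef_part)

lemma fibre_ideal_eq_kernel: "fibre_ideal l = {f \<in> carrier (poly_ring V). collect l f = 0}"
  unfolding fibre_ideal_def by (simp add: poly_mapping_eq_iff fun_eq_iff coef_collect)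

text \<open>
  The moment ideal, the ideal of the embedding and its initial ideals are all of this form, with
  different linear forms, and this is why they are prime.
\<close>

lemma fibre_ideal_prime: "primeideal (fibre_ideal l) (poly_ring V)"
  unfolding fibre_ideal_eq_kernel by (rule kernel_primeideal) (simp_all add: collect_simps)

text \<open>
  Replacing each \<open>t\<^sub>j\<close>, \<open>j \<in> K\<close>, by its expansion in the basis \<open>K'\<close> carries the linear forms of the
  first presentation to those of the second, and so carries fibre sums to fibre sums.  By symmetry
  the ideal depends on the relations alone.
\<close>

lemma fibre_ideal_presents_le:
  assumes P: "presents d W K c" and P': "presents d W K' c'"
  shows "fibre_ideal (\<lambda>i. lin_form K (c i)) \<subseteq> fibre_ideal (\<lambda>i. lin_form K' (c' i))"
proof -
  let ?l = "\<lambda>i. lin_form K (c i)" and ?l' = "\<lambda>i. lin_form K' (c' i)"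
  define \<sigma> where "\<sigma> = eval_pm const (lpow d ?l')"
  interpret evaluation const "lpow d ?l'" by (rule lpow_evaluation)
  have K: "K \<subseteq> {..<d}" "finite K" using P finite_subset by (auto simp: presents_def)
  have \<sigma>_const: "\<sigma> (const x) = const x" for x
    unfolding \<sigma>_def const_def[of x] ev_term by simp
  have \<sigma>_var: "\<sigma> (var j) = ?l' j" if "j < d" for j
    using lpow_single[OF that, of ?l'] by (simp add: \<sigma>_def var_def mono_def)
  have \<sigma>_l: "\<sigma> (?l i) = ?l' i" if i: "i < d" for i
  proof -
    have "(\<Sum>k<d. ((if k = i then 1 else 0) - c i k) * c' k j) = 0" if "j \<in> K'" for j
      using P' that presents_unit(1)[OF P i] by (auto simp: presents_def)
    then have "(\<Sum>k\<in>K. c i k * c' k j) = c' i j" if "j \<in> K'" for j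
      using that presents_unit(2)[OF P i, of "\<lambda>k. c' k j"] by simp
    then have "lin_form K' (\<lambda>j. \<Sum>k\<in>K. c i k * c' k j) = ?l' i"
      unfolding lin_form_def by (intro sum.cong) auto
    then have "(\<Sum>k\<in>K. const (c i k) * ?l' k) = ?l' i"
      using lin_form_combination[of "c i" K' c' K] by simp
    moreover have "\<sigma> (?l i) = (\<Sum>k\<in>K. \<sigma> (const (c i k)) * \<sigma> (var k))"
      unfolding \<sigma>_def lin_form_def[of K "c i"] by (simp add: ev_sum)
    moreover have "(\<Sum>k\<in>K. \<sigma> (const (c i k)) * \<sigma> (var k)) = (\<Sum>k\<in>K. const (c i k) * ?l' k)"
      using K by (intro sum.cong) (auto simp: \<sigma>_const \<sigma>_var)
    ultimately show ?thesis by simp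
  qed
  have "\<sigma> (fibre_sum ?l \<gamma> f) = fibre_sum ?l' \<gamma> f" for \<gamma> f
  proof -
    have "\<sigma> (lpow d ?l \<beta>) = lpow d ?l' \<beta>" for \<beta>
      using \<sigma>_l unfolding \<sigma>_def lpow_def[of d _ \<beta>] by (simp add: ev_prod)
    then show ?thesis
      using \<sigma>_const unfolding \<sigma>_def fibre_sum_def by (simp add: ev_sum)
  qed
  moreover have "\<sigma> 0 = 0" by (simp add: \<sigma>_def)
  ultimately show ?thesis unfolding fibre_ideal_def by (auto, metis)
qed

end

lemma initial_form_dominant:
  assumes "f \<noteq> 0" "\<And>m. m \<in> supp f \<Longrightarrow> mon_weight w m = \<omega>" "\<And>m. m \<in> supp g \<Longrightarrow> \<omega> < mon_weight w m"
  shows "initial_form w (f + g) = f"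
proof (rule poly_mapping_eqI)
  fix m
  have sub: "supp (f + g) \<subseteq> supp f \<union> supp g" by (rule Poly_Mapping.keys_add)
  have fin: "m' \<in> supp (f + g) \<and> coef (f + g) m' = coef f m'" if "m' \<in> supp f" for m'
  proof -
    have "m' \<notin> supp g" using assms(2,3) that by fastforce
    then show ?thesis using that by (simp add: in_keys_iff lookup_add)
  qed
  show "coef (initial_form w (f + g)) m = coef f m"
  proof (cases "m \<in> supp f")
    case True
    then have "\<forall>m'\<in>supp (f + g). mon_weight w m \<le> mon_weight w m'"
      using sub assms(2,3) by (metis Un_iff less_eq_real_def subsetD)
    then show ?thesis using fin[OF True] by (simp add: initial_form_eq_part coef_part)
  next
    case False
    obtain m0 where m0: "m0 \<in> supp f" using assms(1) by (metis keys_eq_empty ex_in_conv)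
    show ?thesis
    proof (cases "m \<in> supp g")
      case True
      then have "\<not> mon_weight w m \<le> mon_weight w m0" using assms(2)[OF m0] assms(3) by fastforce
      then show ?thesis using fin[OF m0] False
        by (auto simp: initial_form_eq_part coef_part in_keys_iff)
    next
      case g: False
      then show ?thesis using False by (auto simp: initial_form_eq_part coef_part in_keys_iff lookup_add)
    qed
  qed
qed

lemma leads_higher: "leads \<tau> \<omega>' p p0 \<Longrightarrow> \<omega> < \<omega>' \<Longrightarrow> leads \<tau> \<omega> p 0"
  using Poly_Mapping.keys_add[of p0 "p - p0"] unfolding leads_def by (auto dest!: subsetD)

lemma leads_0: "leads \<tau> \<omega> 0 q \<Longrightarrow> q = 0"
  unfolding leads_def by (metis diff_0 keys_eq_empty keys_minus less_irrefl ex_in_conv)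

lemma supp_lin_form: "supp (lin_form K v) \<subseteq> {single j 1 | j. j \<in> K \<and> v j \<noteq> 0}"
proof -
  have "supp (const c * var j) \<subseteq> (if c = 0 then {} else {single j 1})" for c and j :: nat
    unfolding var_def const_times_mono by simp
  then have "supp (const (v j) * var j) \<subseteq> {single j 1 | j. j \<in> K \<and> v j \<noteq> 0}" if "j \<in> K" for j
    using that by (force split: if_splits)
  then have "(\<Union>j\<in>K. supp (const (v j) * var j)) \<subseteq> {single j 1 | j. j \<in> K \<and> v j \<noteq> 0}"
    by (rule UN_least)
  then show ?thesis
    unfolding lin_form_def using Poly_Mapping.keys_sum[of "\<lambda>j. const (v j) * var j" K] by blast
qed

lemma lin_form_in_poly_ring: "lin_form K v \<in> carrier (poly_ring K)"
  unfolding lin_form_def by (intro poly_ring_sum poly_ring_mult) auto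

lemma mono_nonzero [simp]: "mono m \<noteq> 0"
  unfolding mono_def by (metis lookup_single_eq lookup_zero zero_neq_one)

section \<open>Initial ideals at tropical weights\<close>

text \<open>
  The monomial \<open>u i\<close> plays the role of \<open>t\<^sub>i\<close>.  By \<open>least\<close>, every fibre contains a monomial whose
  exponents \<open>b\<close> are simultaneously minimal, so that the corresponding power of the linear forms
  divides all fibre sums over that fibre.  For the moment map this is the monomial
  \<open>x\<^bsup>c+\<^esup> y\<^bsup>c-\<^esup>\<close> in the fibre over \<open>c\<close>.
\<close>

locale hypertoric_monomials = fibred_monomials V d \<Gamma> b
  for V :: "'v set" and d \<Gamma> b +
  fixes W :: "(nat \<Rightarrow> complex) set" and u :: "nat \<Rightarrow> 'v mon"
  assumes W: "relation_space d W"
    and unit_notin_W: "i < d \<Longrightarrow> (\<lambda>k. if k = i then 1 else 0) \<notin> W"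
    and u: "i < d \<Longrightarrow> u i \<in> mons V" "i < d \<Longrightarrow> \<Gamma> (u i) = 0" "i < d \<Longrightarrow> b (u i) = single i 1"
    and least: "m \<in> mons V \<Longrightarrow> \<exists>m0\<in>mons V. \<Gamma> m0 = \<Gamma> m \<and>
        (\<forall>n\<in>mons V. \<Gamma> n = \<Gamma> m \<longrightarrow> (\<forall>i. coef (b m0) i \<le> coef (b n) i))"
begin

text \<open>
  Quantifying over all presentations spares a choice, since all of them give the same ideal.
\<close>

definition relation_ideal :: "'v cpoly set" where
  "relation_ideal = {f. \<forall>K c. presents d W K c \<longrightarrow> f \<in> fibre_ideal (\<lambda>i. lin_form K (c i))}"

lemma relation_ideal_eq:
  assumes "presents d W K c"
  shows "relation_ideal = fibre_ideal (\<lambda>i. lin_form K (c i))"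
  using assms fibre_ideal_presents_le[OF assms] unfolding relation_ideal_def by auto

lemma ex_presents: "\<exists>K c. presents d W K c"
  using exists_presentation[OF W, of "\<lambda>_. 0"] by metis

lemma presents_lin_form_nonzero:
  assumes "presents d W K c" "i < d" shows "lin_form K (c i) \<noteq> 0"
proof -
  have "(\<Sum>k<d. (if k = i then 1 else 0) * c k j) = c i j" for j
  proof -
    have "(\<Sum>k<d. (if k = i then 1 else 0) * c k j) = (\<Sum>k<d. if k = i then c i j else 0)"
      by (intro sum.cong) auto
    then show ?thesis using assms(2) by simp
  qed
  then have "\<not> (\<forall>j\<in>K. c i j = 0)"
    using unit_notin_W[OF assms(2)] assms(1) unfolding presents_def by simp
  moreover have "finite K" using assms(1) finite_subset unfolding presents_def by blast
  ultimately show ?thesis by (simp add: lin_form_eq_0_iff)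
qed

lemma relation_ideal_prime: "primeideal relation_ideal (poly_ring V)"
  using ex_presents relation_ideal_eq fibre_ideal_prime by metis

lemma mono_notin_relation_ideal: "mono m \<notin> relation_ideal"
proof -
  obtain K c where P: "presents d W K c" using ex_presents by blast
  have "lpow d (\<lambda>i. lin_form K (c i)) (b m) \<noteq> 0"
    by (intro lpow_nonzero presents_lin_form_nonzero[OF P])
  then have "fibre_sum (\<lambda>i. lin_form K (c i)) (\<Gamma> m) (mono m) \<noteq> 0"
    by (simp add: mono_def fibre_sum_single)
  then show ?thesis unfolding relation_ideal_eq[OF P] fibre_ideal_def by blast
qed

definition lift :: "nat mon \<Rightarrow> 'v mon" where
  "lift \<beta> = (\<Sum>i<d. \<Sum>k<coef \<beta> i. u i)"

lemma lift_mons: "lift \<beta> \<in> mons V"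
  unfolding lift_def by (intro mons_sum) (auto intro: u)

lemma \<Gamma>_lift: "\<Gamma> (lift \<beta>) = 0"
  unfolding lift_def by (auto simp: \<Gamma>_sum u intro!: sum.neutral)

lemma b_lift: assumes "supp \<beta> \<subseteq> {..<d}" shows "b (lift \<beta>) = \<beta>"
proof (rule poly_mapping_eqI)
  fix k
  have "coef (b (lift \<beta>)) k = (\<Sum>i<d. coef \<beta> i * coef (b (u i)) k)"
    unfolding lift_def b_sum lookup_sum by simp
  also have "\<dots> = (\<Sum>i<d. if i = k then coef \<beta> k else 0)"
    by (intro sum.cong) (auto simp: u lookup_single)
  also have "\<dots> = coef \<beta> k"
    using assms by (auto simp: in_keys_iff)
  finally show "coef (b (lift \<beta>)) k = coef \<beta> k" .
qed

lemma mon_weight_lift: "mon_weight w (lift \<beta>) = (\<Sum>i<d. real (coef \<beta> i) * mon_weight w (u i))"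
  by (simp add: lift_def mon_weight_sum)

lemma ideal_relation_ideal: "ideal relation_ideal (poly_ring V)"
  using relation_ideal_prime primeideal.axioms(1) by blast

lemma initial_ideal_mem: "f \<in> relation_ideal \<Longrightarrow> initial_form w f \<in> initial_ideal V w relation_ideal"
  and initial_ideal_is_ideal: "ideal (initial_ideal V w relation_ideal) (poly_ring V)"
proof -
  have sub: "initial_form w ` relation_ideal \<subseteq> carrier (poly_ring V)"
    using poly_ring_idealD(1)[OF ideal_relation_ideal]
    by (auto simp: initial_form_eq_part intro: part_in_poly_ring)
  show "f \<in> relation_ideal \<Longrightarrow> initial_form w f \<in> initial_ideal V w relation_ideal"
    unfolding initial_ideal_def using genideal_mem[OF sub] by blast
  show "ideal (initial_ideal V w relation_ideal) (poly_ring V)"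
    unfolding initial_ideal_def by (rule genideal_is_ideal[OF sub])
qed

text \<open>
  The difference of two such monomials lies in the ideal.  If they had different weights, its
  initial form would be a monomial up to sign.
\<close>

lemma Trop_binomial:
  assumes w: "w \<in> Trop V relation_ideal"
    and mn: "m \<in> mons V" "n \<in> mons V" "\<Gamma> m = \<Gamma> n" "b m = b n"
  shows "mon_weight w m = mon_weight w n"
proof -
  have "\<not> mon_weight w m < mon_weight w n"
    if mn: "m \<in> mons V" "n \<in> mons V" "\<Gamma> m = \<Gamma> n" "b m = b n" for m n
  proof
    assume lt: "mon_weight w m < mon_weight w n"
    obtain K c where P: "presents d W K c" using ex_presents by blast
    have "mono m - mono n \<in> relation_ideal"
      unfolding relation_ideal_eq[OF P] fibre_ideal_def
      using mn by (auto simp: mono_def fibre_sum_single intro: poly_ring_diff)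
    moreover have "initial_form w (mono m + - mono n) = mono m"
      by (rule initial_form_dominant[OF mono_nonzero]) (use lt in \<open>auto simp: mono_def\<close>)
    ultimately have "mono m \<in> initial_ideal V w relation_ideal"
      using initial_ideal_mem[of "mono m - mono n" w] by simp
    then show False using w mn(1) by (simp add: Trop_def)
  qed
  from this[OF mn] this[OF mn(2,1) mn(3,4)[symmetric]] show ?thesis by simp
qed

text \<open>
  Within a fibre the weight of a monomial is, up to an additive constant, the weight of its
  exponents \<open>b\<close>: multiplying \<open>m\<close> by \<open>lift (b n)\<close> and \<open>n\<close> by \<open>lift (b m)\<close> makes the exponents equal,
  and \<open>Trop_binomial\<close> applies.
\<close>

lemma Trop_fibre_weight:
  assumes w: "w \<in> Trop V relation_ideal" and mn: "m \<in> mons V" "n \<in> mons V" "\<Gamma> m = \<Gamma> n"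
  shows "mon_weight w m + (\<Sum>i<d. real (coef (b n) i) * mon_weight w (u i))
    = mon_weight w n + (\<Sum>i<d. real (coef (b m) i) * mon_weight w (u i))"
proof -
  have "mon_weight w (m + lift (b n)) = mon_weight w (n + lift (b m))"
    by (rule Trop_binomial[OF w])
       (auto simp: \<Gamma>_add b_add \<Gamma>_lift b_lift b_supp mn add.commute intro!: mons_add mn lift_mons)
  then show ?thesis by (simp add: mon_weight_add mon_weight_lift)
qed

end

text \<open>
  A weight in the tropical variety together with a basis of largest weight.
\<close>

locale tropical_weight = hypertoric_monomials V d \<Gamma> b W u
  for V :: "'v set" and d \<Gamma> b W u +
  fixes w :: "'v \<Rightarrow> real" and \<tau> :: "nat \<Rightarrow> real" and K :: "nat set" and c :: "nat \<Rightarrow> nat \<Rightarrow> complex"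
  assumes w: "w \<in> Trop V relation_ideal"
    and P: "presents d W K c"
    and greedy: "i < d \<Longrightarrow> c i j \<noteq> 0 \<Longrightarrow> \<tau> i \<le> \<tau> j"
    and \<tau>: "\<tau> i = mon_weight w (u i)"
begin

definition form :: "nat \<Rightarrow> nat cpoly" where "form i = lin_form K (c i)"

definition lead_form :: "nat \<Rightarrow> nat cpoly" where
  "lead_form i = lin_form K (\<lambda>j. if \<tau> j = \<tau> i then c i j else 0)"

abbreviation \<tau>_weight :: "nat mon \<Rightarrow> real" where
  "\<tau>_weight \<beta> \<equiv> (\<Sum>i<d. real (coef \<beta> i) * \<tau> i)"

lemma K: "K \<subseteq> {..<d}" "finite K"
  using P finite_subset by (auto simp: presents_def)

lemma relation_ideal_form: "relation_ideal = fibre_ideal form"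
  unfolding relation_ideal_eq[OF P] form_def[abs_def] ..

lemma form_in_K: "j \<in> K \<Longrightarrow> form j = var j"
proof -
  assume j: "j \<in> K"
  then have "c j = (\<lambda>k. if k = j then 1 else 0)" using P by (auto simp: presents_def)
  then show ?thesis using lin_form_unit[OF K(2) j] by (simp add: form_def)
qed

lemma form_leads: assumes "i < d" shows "leads \<tau> (\<tau> i) (form i) (lead_form i)"
proof -
  have "form i - lead_form i = lin_form K (\<lambda>j. if \<tau> j = \<tau> i then 0 else c i j)"
    unfolding form_def lead_form_def lin_form_def
    by (simp flip: sum_subtractf) (auto intro!: sum.cong)
  then show ?thesis
    using supp_lin_form[of K "\<lambda>j. if \<tau> j = \<tau> i then c i j else 0"] greedy[OF assms]
      supp_lin_form[of K "\<lambda>j. if \<tau> j = \<tau> i then 0 else c i j"]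
    unfolding leads_def lead_form_def by (fastforce split: if_splits)
qed

text \<open>
  If all terms of \<open>form i\<close> were heavier than \<open>\<tau> i\<close>, then the relation expressing \<open>t\<^sub>i\<close> in the basis
  would have the monomial \<open>u i\<close> as its initial form.
\<close>

lemma lead_form_nonzero: assumes i: "i < d" shows "lead_form i \<noteq> 0"
proof
  assume "lead_form i = 0"
  then have "\<forall>j\<in>K. (if \<tau> j = \<tau> i then c i j else 0) = 0"
    using K(2) by (simp add: lead_form_def lin_form_eq_0_iff)
  then have gt: "\<tau> i < \<tau> j" if "j \<in> K" "c i j \<noteq> 0" for j
    using that greedy[OF i that(2)] by (metis less_eq_real_def)
  define g where "g = (\<Sum>j\<in>K. single (u j) (- c i j))"
  have uK: "u j \<in> mons V" "\<Gamma> (u j) = 0" "b (u j) = single j 1" if "j \<in> K" for j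
    using that u K by auto
  have "fibre_sum form \<gamma> (mono (u i) + g) = 0" for \<gamma>
  proof (cases "\<gamma> = 0")
    case True
    have "fibre_sum form 0 g = (\<Sum>j\<in>K. - (const (c i j) * var j))"
      unfolding g_def fibre_sum_sum using K
      by (intro sum.cong) (auto simp: fibre_sum_single uK lpow_single form_in_K const_uminus simp del: One_nat_def)
    also have "\<dots> = - form i" by (simp add: sum_negf form_def lin_form_def)
    finally show ?thesis using i True
      by (simp add: mono_def fibre_sum_single u lpow_single del: One_nat_def)
  next
    case False
    then show ?thesis using i
      by (auto simp: mono_def fibre_sum_single fibre_sum_sum g_def u uK intro!: sum.neutral)
  qed
  then have "mono (u i) + g \<in> relation_ideal"
    unfolding relation_ideal_form fibre_ideal_def g_def using u(1)[OF i] uK(1)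
    by (auto intro!: poly_ring_add poly_ring_sum)
  moreover have "initial_form w (mono (u i) + g) = mono (u i)"
  proof (rule initial_form_dominant)
    show "mono (u i) \<noteq> 0" by simp
    show "mon_weight w m = \<tau> i" if "m \<in> supp (mono (u i))" for m
      using that by (simp add: mono_def \<tau>)
    fix m assume "m \<in> supp g"
    then have "m \<in> (\<Union>j\<in>K. supp (single (u j) (- c i j)))"
      unfolding g_def by (rule subsetD[OF Poly_Mapping.keys_sum])
    then obtain j where "j \<in> K" "m = u j" "c i j \<noteq> 0" by (auto split: if_splits)
    then show "\<tau> i < mon_weight w m" using gt \<tau> by auto
  qed
  ultimately have "mono (u i) \<in> initial_ideal V w relation_ideal"
    using initial_ideal_mem by metis
  then show False using w u(1)[OF i] by (simp add: Trop_def)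
qed

lemma lpow_leads: "leads \<tau> (\<tau>_weight \<beta>) (lpow d form \<beta>) (lpow d lead_form \<beta>)"
  by (rule leads_lpow) (rule form_leads)

lemma fibre_weight:
  assumes "m \<in> mons V" "n \<in> mons V" "\<Gamma> m = \<Gamma> n"
  shows "mon_weight w m + \<tau>_weight (b n) = mon_weight w n + \<tau>_weight (b m)"
  using Trop_fibre_weight[OF w assms] by (simp add: \<tau>)

text \<open>
  On each fibre the weights agree with those of the powers of the linear forms up to a shift.  The
  lightest terms of a vanishing fibre sum therefore form the fibre sum of the initial form, taken
  with the leading forms.
\<close>

lemma initial_form_in_lead_ideal:
  assumes f: "f \<in> relation_ideal"
  shows "initial_form w f \<in> fibre_ideal lead_form"
proof (cases "f = 0")
  case True
  then show ?thesis by (simp add: initial_form_eq_part fibre_ideal_def)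
next
  case False
  define \<omega> where "\<omega> = Min (mon_weight w ` supp f)"
  have ne: "mon_weight w ` supp f \<noteq> {}" "finite (mon_weight w ` supp f)"
    using False by auto
  have \<omega>_le: "\<omega> \<le> mon_weight w m" if "m \<in> supp f" for m
    unfolding \<omega>_def using that by (intro Min_le) auto
  have \<omega>_in: "\<omega> \<in> mon_weight w ` supp f"
    unfolding \<omega>_def by (rule Min_in[OF ne(2,1)])
  have init: "initial_form w f = part (\<lambda>m. mon_weight w m = \<omega>) f"
    unfolding initial_form_eq_part
    by (rule poly_mapping_eqI) (use \<omega>_le \<omega>_in in \<open>force simp: coef_part in_keys_iff\<close>)
  have fV: "supp f \<subseteq> mons V"
    using f by (simp add: relation_ideal_form fibre_ideal_def in_poly_ring_iff)
  have "fibre_sum lead_form \<gamma> (part (\<lambda>m. mon_weight w m = \<omega>) f) = 0" for \<gamma>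
  proof (cases "\<exists>n\<in>supp f. \<Gamma> n = \<gamma>")
    case False
    then have empty: "{m \<in> supp f. \<Gamma> m = \<gamma>} = {}" by auto
    show ?thesis unfolding fibre_sum_part empty by simp
  next
    case True
    then obtain n where n: "n \<in> supp f" "\<Gamma> n = \<gamma>" by blast
    define \<delta> where "\<delta> = mon_weight w n - \<tau>_weight (b n)"
    have \<delta>: "\<tau>_weight (b m) = mon_weight w m - \<delta>" if "m \<in> supp f" "\<Gamma> m = \<gamma>" for m
    proof -
      have "mon_weight w m + \<tau>_weight (b n) = mon_weight w n + \<tau>_weight (b m)"
        using that n fV by (intro fibre_weight) auto
      then show ?thesis by (simp add: \<delta>_def)
    qed
    have "leads \<tau> (\<omega> - \<delta>) (const (coef f m) * lpow d form (b m))
        (if mon_weight w m = \<omega> then const (coef f m) * lpow d lead_form (b m) else 0)"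
      if m: "m \<in> supp f" "\<Gamma> m = \<gamma>" for m
    proof (cases "mon_weight w m = \<omega>")
      case True
      then show ?thesis using leads_const[OF lpow_leads[of "b m"]] \<delta>[OF m] by simp
    next
      case False
      then have "\<omega> - \<delta> < \<tau>_weight (b m)" using \<delta>[OF m] \<omega>_le[OF m(1)] by simp
      then show ?thesis using leads_higher[OF leads_const[OF lpow_leads[of "b m"]]] False by simp
    qed
    then have "leads \<tau> (\<omega> - \<delta>) (fibre_sum form \<gamma> f)
        (fibre_sum lead_form \<gamma> (part (\<lambda>m. mon_weight w m = \<omega>) f))"
      unfolding fibre_sum_part unfolding fibre_sum_def by (intro leads_sum) auto
    moreover have "fibre_sum form \<gamma> f = 0"
      using f by (simp add: relation_ideal_form fibre_ideal_def)
    ultimately show ?thesis using leads_0 by simp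
  qed
  then show ?thesis
    using f unfolding init relation_ideal_form
    by (auto simp: fibre_ideal_def intro: part_in_poly_ring)
qed

text \<open>
  The leading forms are homogeneous, so a fibre sum taken with them splits according to weight.
\<close>

lemma lead_ideal_part:
  assumes f: "f \<in> fibre_ideal lead_form"
  shows "part (\<lambda>m. (\<Gamma> m, mon_weight w m) = (\<gamma>, \<omega>)) f \<in> fibre_ideal lead_form"
proof -
  let ?P = "\<lambda>m. (\<Gamma> m, mon_weight w m) = (\<gamma>, \<omega>)"
  have fV: "supp f \<subseteq> mons V" and f0: "fibre_sum lead_form \<gamma> f = 0"
    using f by (auto simp: fibre_ideal_def in_poly_ring_iff)
  have "fibre_sum lead_form \<gamma>' (part ?P f) = 0" for \<gamma>'
  proof (cases "\<gamma>' = \<gamma> \<and> (\<exists>n\<in>supp f. \<Gamma> n = \<gamma>)")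
    case False
    then have empty: "{m \<in> supp f. ?P m \<and> \<Gamma> m = \<gamma>'} = {}" by auto
    show ?thesis unfolding fibre_sum_def supp_part
      by (rule sum.neutral) (use empty in auto)
  next
    case True
    then obtain n where n: "n \<in> supp f" "\<Gamma> n = \<gamma>" and [simp]: "\<gamma>' = \<gamma>" by blast
    define \<delta> where "\<delta> = mon_weight w n - \<tau>_weight (b n)"
    let ?A = "{m \<in> supp f. \<Gamma> m = \<gamma>}"
    let ?t = "\<lambda>m. const (coef f m) * lpow d lead_form (b m)"
    let ?q = "\<Sum>m\<in>?A. if mon_weight w m = \<omega> then ?t m else 0"
    have pure: "mon_weight \<tau> \<mu> = mon_weight w m - \<delta>" if m: "m \<in> ?A" "\<mu> \<in> supp (?t m)" for m \<mu>
    proof -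
      have "mon_weight w m + \<tau>_weight (b n) = mon_weight w n + \<tau>_weight (b m)"
        using m n fV by (intro fibre_weight) auto
      moreover have "mon_weight \<tau> \<mu> = \<tau>_weight (b m)"
        using leads_const[OF lpow_leads[of "b m"], of "coef f m"] m(2) unfolding leads_def by blast
      ultimately show ?thesis by (simp add: \<delta>_def)
    qed
    have q1: "mon_weight \<tau> \<mu> = \<omega> - \<delta>" if "\<mu> \<in> supp ?q" for \<mu>
    proof -
      have "\<mu> \<in> (\<Union>m\<in>?A. supp (if mon_weight w m = \<omega> then ?t m else 0))"
        by (rule subsetD[OF Poly_Mapping.keys_sum that])
      then show ?thesis using pure by (auto split: if_splits)
    qed
    have eq: "fibre_sum lead_form \<gamma> f = ?q + (\<Sum>m\<in>?A. if mon_weight w m = \<omega> then 0 else ?t m)"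
      unfolding fibre_sum_def sum.distrib[symmetric] by (intro sum.cong) auto
    have q2: "mon_weight \<tau> \<mu> \<noteq> \<omega> - \<delta>" if "\<mu> \<in> supp ?q" for \<mu>
    proof -
      have "?q = - (\<Sum>m\<in>?A. if mon_weight w m = \<omega> then 0 else ?t m)"
        using eq f0 by (simp add: eq_neg_iff_add_eq_0)
      then have "supp ?q = supp (\<Sum>m\<in>?A. if mon_weight w m = \<omega> then 0 else ?t m)"
        by simp
      then have "\<mu> \<in> supp (\<Sum>m\<in>?A. if mon_weight w m = \<omega> then 0 else ?t m)"
        using that by (simp only:)
      then have "\<mu> \<in> (\<Union>m\<in>?A. supp (if mon_weight w m = \<omega> then 0 else ?t m))"
        by (rule subsetD[OF Poly_Mapping.keys_sum])
      then show ?thesis using pure by (auto split: if_splits)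
    qed
    have "supp ?q = {}" using q1 q2 by blast
    then have "?q = 0" by (simp only: keys_eq_empty)
    moreover have "fibre_sum lead_form \<gamma> (part ?P f) = ?q"
      unfolding fibre_sum_part by (intro sum.cong) auto
    ultimately show ?thesis by simp
  qed
  then show ?thesis using f by (auto simp: fibre_ideal_def intro: part_in_poly_ring)
qed

text \<open>
  The polynomial \<open>f\<close> must be completed by heavier terms to an element of the ideal.  Its fibre sum
  is divisible by the power belonging to the least monomial \<open>m0\<close> of the fibre; write \<open>e form\<close> for
  the quotient.  The same quotient for the leading forms vanishes because they are not zero divisors,
  so all terms of \<open>e form\<close> are heavier than the difference of \<open>\<omega>\<close> and the weight of \<open>m0\<close>.  Subtracting
  the monomial \<open>m0 + lift \<mu>\<close>, with the coefficient of \<open>\<mu>\<close>, for every term \<open>\<mu>\<close> of \<open>e form\<close> cancels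
  the fibre sum of \<open>f\<close>.
\<close>

lemma homogeneous_lead_ideal_mem:
  assumes f: "f \<in> fibre_ideal lead_form" and "f \<noteq> 0"
    and hom: "\<And>m. m \<in> supp f \<Longrightarrow> \<Gamma> m = \<gamma> \<and> mon_weight w m = \<omega>"
  shows "f \<in> initial_ideal V w relation_ideal"
proof -
  have fV: "supp f \<subseteq> mons V" using f by (auto simp: fibre_ideal_def in_poly_ring_iff)
  obtain n where n: "n \<in> supp f" using \<open>f \<noteq> 0\<close> by (metis ex_in_conv keys_eq_empty)
  obtain m0 where m0: "m0 \<in> mons V" "\<Gamma> m0 = \<gamma>"
    and le: "\<And>m i. m \<in> mons V \<Longrightarrow> \<Gamma> m = \<gamma> \<Longrightarrow> coef (b m0) i \<le> coef (b m) i"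
  proof -
    have "n \<in> mons V" "\<Gamma> n = \<gamma>" using n fV hom by auto
    then show ?thesis using least[of n] that by blast
  qed
  \<comment> \<open>\<open>r m\<close> are the exponents that remain after dividing by the power common to the fibre\<close>
  define r where "r m = b m - b m0" for m
  have br: "b m = b m0 + r m" if "m \<in> supp f" for m
    by (rule poly_mapping_eqI) (use le[of m] fV hom that in \<open>auto simp: r_def lookup_add lookup_minus\<close>)
  define e where "e l = (\<Sum>m\<in>supp f. const (coef f m) * lpow d l (r m))" for l :: "nat \<Rightarrow> nat cpoly"
  have fs: "fibre_sum l \<gamma>' f = (if \<gamma>' = \<gamma> then lpow d l (b m0) * e l else 0)" for l \<gamma>'
  proof -
    have "{m \<in> supp f. \<Gamma> m = \<gamma>'} = (if \<gamma>' = \<gamma> then supp f else {})" using hom by auto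
    then show ?thesis
      by (auto simp: fibre_sum_def e_def sum_distrib_left br lpow_add mult_ac intro!: sum.cong)
  qed
  have "lpow d lead_form (b m0) * e lead_form = 0"
    using f fs[of lead_form \<gamma>] by (simp add: fibre_ideal_def)
  moreover have "lpow d lead_form (b m0) \<noteq> 0" by (intro lpow_nonzero lead_form_nonzero)
  ultimately have e0: "e lead_form = 0" by simp
  have wr: "\<tau>_weight (r m) = \<omega> - mon_weight w m0" if "m \<in> supp f" for m
  proof -
    have "mon_weight w m + \<tau>_weight (b m0) = mon_weight w m0 + \<tau>_weight (b m)"
      using that fV hom m0 by (intro fibre_weight) auto
    then show ?thesis using hom[OF that]
      by (simp add: br[OF that] lookup_add distrib_right sum.distrib)
  qed
  have "leads \<tau> (\<omega> - mon_weight w m0) (e form) (e lead_form)"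
    unfolding e_def
  proof (rule leads_sum)
    fix m assume "m \<in> supp f"
    then show "leads \<tau> (\<omega> - mon_weight w m0) (const (coef f m) * lpow d form (r m))
        (const (coef f m) * lpow d lead_form (r m))"
      using leads_const[OF lpow_leads[of "r m"]] wr by simp
  qed
  then have e_above: "\<omega> - mon_weight w m0 < mon_weight \<tau> \<mu>" if "\<mu> \<in> supp (e form)" for \<mu>
    using that by (simp add: leads_def e0)
  have "e form \<in> carrier (poly_ring K)"
    unfolding e_def lpow_def form_def
    by (intro poly_ring_sum poly_ring_mult poly_ring_prod poly_ring_power lin_form_in_poly_ring) simp
  then have eK: "supp \<mu> \<subseteq> K" if "\<mu> \<in> supp (e form)" for \<mu>
    using that by (auto simp: in_poly_ring_iff mons_def)
  have lift_weight: "mon_weight w (lift \<mu>) = mon_weight \<tau> \<mu>" if "supp \<mu> \<subseteq> K" for \<mu>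
    unfolding mon_weight_lift \<tau>[symmetric] mon_weight_def[of \<tau>]
    using that K by (intro sum.mono_neutral_right) (auto simp: in_keys_iff)
  have lpow_lift: "lpow d form \<mu> = mono \<mu>" if \<mu>: "supp \<mu> \<subseteq> K" for \<mu>
  proof -
    have "form i ^ coef \<mu> i = mono (\<Sum>k<coef \<mu> i. single i 1)" if "i < d" for i
    proof (cases "i \<in> K")
      case True
      have "var i ^ k = mono (\<Sum>k<k. single i 1)" for k
        by (induction k) (simp_all add: mono_add var_def mult.commute del: sum_constant)
      then show ?thesis using True by (simp add: form_in_K)
    next
      case False
      then have "coef \<mu> i = 0" using \<mu> by (metis in_keys_iff subsetD)
      then show ?thesis by simp
    qed
    then have "lpow d form \<mu> = (\<Prod>i<d. mono (\<Sum>k<coef \<mu> i. single i 1))"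
      unfolding lpow_def by (intro prod.cong) auto
    also have "\<dots> = mono (\<Sum>i<d. \<Sum>k<coef \<mu> i. single i 1)"
      by (induction d) (simp_all add: mono_add mult.commute del: sum_constant)
    also have "(\<Sum>i<d. \<Sum>k<coef \<mu> i. single i 1) = \<mu>"
    proof (rule poly_mapping_eqI)
      fix k
      have "coef (\<Sum>i<d. \<Sum>k<coef \<mu> i. single i 1) k = (\<Sum>i<d. if i = k then coef \<mu> k else 0)"
        unfolding lookup_sum by (intro sum.cong) (auto simp: lookup_single when_def)
      then show "coef (\<Sum>i<d. \<Sum>k<coef \<mu> i. single i 1) k = coef \<mu> k"
        using \<mu> K by (auto simp: in_keys_iff)
    qed
    finally show ?thesis .
  qed
  define g where "g = (\<Sum>\<mu>\<in>supp (e form). single (m0 + lift \<mu>) (coef (e form) \<mu>))"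
  have gV: "g \<in> carrier (poly_ring V)"
    unfolding g_def by (intro poly_ring_sum term_in_poly_ring mons_add m0 lift_mons)
  have "fibre_sum form \<gamma>' g = fibre_sum form \<gamma>' f" for \<gamma>'
  proof -
    have "fibre_sum form \<gamma>' g = (\<Sum>\<mu>\<in>supp (e form). if \<gamma>' = \<gamma>
        then lpow d form (b m0) * single \<mu> (coef (e form) \<mu>) else 0)"
      unfolding g_def fibre_sum_sum
    proof (rule sum.cong[OF refl])
      fix \<mu> assume "\<mu> \<in> supp (e form)"
      then have \<mu>: "supp \<mu> \<subseteq> K" by (rule eK)
      then have "b (lift \<mu>) = \<mu>" using K by (intro b_lift) auto
      then show "fibre_sum form \<gamma>' (single (m0 + lift \<mu>) (coef (e form) \<mu>))
          = (if \<gamma>' = \<gamma> then lpow d form (b m0) * single \<mu> (coef (e form) \<mu>) else 0)"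
        using m0 lpow_lift[OF \<mu>]
        by (auto simp: fibre_sum_single \<Gamma>_add \<Gamma>_lift b_add lpow_add mult_ac
              const_times_mono[symmetric, where c = "coef (e form) \<mu>" and m = \<mu>])
    qed
    also have "\<dots> = (if \<gamma>' = \<gamma> then lpow d form (b m0) * e form else 0)"
      by (simp add: sum_distrib_left[symmetric] sum_terms)
    finally show ?thesis by (simp add: fs)
  qed
  then have "f - g \<in> relation_ideal"
    using f gV by (auto simp: relation_ideal_form fibre_ideal_def intro: poly_ring_diff)
  moreover have "initial_form w (f + - g) = f"
  proof (rule initial_form_dominant[OF \<open>f \<noteq> 0\<close>])
    show "mon_weight w m = \<omega>" if "m \<in> supp f" for m using hom[OF that] by simp
    fix m assume "m \<in> supp (- g)"
    then have "m \<in> (\<Union>\<mu>\<in>supp (e form). supp (single (m0 + lift \<mu>) (coef (e form) \<mu>)))"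
      unfolding keys_minus g_def by (rule subsetD[OF Poly_Mapping.keys_sum])
    then obtain \<mu> where "\<mu> \<in> supp (e form)" "m = m0 + lift \<mu>" by (auto split: if_splits)
    then show "\<omega> < mon_weight w m"
      using e_above[of \<mu>] lift_weight[OF eK[of \<mu>]] by (simp add: mon_weight_add)
  qed
  ultimately show ?thesis using initial_ideal_mem[of "f - g" w] by simp
qed

theorem initial_ideal_eq: "initial_ideal V w relation_ideal = fibre_ideal lead_form"
proof
  have "ideal (fibre_ideal lead_form) (poly_ring V)"
    using fibre_ideal_prime primeideal.axioms(1) by blast
  then show "initial_ideal V w relation_ideal \<subseteq> fibre_ideal lead_form"
    unfolding initial_ideal_def using initial_form_in_lead_ideal by (intro genideal_le) auto
next
  show "fibre_ideal lead_form \<subseteq> initial_ideal V w relation_ideal"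
  proof
    fix f assume f: "f \<in> fibre_ideal lead_form"
    let ?h = "\<lambda>m. (\<Gamma> m, mon_weight w m)"
    note I = poly_ring_idealD[OF initial_ideal_is_ideal[of w]]
    have "part (\<lambda>m. ?h m = x) f \<in> initial_ideal V w relation_ideal" for x
    proof (cases "part (\<lambda>m. ?h m = x) f = 0")
      case True then show ?thesis using I(2) by simp
    next
      case False
      obtain \<gamma> \<omega> where x: "x = (\<gamma>, \<omega>)" by (cases x)
      show ?thesis
      proof (rule homogeneous_lead_ideal_mem[OF _ False])
        show "part (\<lambda>m. ?h m = x) f \<in> fibre_ideal lead_form"
          unfolding x by (rule lead_ideal_part[OF f])
        show "\<Gamma> m = \<gamma> \<and> mon_weight w m = \<omega>" if "m \<in> supp (part (\<lambda>m. ?h m = x) f)" for m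
          using that by (simp add: x supp_part)
      qed
    qed
    then have "(\<Sum>x\<in>?h ` supp f. part (\<lambda>m. ?h m = x) f) \<in> initial_ideal V w relation_ideal"
      by (rule I(7))
    then show "f \<in> initial_ideal V w relation_ideal" by (simp only: sum_parts)
  qed
qed

end

theorem (in hypertoric_monomials) relation_ideal_well_poised: "well_poised V relation_ideal"
  unfolding well_poised_def
proof (intro conjI ballI)
  show "primeideal relation_ideal (poly_ring V)" by (rule relation_ideal_prime)
  show "var v \<notin> relation_ideal" for v
    unfolding var_def by (rule mono_notin_relation_ideal)
  fix w assume w: "w \<in> Trop V relation_ideal"
  obtain K c where "presents d W K c"
    "\<And>i j. i < d \<Longrightarrow> c i j \<noteq> 0 \<Longrightarrow> mon_weight w (u i) \<le> mon_weight w (u j)"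
    using exists_presentation[OF W, of "\<lambda>i. mon_weight w (u i)"] by metis
  then interpret tropical_weight V d \<Gamma> b W u w "\<lambda>i. mon_weight w (u i)" K c
    by unfold_locales (use w in auto)
  show "primeideal (initial_ideal V w relation_ideal) (poly_ring V)"
    unfolding initial_ideal_eq by (rule fibre_ideal_prime)
qed

section \<open>The ideal of the moment map\<close>

definition xy_vars :: "nat \<Rightarrow> (nat + nat) set" where
  "xy_vars d = Inl ` {..<d} \<union> Inr ` {..<d}"

text \<open>
  The weight of a monomial under the full \<open>d\<close>-dimensional torus, of which the torus of the
  hypertoric variety is a subgroup.
\<close>

definition xy_diff :: "nat \<Rightarrow> (nat + nat) mon \<Rightarrow> (nat \<Rightarrow>\<^sub>0 int)" where
  "xy_diff d m = (\<Sum>i<d. single i (int (coef m (Inl i)) - int (coef m (Inr i))))"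

definition y_part :: "nat \<Rightarrow> (nat + nat) mon \<Rightarrow> nat mon" where
  "y_part d m = (\<Sum>i<d. single i (coef m (Inr i)))"

definition xy_mon :: "nat \<Rightarrow> (nat + nat) mon" where
  "xy_mon i = single (Inl i) 1 + single (Inr i) 1"

text \<open>
  The monomial \<open>x\<^bsup>\<gamma>+\<^esup> y\<^bsup>\<gamma>-\<^esup>\<close> built from the positive and negative parts of \<open>\<gamma>\<close>.
\<close>

definition least_mon :: "nat \<Rightarrow> (nat \<Rightarrow>\<^sub>0 int) \<Rightarrow> (nat + nat) mon" where
  "least_mon d \<gamma> = (\<Sum>i<d. single (Inl i) (nat (coef \<gamma> i)) + single (Inr i) (nat (- coef \<gamma> i)))"

lemma coef_xy_diff: "coef (xy_diff d m) i = (if i < d then int (coef m (Inl i)) - int (coef m (Inr i)) else 0)"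
  by (simp add: xy_diff_def lookup_sum lookup_single when_def)

lemma coef_y_part: "coef (y_part d m) i = (if i < d then coef m (Inr i) else 0)"
  by (simp add: y_part_def lookup_sum lookup_single when_def)

lemma coef_least_mon:
  "coef (least_mon d \<gamma>) (Inl i) = (if i < d then nat (coef \<gamma> i) else 0)"
  "coef (least_mon d \<gamma>) (Inr i) = (if i < d then nat (- coef \<gamma> i) else 0)"
  by (simp_all add: least_mon_def lookup_sum lookup_add lookup_single when_def)

lemma xy_diff_add: "xy_diff d (m + n) = xy_diff d m + xy_diff d n"
  by (rule poly_mapping_eqI) (simp add: coef_xy_diff lookup_add)

lemma y_part_add: "y_part d (m + n) = y_part d m + y_part d n"
  by (rule poly_mapping_eqI) (simp add: coef_y_part lookup_add)

lemma supp_y_part: "supp (y_part d m) \<subseteq> {..<d}"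
  by (auto simp: in_keys_iff coef_y_part split: if_splits)

lemma supp_xy_diff: "supp (xy_diff d m) \<subseteq> {..<d}"
  by (auto simp: in_keys_iff coef_xy_diff split: if_splits)

lemma xy_monsI: "(\<And>i. d \<le> i \<Longrightarrow> coef m (Inl i) = 0 \<and> coef m (Inr i) = 0) \<Longrightarrow> m \<in> mons (xy_vars d)"
  unfolding mons_def xy_vars_def
proof (intro CollectI subsetI)
  fix v assume *: "\<And>i. d \<le> i \<Longrightarrow> coef m (Inl i) = 0 \<and> coef m (Inr i) = 0" and v: "v \<in> supp m"
  show "v \<in> Inl ` {..<d} \<union> Inr ` {..<d}"
  proof (cases v)
    case (Inl i)
    then have "i < d" using *[of i] v by (metis in_keys_iff not_le)
    then show ?thesis using Inl by blast
  next
    case (Inr i)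
    then have "i < d" using *[of i] v by (metis in_keys_iff not_le)
    then show ?thesis using Inr by blast
  qed
qed

lemma xy_monsD: "m \<in> mons (xy_vars d) \<Longrightarrow> d \<le> i \<Longrightarrow> coef m (Inl i) = 0 \<and> coef m (Inr i) = 0"
  by (auto simp: mons_def xy_vars_def in_keys_iff subset_iff image_iff)

lemma least_mon_mons: "least_mon d \<gamma> \<in> mons (xy_vars d)"
  by (rule xy_monsI) (simp add: coef_least_mon)

lemma xy_diff_least_mon:
  assumes "supp \<gamma> \<subseteq> {..<d}" shows "xy_diff d (least_mon d \<gamma>) = \<gamma>"
proof (rule poly_mapping_eqI)
  fix i
  have "\<not> i < d \<Longrightarrow> coef \<gamma> i = 0" using assms by (auto simp: in_keys_iff)
  then show "coef (xy_diff d (least_mon d \<gamma>)) i = coef \<gamma> i"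
    by (simp add: coef_xy_diff coef_least_mon)
qed

lemma least_mon_le: "coef (y_part d (least_mon d (xy_diff d m))) i \<le> coef (y_part d m) i"
  by (simp add: coef_y_part coef_least_mon coef_xy_diff nat_le_iff)

lemma xy_fibred: "fibred_monomials (xy_vars d) d (xy_diff d) (y_part d)"
  by unfold_locales (rule xy_diff_add y_part_add supp_y_part)+

lemma relation_space_linear_relations: "relation_space d (linear_relations N d a)"
  unfolding relation_space_def linear_relations_def
  by (auto simp: distrib_right sum.distrib mult.assoc simp flip: sum_distrib_left)

text \<open>
  The coordinate functions of a free abelian group separate its elements.
\<close>

lemma exists_nonzero_functional:
  assumes N: "finite_rank_lattice N" and v: "v \<in> carrier N" "v \<noteq> \<one>\<^bsub>N\<^esub>"
  obtains u where "u \<in> dual_lattice N" "u v \<noteq> 0"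
proof -
  obtain n \<phi> where "comm_group N" and \<phi>: "\<phi> \<in> iso N (free_Abelian_group {..<n::nat})"
    using N by (auto simp: finite_rank_lattice_def is_iso_def)
  then have hom: "\<phi> \<in> hom N (free_Abelian_group {..<n})" and inj: "inj_on \<phi> (carrier N)"
    by (auto simp: iso_def bij_betw_def)
  interpret N: comm_group N by fact
  have "\<phi> \<one>\<^bsub>N\<^esub> = 0"
    using hom_one[OF hom N.is_group group_free_Abelian_group] by simp
  then have "\<phi> v \<noteq> 0" using inj v by (metis N.one_closed inj_onD)
  then obtain j where j: "coef (\<phi> v) j \<noteq> 0" by (metis poly_mapping_eqI lookup_zero)
  have "(\<lambda>x. coef (\<phi> x) j) \<in> dual_lattice N"
    unfolding dual_lattice_def
    using hom by (auto simp: hom_def integer_group_def lookup_add)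
  then show ?thesis using that j by blast
qed

lemma unit_notin_linear_relations:
  assumes "finite_rank_lattice N" "i < d" "a i \<in> carrier N" "a i \<noteq> \<one>\<^bsub>N\<^esub>"
  shows "(\<lambda>k. if k = i then 1 else 0) \<notin> linear_relations N d a"
proof -
  obtain u where u: "u \<in> dual_lattice N" "u (a i) \<noteq> 0"
    using exists_nonzero_functional[OF assms(1,3,4)] by blast
  have "(\<Sum>k<d. (if k = i then 1 else 0) * of_int (u (a k))) = (\<Sum>k<d. if k = i then of_int (u (a i)) else (0::complex))"
    by (intro sum.cong) auto
  then have "(\<Sum>k<d. (if k = i then 1 else 0) * of_int (u (a k))) \<noteq> (0::complex)"
    using u(2) assms(2) by simp
  then show ?thesis using u(1) by (auto simp: linear_relations_def)
qed

lemma ideal_prod_cong: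
  assumes I: "ideal I (poly_ring V)"
    and p: "\<And>i. i < d \<Longrightarrow> p i \<in> carrier (poly_ring V)" "\<And>i. i < d \<Longrightarrow> q i \<in> carrier (poly_ring V)"
    and pq: "\<And>i. i < d \<Longrightarrow> p i - q i \<in> I"
  shows "lpow d p \<beta> - lpow d q \<beta> \<in> I"
proof -
  note I' = poly_ring_idealD[OF I]
  have mult: "x * y - x' * y' \<in> I"
    if "x - x' \<in> I" "y - y' \<in> I" "x \<in> carrier (poly_ring V)" "y' \<in> carrier (poly_ring V)" for x x' y y'
  proof -
    have "x * (y - y') + y' * (x - x') \<in> I" using that by (intro I'(3,4))
    then show ?thesis by (simp add: algebra_simps)
  qed
  have power: "p i ^ n - q i ^ n \<in> I" if i: "i < d" for i n
  proof (induction n)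
    case (Suc n)
    then show ?case using mult[OF pq[OF i] Suc p(1)[OF i] poly_ring_power[OF p(2)[OF i]]] by simp
  qed (simp add: I'(2))
  have "(\<Prod>i<k. p i ^ coef \<beta> i) - (\<Prod>i<k. q i ^ coef \<beta> i) \<in> I" if "k \<le> d" for k
    using that
  proof (induction k)
    case (Suc k)
    have "(\<Prod>i<k. p i ^ coef \<beta> i) \<in> carrier (poly_ring V)"
      using Suc.prems p by (intro poly_ring_prod poly_ring_power) auto
    then show ?case
      using Suc mult[OF _ power[of k "coef \<beta> k"]] poly_ring_power[OF p(2)[of k]] by simp
  qed (simp add: I'(2))
  then show ?thesis by (simp add: lpow_def)
qed

lemma const_diff: "const (x - y) = const x - const y"
  by (simp add: const_def single_diff)

locale toric_arrangement =
  fixes N :: "'n monoid" and d :: nat and a :: "nat \<Rightarrow> 'n"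
  assumes N: "finite_rank_lattice N" and a: "i < d \<Longrightarrow> a i \<in> carrier N" "i < d \<Longrightarrow> a i \<noteq> \<one>\<^bsub>N\<^esub>"
begin

sublocale xy: hypertoric_monomials "xy_vars d" d "xy_diff d" "y_part d" "linear_relations N d a" xy_mon
proof (intro hypertoric_monomials.intro hypertoric_monomials_axioms.intro xy_fibred)
  show "relation_space d (linear_relations N d a)" by (rule relation_space_linear_relations)
  show "(\<lambda>k. if k = i then 1 else 0) \<notin> linear_relations N d a" if "i < d" for i
    by (intro unit_notin_linear_relations N that a)
  show "xy_mon i \<in> mons (xy_vars d)" if "i < d" for i
    unfolding xy_mon_def using that by (intro mons_add) (auto simp: mons_def xy_vars_def)
  show "xy_diff d (xy_mon i) = 0" if "i < d" for i
    by (rule poly_mapping_eqI) (simp add: coef_xy_diff xy_mon_def lookup_add lookup_single when_def)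
  show "y_part d (xy_mon i) = single i 1" if "i < d" for i
    using that by (intro poly_mapping_eqI) (auto simp: coef_y_part xy_mon_def lookup_add lookup_single when_def)
  show "\<exists>m0\<in>mons (xy_vars d). xy_diff d m0 = xy_diff d m \<and>
      (\<forall>n\<in>mons (xy_vars d). xy_diff d n = xy_diff d m \<longrightarrow> (\<forall>i. coef (y_part d m0) i \<le> coef (y_part d n) i))" for m
    using least_mon_mons xy_diff_least_mon[OF supp_xy_diff] least_mon_le by metis
qed

lemma var_product: "const x * var (Inl i) * var (Inr i) = single (xy_mon i) x"
proof -
  have "var (Inl i) * var (Inr i) = mono (xy_mon i)" by (simp add: var_def xy_mon_def mono_add)
  then show ?thesis by (simp add: mult.assoc const_times_mono)
qed

lemma moment_generators:
  "(\<lambda>c. \<Sum>i<d. const (c i) * var (Inl i) * var (Inr i)) ` linear_relations N d a \<subseteq> carrier (poly_ring (xy_vars d))"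
  unfolding var_product by (auto intro!: poly_ring_sum term_in_poly_ring xy.u(1))

text \<open>
  The generators have vanishing fibre sums because \<open>x\<^sub>i y\<^sub>i\<close> is evaluated at the \<open>i\<close>-th linear form.
  Conversely, modulo the moment ideal each \<open>x\<^sub>i y\<^sub>i\<close> may be replaced by a combination of the
  \<open>x\<^sub>j y\<^sub>j\<close> with \<open>j \<in> K\<close>.  This turns \<open>f\<close> into a sum over \<open>\<gamma>\<close> of \<open>least_mon d \<gamma>\<close> times a polynomial \<open>F \<gamma>\<close>
  in those products.  The fibre sum of \<open>f\<close> over \<open>\<gamma>\<close> is the product of \<open>F \<gamma>\<close> with a power of nonzero
  linear forms, so \<open>F \<gamma> = 0\<close> if the fibre sum vanishes.
\<close>

lemma moment_ideal_eq: "moment_ideal N d a = xy.relation_ideal"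
proof -
  define I where "I = moment_ideal N d a"
  obtain K c where P: "presents d (linear_relations N d a) K c" using xy.ex_presents by blast
  define l where "l = (\<lambda>i. lin_form K (c i))"
  have K: "K \<subseteq> {..<d}" "finite K" using P finite_subset by (auto simp: presents_def)
  have rel: "xy.relation_ideal = xy.fibre_ideal l" unfolding xy.relation_ideal_eq[OF P] l_def ..
  have gen: "I = genideal (poly_ring (xy_vars d))
      ((\<lambda>c. \<Sum>i<d. const (c i) * var (Inl i) * var (Inr i)) ` linear_relations N d a)"
    by (simp add: I_def moment_ideal_def xy_ring_def xy_vars_def)
  have I: "ideal I (poly_ring (xy_vars d))" unfolding gen by (rule genideal_is_ideal[OF moment_generators])
  note I' = poly_ring_idealD[OF I]
  have gen_mem: "(\<Sum>i<d. const (x i) * mono (xy_mon i)) \<in> I" if "x \<in> linear_relations N d a" for x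
  proof -
    have "(\<Sum>i<d. const (x i) * var (Inl i) * var (Inr i)) \<in> I"
      unfolding gen using that by (intro genideal_mem[OF moment_generators]) blast
    then show ?thesis by (simp add: var_product const_times_mono)
  qed
  have "I \<subseteq> xy.relation_ideal"
    unfolding gen
  proof (rule genideal_le[OF xy.ideal_relation_ideal], safe)
    fix x assume x: "x \<in> linear_relations N d a"
    have "xy.fibre_sum l \<gamma> (\<Sum>i<d. single (xy_mon i) (x i)) = 0" for \<gamma>
    proof (cases "\<gamma> = 0")
      case True
      have "xy.fibre_sum l 0 (\<Sum>i<d. single (xy_mon i) (x i)) = (\<Sum>i<d. const (x i) * l i)"
        unfolding xy.fibre_sum_sum
        by (intro sum.cong) (auto simp: xy.fibre_sum_single xy.u lpow_single simp del: One_nat_def)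
      also have "\<dots> = lin_form K (\<lambda>j. \<Sum>i<d. x i * c i j)" unfolding l_def by (rule lin_form_combination)
      also have "\<dots> = 0" using x P K by (simp add: lin_form_eq_0_iff presents_def)
      finally show ?thesis using True by simp
    next
      case False
      then show ?thesis unfolding xy.fibre_sum_sum
        by (intro sum.neutral) (auto simp: xy.fibre_sum_single xy.u)
    qed
    then show "(\<Sum>i<d. const (x i) * var (Inl i) * var (Inr i)) \<in> xy.relation_ideal"
      unfolding rel xy.fibre_ideal_def var_product by (auto intro!: poly_ring_sum term_in_poly_ring xy.u(1))
  qed
  moreover have "xy.relation_ideal \<subseteq> I"
  proof
    fix f assume f: "f \<in> xy.relation_ideal"
    then have fV: "supp f \<subseteq> mons (xy_vars d)" and f0: "\<And>\<gamma>. xy.fibre_sum l \<gamma> f = 0"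
      by (auto simp: rel xy.fibre_ideal_def in_poly_ring_iff)
    \<comment> \<open>\<open>\<sigma>\<close> evaluates a polynomial in the basis variables at the products \<open>x\<^sub>j y\<^sub>j\<close>\<close>
    define t :: "nat \<Rightarrow> (nat + nat) cpoly" where "t = (\<lambda>i. mono (xy_mon i))"
    define \<sigma> where "\<sigma> = eval_pm const (lpow d t)"
    interpret \<sigma>: evaluation const "lpow d t" by (rule lpow_evaluation)
    define low where "low m = least_mon d (xy_diff d m)" for m
    define e where "e m = y_part d m - y_part d (low m)" for m
    have \<sigma>_l: "\<sigma> (l i) = (\<Sum>j\<in>K. const (c i j) * t j)" if "i < d" for i
      unfolding l_def lin_form_def \<sigma>_def
      using K by (simp add: \<sigma>.ev_sum) (auto simp: const_def[where 'v = nat] var_def mono_def lpow_single simp del: One_nat_def intro!: sum.cong)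
    have t_carr: "t i \<in> carrier (poly_ring (xy_vars d))" if "i < d" for i
      using xy.u(1)[OF that] by (simp add: t_def)
    have \<sigma>l_carr: "\<sigma> (l i) \<in> carrier (poly_ring (xy_vars d))" if "i < d" for i
      unfolding \<sigma>_l[OF that] using K by (intro poly_ring_sum poly_ring_mult t_carr) auto
    have t_cong: "t i - \<sigma> (l i) \<in> I" if i: "i < d" for i
    proof -
      have "(\<Sum>k<d. const ((if k = i then 1 else 0) - c i k) * t k) = t i - (\<Sum>k\<in>K. const (c i k) * t k)"
      proof -
        have "(\<Sum>k<d. const ((if k = i then 1 else 0) - c i k) * t k)
            = (\<Sum>k<d. if k = i then t i else 0) - (\<Sum>k<d. const (c i k) * t k)"
          unfolding sum_subtractf[symmetric]
          by (intro sum.cong) (auto simp: const_diff algebra_simps)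
        also have "(\<Sum>k<d. const (c i k) * t k) = (\<Sum>k\<in>K. const (c i k) * t k)"
          using K P i by (intro sum.mono_neutral_right) (auto simp: presents_def)
        finally show ?thesis using i by simp
      qed
      then show ?thesis using gen_mem[OF presents_unit(1)[OF P i]] by (simp add: \<sigma>_l[OF i] t_def)
    qed
    have decomp: "mono m = mono (low m) * lpow d t (e m)" and e_add: "y_part d m = y_part d (low m) + e m"
      if m: "m \<in> mons (xy_vars d)" for m
    proof -
      show e_add: "y_part d m = y_part d (low m) + e m"
        using least_mon_le[of d m]
        by (intro poly_mapping_eqI) (simp add: e_def low_def lookup_add lookup_minus)
      have "lpow d t \<beta> = mono (xy.lift \<beta>)" for \<beta>
      proof -
        have "mono (\<Sum>k<n. xy_mon i) = t i ^ n" for i n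
          by (induction n) (simp_all add: t_def mono_add mult.commute del: sum_constant)
        moreover have "mono (\<Sum>i<k. h i) = (\<Prod>i<k. mono (h i))" for k :: nat and h :: "nat \<Rightarrow> (nat + nat) mon"
          by (induction k) (simp_all add: mono_add mult.commute)
        ultimately show ?thesis by (simp add: lpow_def xy.lift_def)
      qed
      moreover have "m = low m + xy.lift (e m)"
      proof (rule poly_mapping_eqI)
        fix v
        have lift: "coef (xy.lift (e m)) (Inl i) = coef (e m) i \<and> coef (xy.lift (e m)) (Inr i) = coef (e m) i"
          if "i < d" for i
        proof -
          have "coef (xy.lift (e m)) w = (\<Sum>k<d. coef (e m) k * coef (xy_mon k) w)" for w
            unfolding xy.lift_def lookup_sum by simp
          moreover have "(\<Sum>k<d. coef (e m) k * coef (xy_mon k) w) = (\<Sum>k<d. if k = i then coef (e m) i else 0)"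
            if "w = Inl i \<or> w = Inr i" for w
            using that by (intro sum.cong) (auto simp: xy_mon_def lookup_add lookup_single when_def)
          ultimately show ?thesis using that by simp
        qed
        have "low m + xy.lift (e m) \<in> mons (xy_vars d)"
          unfolding low_def by (intro mons_add least_mon_mons xy.lift_mons)
        note out = xy_monsD[OF this] xy_monsD[OF m]
        show "coef m v = coef (low m + xy.lift (e m)) v"
        proof (cases v)
          case (Inl i)
          then show ?thesis
            using out[of i] lift[of i]
            by (cases "i < d") (simp_all add: lookup_add low_def coef_least_mon coef_xy_diff e_def lookup_minus coef_y_part)
        next
          case (Inr i)
          then show ?thesis
            using out[of i] lift[of i]
            by (cases "i < d") (simp_all add: lookup_add low_def coef_least_mon coef_xy_diff e_def lookup_minus coef_y_part)
        qed
      qed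
      ultimately show "mono m = mono (low m) * lpow d t (e m)" by (metis mono_add)
    qed
    have cong: "mono m - mono (low m) * \<sigma> (lpow d l (e m)) \<in> I" if m: "m \<in> mons (xy_vars d)" for m
    proof -
      have "lpow d t (e m) - lpow d (\<lambda>i. \<sigma> (l i)) (e m) \<in> I"
        by (rule ideal_prod_cong[OF I t_carr \<sigma>l_carr t_cong])
      moreover have "\<sigma> (lpow d l (e m)) = lpow d (\<lambda>i. \<sigma> (l i)) (e m)"
        unfolding lpow_def[of d _ "e m"] \<sigma>_def by (simp add: \<sigma>.ev_prod)
      moreover have "mono (low m) \<in> carrier (poly_ring (xy_vars d))"
        unfolding low_def by (simp add: least_mon_mons)
      ultimately have "mono (low m) * (lpow d t (e m) - \<sigma> (lpow d l (e m))) \<in> I"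
        using I'(4) by metis
      then show ?thesis unfolding decomp[OF m] by (simp add: right_diff_distrib)
    qed
    define F where "F \<gamma> = (\<Sum>m | m \<in> supp f \<and> xy_diff d m = \<gamma>. const (coef f m) * lpow d l (e m))" for \<gamma>
    have F0: "F \<gamma> = 0" for \<gamma>
    proof -
      have "lpow d l (y_part d (least_mon d \<gamma>)) * F \<gamma> = xy.fibre_sum l \<gamma> f"
        unfolding F_def xy.fibre_sum_def sum_distrib_left
      proof (rule sum.cong[OF refl])
        fix m assume m: "m \<in> {m \<in> supp f. xy_diff d m = \<gamma>}"
        then have "y_part d m = y_part d (least_mon d \<gamma>) + e m"
          using e_add[of m] fV by (auto simp: low_def)
        then show "lpow d l (y_part d (least_mon d \<gamma>)) * (const (coef f m) * lpow d l (e m))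
            = const (coef f m) * lpow d l (y_part d m)"
          by (simp add: lpow_add mult_ac)
      qed
      moreover have "lpow d l (y_part d (least_mon d \<gamma>)) \<noteq> 0"
        unfolding l_def by (intro lpow_nonzero xy.presents_lin_form_nonzero[OF P])
      ultimately show ?thesis using f0 by simp
    qed
    have "(\<Sum>m\<in>supp f. const (coef f m) * (mono m - mono (low m) * \<sigma> (lpow d l (e m)))) \<in> I"
      using cong fV by (intro I'(7) I'(4)) auto
    moreover have "(\<Sum>m\<in>supp f. const (coef f m) * (mono (low m) * \<sigma> (lpow d l (e m)))) = 0"
    proof -
      have \<sigma>_const: "\<sigma> (const x * p) = const x * \<sigma> p" for x p
        unfolding \<sigma>_def by (simp add: const_def[where 'v = nat])
      have "(\<Sum>m\<in>supp f. const (coef f m) * (mono (low m) * \<sigma> (lpow d l (e m))))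
          = (\<Sum>\<gamma>\<in>xy_diff d ` supp f. \<Sum>m | m \<in> supp f \<and> xy_diff d m = \<gamma>.
              const (coef f m) * (mono (low m) * \<sigma> (lpow d l (e m))))"
        by (rule sum.image_gen) simp
      also have "\<dots> = (\<Sum>\<gamma>\<in>xy_diff d ` supp f. mono (least_mon d \<gamma>) * \<sigma> (F \<gamma>))"
      proof (rule sum.cong[OF refl])
        fix \<gamma>
        have "\<sigma> (F \<gamma>) = (\<Sum>m | m \<in> supp f \<and> xy_diff d m = \<gamma>. const (coef f m) * \<sigma> (lpow d l (e m)))"
          unfolding F_def \<sigma>_const[symmetric] unfolding \<sigma>_def by (rule \<sigma>.ev_sum)
        then show "(\<Sum>m | m \<in> supp f \<and> xy_diff d m = \<gamma>. const (coef f m) * (mono (low m) * \<sigma> (lpow d l (e m))))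
            = mono (least_mon d \<gamma>) * \<sigma> (F \<gamma>)"
          by (simp add: sum_distrib_left) (auto intro!: sum.cong simp: low_def mult_ac)
      qed
      also have "\<dots> = 0" by (simp add: F0 \<sigma>_def)
      finally show ?thesis .
    qed
    ultimately show "f \<in> I"
      by (simp add: right_diff_distrib sum_subtractf const_times_mono sum_terms)
  qed
  ultimately show ?thesis by (simp add: I_def)
qed

end

section \<open>Finite generation of monoids of exponents\<close>

lemma nat_sequence_incseq_subseq:
  fixes s :: "nat \<Rightarrow> nat"
  obtains r where "strict_mono r" "incseq (\<lambda>n. s (r n))"
proof -
  obtain f where f: "strict_mono f" "monoseq (\<lambda>n. s (f n))" using seq_monosub by blast
  then consider "incseq (\<lambda>n. s (f n))" | "decseq (\<lambda>n. s (f n))" unfolding monoseq_iff by blast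
  then show ?thesis
  proof cases
    case 1 then show ?thesis using that f(1) by blast
  next
    case 2
    define N where "N = (LEAST n. s (f n) = (LEAST L. \<exists>n. s (f n) = L))"
    have least: "s (f N) = (LEAST L. \<exists>n. s (f n) = L)"
    proof -
      have "\<exists>n. s (f n) = (LEAST L. \<exists>n. s (f n) = L)"
        by (rule LeastI_ex[of "\<lambda>L. \<exists>n. s (f n) = L"]) blast
      then show ?thesis unfolding N_def by (rule LeastI_ex)
    qed
    have "s (f (N + n)) = s (f N)" for n
    proof (rule antisym)
      show "s (f (N + n)) \<le> s (f N)" using 2 by (simp add: decseq_def)
      show "s (f N) \<le> s (f (N + n))" unfolding least by (rule Least_le) blast
    qed
    then have "incseq (\<lambda>n. s (f (N + n)))" by (simp add: incseq_def)
    moreover have "strict_mono (\<lambda>n. f (N + n))" using f(1) by (simp add: strict_mono_def)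
    ultimately show ?thesis using that by blast
  qed
qed

lemma common_incseq_subseq:
  fixes f :: "nat \<Rightarrow> 'x" and C :: "('x \<Rightarrow> nat) set"
  assumes "finite C"
  shows "\<exists>r. strict_mono r \<and> (\<forall>c\<in>C. incseq (\<lambda>n. c (f (r n))))"
  using assms
proof (induction C rule: finite_induct)
  case empty
  show ?case by (intro exI[of _ id]) (simp add: strict_mono_def)
next
  case (insert c C)
  then obtain r where r: "strict_mono r" "\<forall>c\<in>C. incseq (\<lambda>n. c (f (r n)))" by blast
  obtain r' where r': "strict_mono r'" "incseq (\<lambda>n. c (f (r (r' n))))"
    by (rule nat_sequence_incseq_subseq[of "\<lambda>n. c (f (r n))"])
  have mono: "r' m \<le> r' n" if "m \<le> n" for m n
    using strict_mono_less_eq[OF r'(1)] that by simp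
  have "strict_mono (\<lambda>n. r (r' n))" using r(1) r'(1) by (simp add: strict_mono_def)
  moreover have "incseq (\<lambda>n. c' (f (r (r' n))))" if "c' \<in> insert c C" for c'
    using that r(2) r'(2) mono by (auto simp: incseq_def)
  ultimately show ?case by (intro exI[of _ "\<lambda>n. r (r' n)"]) blast
qed

text \<open>
  Dickson's lemma, for a finite family of functions in place of coordinates.
\<close>

lemma infinite_comparable_pair:
  assumes "infinite M" "finite C"
  shows "\<exists>x\<in>M. \<exists>y\<in>M. x \<noteq> y \<and> (\<forall>c\<in>C. c x \<le> (c y :: nat))"
proof -
  obtain f :: "nat \<Rightarrow> 'a" where f: "inj f" "range f \<subseteq> M"
    using infinite_countable_subset[OF assms(1)] by blast
  obtain r where r: "strict_mono r" "\<forall>c\<in>C. incseq (\<lambda>n. c (f (r n)))"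
    using common_incseq_subseq[OF assms(2), of f] by blast
  have "r 0 \<noteq> r 1" using strict_mono_eq[OF r(1)] by simp
  then have "f (r 0) \<noteq> f (r 1)" using f(1) by (simp add: inj_eq)
  moreover have "\<forall>c\<in>C. c (f (r 0)) \<le> c (f (r 1))" using r(2) by (auto simp: incseq_def)
  ultimately show ?thesis using f(2) by (metis rangeI subsetD)
qed

definition rep :: "nat \<Rightarrow> 'x \<Rightarrow> 'x::comm_monoid_add" where
  "rep n x = (\<Sum>i<n. x)"

lemma rep_0 [simp]: "rep 0 x = 0" and rep_Suc: "rep (Suc n) x = x + rep n x"
  by (simp_all add: rep_def add.commute)

lemma rep_1 [simp]: "rep (Suc 0) x = x"
  by (simp add: rep_Suc)

lemma rep_add: "rep (m + n) x = rep m x + rep n x"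
  by (induction m) (simp_all add: rep_Suc add.assoc)

lemma additive_rep:
  assumes "F 0 = 0" "\<And>x y. F (x + y) = F x + F y" shows "F (rep n x) = rep n (F x)"
  by (induction n) (simp_all add: rep_Suc assms)

lemma rep_nat [simp]: "rep n (k::nat) = n * k"
  by (simp add: rep_def)

text \<open>
  If two elements are comparable under \<open>C\<close>, then the larger one is the smaller one plus an element of
  \<open>Q\<close>.  Hence irreducible elements are pairwise incomparable, and Dickson's lemma makes them finitely
  many; they generate by induction on the sum of the functions in \<open>C\<close>.
\<close>

lemma irreducible_generators:
  fixes Q :: "'x::cancel_comm_monoid_add set" and C :: "('x \<Rightarrow> nat) set"
  assumes C: "finite C" and add: "\<And>c x y. c \<in> C \<Longrightarrow> c (x + y) = c x + c y"
    and zero: "\<And>x. x \<in> Q \<Longrightarrow> (\<And>c. c \<in> C \<Longrightarrow> c x = 0) \<Longrightarrow> x = 0"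
    and diff: "\<And>x y. x \<in> Q \<Longrightarrow> y \<in> Q \<Longrightarrow> (\<And>c. c \<in> C \<Longrightarrow> c x \<le> c y) \<Longrightarrow> \<exists>z\<in>Q. y = x + z"
  shows "\<exists>F. finite F \<and> F \<subseteq> Q \<and> (\<forall>y\<in>Q. \<forall>z\<in>Q. y + z \<in> F \<longrightarrow> y = 0 \<or> z = 0) \<and>
    (\<forall>x\<in>Q. \<exists>n. x = (\<Sum>f\<in>F. rep (n f) f))"
proof -
  define reducible where "reducible x \<longleftrightarrow> (\<exists>y\<in>Q. \<exists>z\<in>Q. y \<noteq> 0 \<and> z \<noteq> 0 \<and> x = y + z)" for x
  define F where "F = {x \<in> Q. x \<noteq> 0 \<and> \<not> reducible x}"
  have fin: "finite F"
  proof (rule ccontr)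
    assume "infinite F"
    from infinite_comparable_pair[OF this C] obtain x y where
      xy: "x \<in> F" "y \<in> F" "x \<noteq> y" "\<forall>c\<in>C. c x \<le> c y" by (elim bexE conjE)
    then obtain z where z: "z \<in> Q" "y = x + z" using diff[of x y] by (auto simp: F_def)
    have "x \<in> Q" "x \<noteq> 0" "\<not> reducible y" using xy by (auto simp: F_def)
    then have "z = 0" using z unfolding reducible_def by blast
    then show False using z xy(3) by simp
  qed
  define size where "size x = (\<Sum>c\<in>C. c x)" for x
  have size_add: "size (x + y) = size x + size y" for x y
    by (simp add: size_def add sum.distrib)
  have size_pos: "0 < size x" if "x \<in> Q" "x \<noteq> 0" for x
  proof (rule ccontr)
    assume "\<not> 0 < size x"
    then have "\<forall>c\<in>C. c x = 0" unfolding size_def using C by simp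
    then show False using zero[OF that(1)] that(2) by blast
  qed
  have gen: "\<exists>n. x = (\<Sum>f\<in>F. rep (n f) f)" if "x \<in> Q" for x
    using that
  proof (induction "size x" arbitrary: x rule: less_induct)
    case less
    have "x = 0 \<or> x \<in> F \<or> reducible x"
      using less.prems by (cases "x = 0"; cases "reducible x") (simp_all add: F_def)
    then consider "x = 0" | "x \<in> F" | y z where "y \<in> Q" "z \<in> Q" "y \<noteq> 0" "z \<noteq> 0" "x = y + z"
      unfolding reducible_def by blast
    then show ?case
    proof cases
      case 1
      then show ?thesis by (intro exI[of _ "\<lambda>_. 0"]) simp
    next
      case 2
      have "(\<Sum>f\<in>F. rep (if f = x then 1 else 0) f) = (\<Sum>f\<in>F. if f = x then x else 0)"
        by (intro sum.cong) auto
      then have "x = (\<Sum>f\<in>F. rep (if f = x then 1 else 0) f)" using fin 2 by simp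
      then show ?thesis by (rule exI[of _ "\<lambda>f. if f = x then 1 else 0"])
    next
      case 3
      then have "size y < size x" "size z < size x" using size_pos[of y] size_pos[of z] by (auto simp: size_add)
      then obtain n n' where "y = (\<Sum>f\<in>F. rep (n f) f)" "z = (\<Sum>f\<in>F. rep (n' f) f)"
        using less.hyps 3 by metis
      then have "x = (\<Sum>f\<in>F. rep (n f + n' f) f)" using 3(5) by (simp add: rep_add sum.distrib)
      then show ?thesis by (rule exI[of _ "\<lambda>f. n f + n' f"])
    qed
  qed
  have "\<forall>y\<in>Q. \<forall>z\<in>Q. y + z \<in> F \<longrightarrow> y = 0 \<or> z = 0"
    unfolding F_def reducible_def by blast
  moreover have "F \<subseteq> Q" unfolding F_def by blast
  moreover have "\<forall>x\<in>Q. \<exists>n. x = (\<Sum>f\<in>F. rep (n f) f)" using gen by (rule ballI)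
  ultimately show ?thesis using fin by (intro exI[of _ F] conjI)
qed

subsection \<open>A Veronese submonoid generated in degrees zero and one\<close>

lemma y_degree_add: "y_degree (m + n) = y_degree m + y_degree n"
  unfolding y_degree_def
  by (rule setsum_keys_plus_distrib[of "\<lambda>v k. case v of Inl i \<Rightarrow> 0 | Inr j \<Rightarrow> k"]) (auto split: sum.splits)

lemma y_degree_0 [simp]: "y_degree 0 = 0"
  by (simp add: y_degree_def)

lemma y_degree_sum: "y_degree (sum g A) = (\<Sum>a\<in>A. y_degree (g a))"
  by (rule additive_sum) (auto simp: y_degree_add)

lemma y_degree_single: "y_degree (single v n) = (case v of Inl i \<Rightarrow> 0 | Inr j \<Rightarrow> n)"
  by (auto simp: y_degree_def split: sum.splits)

definition subst_mon :: "('v \<Rightarrow> 'w mon) \<Rightarrow> 'v mon \<Rightarrow> 'w mon" where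
  "subst_mon g z = (\<Sum>v\<in>supp z. rep (coef z v) (g v))"

lemma subst_mon_add: "subst_mon g (m + n) = subst_mon g m + subst_mon g n"
  unfolding subst_mon_def
  by (rule setsum_keys_plus_distrib) (auto simp: rep_add)

lemma subst_mon_0 [simp]: "subst_mon g 0 = 0"
  by (simp add: subst_mon_def)

lemma subst_mon_sum: "subst_mon g (sum h A) = (\<Sum>a\<in>A. subst_mon g (h a))"
  by (rule additive_sum) (auto simp: subst_mon_add)

lemma subst_mon_single [simp]: "subst_mon g (single v n) = rep n (g v)"
  by (simp add: subst_mon_def)

text \<open>
  The pairs of an exponent in \<open>H k\<close> and its degree \<open>k\<close> form a monoid that is closed under those
  differences which are again exponents.
\<close>

locale graded_exponents =
  fixes V :: "'v set" and H :: "nat \<Rightarrow> 'v mon set"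
  assumes finite_V: "finite V" and H_sub: "H k \<subseteq> mons V" and H_0: "0 \<in> H 0"
    and H_add: "m \<in> H k \<Longrightarrow> n \<in> H l \<Longrightarrow> m + n \<in> H (k + l)"
    and H_diff: "m \<in> H k \<Longrightarrow> m + n \<in> H (k + l) \<Longrightarrow> n \<in> H l"
    and H_1: "H 1 \<noteq> {}"
begin

lemma veronese_generators:
  assumes "0 < e"
  shows "\<exists>F. finite F \<and> (\<forall>m n. (m, n) \<in> F \<longrightarrow> m \<in> H (e * n)) \<and>
    (\<forall>n n'. \<forall>m\<in>H (e * n). \<forall>m'\<in>H (e * n'). (m + m', n + n') \<in> F \<longrightarrow> (m, n) = 0 \<or> (m', n') = 0) \<and>
    (\<forall>n. \<forall>m\<in>H (e * n). \<exists>c. (m, n) = (\<Sum>f\<in>F. rep (c f) f))"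
proof -
  define Q where "Q = {(m, n). m \<in> H (e * n)}"
  define C :: "('v mon \<times> nat \<Rightarrow> nat) set" where "C = insert snd ((\<lambda>v x. coef (fst x) v) ` V)"
  have supp: "coef m v = 0" if "(m, n) \<in> Q" "v \<notin> V" for m n v
  proof -
    have "m \<in> mons V" using that H_sub by (auto simp: Q_def)
    then show ?thesis using that(2) by (auto simp: mons_def in_keys_iff)
  qed
  have "finite C" using finite_V by (simp add: C_def)
  moreover have "c (x + y) = c x + c y" if "c \<in> C" for c x y
    using that by (auto simp: C_def lookup_add)
  moreover have "x = 0" if "x \<in> Q" "\<And>c. c \<in> C \<Longrightarrow> c x = 0" for x
  proof -
    obtain m n where x: "x = (m, n)" by (cases x)
    have "coef m v = 0" for v
      using supp[of m n v] that(1) that(2)[of "\<lambda>x. coef (fst x) v"] by (cases "v \<in> V") (auto simp: x C_def)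
    then have "m = 0" by (auto intro: poly_mapping_eqI)
    moreover have "n = 0" using that(2)[of snd] by (simp add: C_def x)
    ultimately show ?thesis by (simp add: x zero_prod_def)
  qed
  moreover have "\<exists>z\<in>Q. y = x + z" if xy: "x \<in> Q" "y \<in> Q" and le: "\<And>c. c \<in> C \<Longrightarrow> c x \<le> c y" for x y
  proof -
    obtain m n m' n' where x: "x = (m, n)" and y: "y = (m', n')" by (cases x, cases y)
    have "coef m v \<le> coef m' v" for v
    proof (cases "v \<in> V")
      case True
      then show ?thesis using le[of "\<lambda>x. coef (fst x) v"] by (simp add: C_def x y)
    next
      case False
      then show ?thesis using supp[of m n v] xy by (simp add: x)
    qed
    then have m': "m' = m + (m' - m)"
      by (intro poly_mapping_eqI) (simp add: lookup_add lookup_minus)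
    have n': "n' = n + (n' - n)" using le[of snd] by (simp add: C_def x y)
    have "e * n' = e * n + e * (n' - n)" by (subst n') (simp add: distrib_left)
    then have "m' - m \<in> H (e * (n' - n))"
      using xy m' H_diff[of m "e * n" "m' - m" "e * (n' - n)"] by (simp add: Q_def x y)
    then have "(m' - m, n' - n) \<in> Q" by (simp add: Q_def)
    moreover have "y = x + (m' - m, n' - n)" using m' n' by (simp add: x y)
    ultimately show ?thesis by blast
  qed
  ultimately have "\<exists>F. finite F \<and> F \<subseteq> Q \<and> (\<forall>y\<in>Q. \<forall>z\<in>Q. y + z \<in> F \<longrightarrow> y = 0 \<or> z = 0) \<and>
    (\<forall>x\<in>Q. \<exists>n. x = (\<Sum>f\<in>F. rep (n f) f))"
    by (rule irreducible_generators)
  then obtain F where F: "finite F" "F \<subseteq> Q" "\<forall>y\<in>Q. \<forall>z\<in>Q. y + z \<in> F \<longrightarrow> y = 0 \<or> z = 0"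
    "\<forall>x\<in>Q. \<exists>n. x = (\<Sum>f\<in>F. rep (n f) f)" by blast
  have Q: "(m, n) \<in> Q \<longleftrightarrow> m \<in> H (e * n)" for m n by (simp add: Q_def)
  show ?thesis
  proof (intro exI[of _ F] conjI allI ballI impI)
    show "m \<in> H (e * n)" if "(m, n) \<in> F" for m n using that F(2) Q by blast
    show "(m, n) = 0 \<or> (m', n') = 0"
      if "m \<in> H (e * n)" "m' \<in> H (e * n')" "(m + m', n + n') \<in> F" for m n m' n'
      using F(3)[unfolded Ball_def, rule_format, of "(m, n)" "(m', n')"] that Q by simp
    show "\<exists>c. (m, n) = (\<Sum>f\<in>F. rep (c f) f)" if "m \<in> H (e * n)" for m n
      using F(4) that Q by blast
  qed (rule F(1))
qed

lemma H_rep: "m \<in> H k \<Longrightarrow> rep n m \<in> H (n * k)"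
  by (induction n) (auto simp: H_0 rep_Suc intro: H_add)

lemma H_sum: "finite A \<Longrightarrow> (\<And>a. a \<in> A \<Longrightarrow> g a \<in> H (k a)) \<Longrightarrow> sum g A \<in> H (sum k A)"
  by (induction A rule: finite_induct) (auto simp: H_0 intro: H_add)

lemma fst_rep: "fst (rep n x) = rep n (fst x)" and snd_rep: "snd (rep n x) = rep n (snd x)"
  by (rule additive_rep; simp)+

text \<open>
  Let \<open>s\<close> generators have positive degree and let \<open>L\<close> be the product of their degrees.  In degree at
  least \<open>s * L\<close> some generator contributes at least \<open>L\<close>, and as its degree divides \<open>L\<close>, an element of
  degree exactly \<open>L\<close> can be split off.  Starting in degree at least \<open>2 * (s * L)\<close>, this can be done \<open>s\<close>
  times, which splits off an element of degree \<open>s * L\<close>.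
\<close>

lemma exists_splitting_degree:
  "\<exists>e>0. \<forall>k. \<forall>m\<in>H k. 2 * e \<le> k \<longrightarrow> (\<exists>m1\<in>H e. \<exists>m2\<in>H (k - e). m = m1 + m2)"
proof -
  obtain F where F1: "finite F" "\<forall>m n. (m, n) \<in> F \<longrightarrow> m \<in> H (1 * n)"
    and gen1: "\<forall>n. \<forall>m\<in>H (1 * n). \<exists>c. (m, n) = (\<Sum>f\<in>F. rep (c f) f)"
    using veronese_generators[OF zero_less_one] by (elim exE conjE)
  have F: "finite F" "\<And>m n. (m, n) \<in> F \<Longrightarrow> m \<in> H n"
    and gen: "\<And>m n. m \<in> H n \<Longrightarrow> \<exists>c. (m, n) = (\<Sum>f\<in>F. rep (c f) f)"
    using F1 gen1 by simp_all
  define F1 where "F1 = {f \<in> F. snd f \<noteq> 0}"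
  define L where "L = (\<Prod>f\<in>F1. snd f)"
  define s where "s = card F1"
  have F1: "finite F1" "F1 \<subseteq> F" using F by (auto simp: F1_def)
  have degree: "k = (\<Sum>f\<in>F1. c f * snd f)" if "(m, k) = (\<Sum>f\<in>F. rep (c f) f)" for m k c
  proof -
    have "k = snd (\<Sum>f\<in>F. rep (c f) f)" by (simp flip: that)
    also have "\<dots> = (\<Sum>f\<in>F. c f * snd f)" by (simp add: snd_sum snd_rep)
    also have "\<dots> = (\<Sum>f\<in>F1. c f * snd f)" using F F1 by (intro sum.mono_neutral_right) (auto simp: F1_def)
    finally show ?thesis .
  qed
  have "L \<noteq> 0" using F1 by (simp add: L_def F1_def)
  moreover have "s \<noteq> 0"
  proof
    assume "s = 0"
    then have "F1 = {}" using F1 by (simp add: s_def)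
    obtain m where "m \<in> H 1" using H_1 by blast
    then show False using gen[of m 1] degree[of m 1] \<open>F1 = {}\<close> by auto
  qed
  ultimately have Ls: "0 < L" "0 < s" by auto
  \<comment> \<open>pigeonhole: in degree at least \<open>s * L\<close> some generator contributes at least \<open>L\<close> to the degree\<close>
  have split: "\<exists>m1\<in>H L. \<exists>m2\<in>H (k - L). m = m1 + m2" if m: "m \<in> H k" and k: "s * L \<le> k" for m k
  proof -
    obtain c where c: "(m, k) = (\<Sum>f\<in>F. rep (c f) f)" using gen[OF m] by blast
    have "\<exists>f\<in>F1. L \<le> c f * snd f"
    proof (rule ccontr)
      assume "\<not> ?thesis"
      then have "(\<Sum>f\<in>F1. c f * snd f) < (\<Sum>f\<in>F1. L)"
        using F1 Ls by (intro sum_strict_mono) (auto simp: s_def)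
      then show False using degree[OF c] k by (simp add: s_def)
    qed
    then obtain f where f: "f \<in> F1" "L \<le> c f * snd f" by blast
    have "snd f dvd L" unfolding L_def using F1(1) f(1) by (rule dvd_prodI)
    then obtain q where q: "L = q * snd f" by (metis dvd_def mult.commute)
    have "q \<le> c f" using f by (simp add: q F1_def)
    then have cf: "c f = q + (c f - q)" by simp
    define m2 where "m2 = rep (c f - q) (fst f) + (\<Sum>g\<in>F - {f}. rep (c g) (fst g))"
    have "m = fst (\<Sum>f\<in>F. rep (c f) f)" by (simp flip: c)
    also have "\<dots> = rep (c f) (fst f) + (\<Sum>g\<in>F - {f}. rep (c g) (fst g))"
    proof -
      have "f \<in> F" using f F1 by blast
      then show ?thesis by (simp add: fst_sum fst_rep sum.remove[OF F(1)])
    qed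
    also have "rep (c f) (fst f) = rep q (fst f) + rep (c f - q) (fst f)"
      by (subst cf) (rule rep_add)
    finally have m: "m = rep q (fst f) + m2" by (simp add: m2_def add.assoc)
    have fH: "fst f \<in> H (snd f)" using F(2)[of "fst f" "snd f"] f F1 by auto
    have "rep q (fst f) \<in> H L" unfolding q by (rule H_rep[OF fH])
    moreover have "m2 \<in> H (k - L)"
      using H_diff[of "rep q (fst f)" L m2 "k - L"] that calculation m k f Ls
      by (metis le_add_diff_inverse le_trans mult_le_mono1 mult_1 less_eq_Suc_le One_nat_def)
    ultimately show ?thesis using m by blast
  qed
  have "\<exists>m1\<in>H (j * L). \<exists>m2\<in>H (k - j * L). m = m1 + m2"
    if "j \<le> s" "m \<in> H k" "2 * (s * L) \<le> k" for j m k
    using that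
  proof (induction j)
    case 0
    then show ?case using H_0 by (intro bexI[of _ 0] bexI[of _ m]) auto
  next
    case (Suc j)
    then obtain m1 m2 where m: "m1 \<in> H (j * L)" "m2 \<in> H (k - j * L)" "m = m1 + m2" by auto
    have "j * L \<le> s * L" using Suc.prems(1) by (intro mult_le_mono1) simp
    then have "s * L \<le> k - j * L" using Suc.prems(3) by linarith
    from split[OF m(2) this] obtain m3 m4 where m': "m3 \<in> H L" "m4 \<in> H (k - j * L - L)" "m2 = m3 + m4"
      by blast
    have "m1 + m3 \<in> H (Suc j * L)" using H_add[OF m(1) m'(1)] by (simp add: add.commute)
    moreover have "m4 \<in> H (k - Suc j * L)" using m'(2) by (simp add: add.commute)
    moreover have "m = (m1 + m3) + m4" using m m' by (simp add: add.assoc)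
    ultimately show ?case by blast
  qed
  then have "\<forall>k. \<forall>m\<in>H k. 2 * (s * L) \<le> k \<longrightarrow> (\<exists>m1\<in>H (s * L). \<exists>m2\<in>H (k - s * L). m = m1 + m2)"
    by blast
  moreover have "0 < s * L" using Ls by simp
  ultimately show ?thesis by blast
qed

text \<open>
  In the Veronese submonoid of degrees divisible by \<open>e\<close>, with \<open>e\<close> as its unit of degree, an
  irreducible element has degree at most one, since from degree two on an element of degree one can
  be split off.
\<close>

lemma exists_degree_one_generators:
  obtains e p q g where "0 < e"
    "\<And>i. i \<in> {1..p} \<Longrightarrow> g (Inl i) \<in> H 0" "\<And>j. j \<in> {0..q} \<Longrightarrow> g (Inr j) \<in> H e"
    "\<And>m n. m \<in> H (e * n) \<Longrightarrow> \<exists>z\<in>mons (zy_vars p q). y_degree z = n \<and> subst_mon g z = m"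
proof -
  obtain e where e: "0 < e"
    "\<forall>k. \<forall>m\<in>H k. 2 * e \<le> k \<longrightarrow> (\<exists>m1\<in>H e. \<exists>m2\<in>H (k - e). m = m1 + m2)"
    using exists_splitting_degree by blast
  obtain F where fin_F: "finite F" and FH: "\<forall>m n. (m, n) \<in> F \<longrightarrow> m \<in> H (e * n)"
    and irr0: "\<forall>n n'. \<forall>m\<in>H (e * n). \<forall>m'\<in>H (e * n'). (m + m', n + n') \<in> F \<longrightarrow> (m, n) = 0 \<or> (m', n') = 0"
    and gen0: "\<forall>n. \<forall>m\<in>H (e * n). \<exists>c. (m, n) = (\<Sum>f\<in>F. rep (c f) f)"
    using veronese_generators[OF e(1)] by (elim exE conjE)
  note F = fin_F FH[rule_format] and irr = irr0[rule_format] and gen = gen0[rule_format]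
  have deg: "n \<le> 1" if mn: "(m, n) \<in> F" for m n
  proof (rule ccontr)
    assume "\<not> n \<le> 1"
    then have n: "2 \<le> n" by simp
    then have "2 * e \<le> e * n" by simp
    then obtain m1 m2 where m: "m1 \<in> H e" "m2 \<in> H (e * n - e)" "m = m1 + m2"
      using e(2) F(2)[OF mn] by blast
    have "e * n - e = e * (n - 1)" by (simp add: diff_mult_distrib2)
    then show False
      using irr[of m1 1 m2 "n - 1"] m mn n by (simp add: zero_prod_def)
  qed
  define F0 where "F0 = {m. (m, 0) \<in> F}"
  define F1 where "F1 = {m. (m, 1::nat) \<in> F}"
  have fin: "finite F0" "finite F1"
    by (rule finite_subset[OF _ finite_imageI[OF F(1), of fst]]; force simp: F0_def F1_def)+
  have "F1 \<noteq> {}"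
  proof
    assume "F1 = {}"
    then have "snd f = 0" if "f \<in> F" for f
      using deg[of "fst f" "snd f"] that by (cases f) (auto simp: F1_def le_Suc_eq)
    moreover obtain m where "m \<in> H 1" using H_1 by blast
    then have "rep e m \<in> H (e * 1)" using H_rep[of m 1 e] by simp
    then obtain c where "(rep e m, 1) = (\<Sum>f\<in>F. rep (c f) f)" using gen by metis
    then have "1 = snd (\<Sum>f\<in>F. rep (c f) f)" by (metis snd_conv)
    then have "1 = (\<Sum>f\<in>F. c f * snd f)" by (simp add: snd_sum snd_rep)
    ultimately show False by simp
  qed
  then obtain q where q: "card F1 = Suc q" using fin(2) by (metis card_0_eq not0_implies_Suc)
  obtain h0 where h0: "bij_betw h0 {1..card F0} F0" using ex_bij_betw_nat_finite_1[OF fin(1)] by blast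
  obtain h1 where h1: "bij_betw h1 {0..<card F1} F1" using ex_bij_betw_nat_finite[OF fin(2)] by blast
  define g where "g = case_sum h0 h1"
  have range: "{0..<card F1} = {0..q}" unfolding q by auto
  have idx: "\<exists>v\<in>zy_vars (card F0) q. g v = fst f \<and> (\<forall>n. y_degree (single v n) = n * snd f)" if f: "f \<in> F" for f
  proof -
    have "snd f = 0 \<or> snd f = 1" using deg[of "fst f" "snd f"] f by auto
    then show ?thesis
    proof
      assume "snd f = 0"
      then have "fst f \<in> F0" using f unfolding F0_def by (metis mem_Collect_eq prod.collapse)
      then obtain i where "i \<in> {1..card F0}" "h0 i = fst f" using h0 unfolding bij_betw_def by (metis imageE)
      then show ?thesis using \<open>snd f = 0\<close>
        by (intro bexI[of _ "Inl i"]) (auto simp: g_def y_degree_single zy_vars_def)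
    next
      assume "snd f = 1"
      then have "fst f \<in> F1" using f unfolding F1_def by (metis mem_Collect_eq prod.collapse)
      then obtain j where "j \<in> {0..q}" "h1 j = fst f"
        using h1 unfolding bij_betw_def range by (metis imageE)
      then show ?thesis using \<open>snd f = 1\<close>
        by (intro bexI[of _ "Inr j"]) (auto simp: g_def y_degree_single zy_vars_def)
    qed
  qed
  then obtain v where v: "\<And>f. f \<in> F \<Longrightarrow> v f \<in> zy_vars (card F0) q"
    "\<And>f. f \<in> F \<Longrightarrow> g (v f) = fst f" "\<And>f n. f \<in> F \<Longrightarrow> y_degree (single (v f) n) = n * snd f"
    by metis
  have "\<exists>z\<in>mons (zy_vars (card F0) q). y_degree z = n \<and> subst_mon g z = m" if m: "m \<in> H (e * n)" for m n
  proof -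
    obtain c where c: "(m, n) = (\<Sum>f\<in>F. rep (c f) f)" using gen[OF m] by blast
    define z where "z = (\<Sum>f\<in>F. single (v f) (c f))"
    have "z \<in> mons (zy_vars (card F0) q)"
      unfolding z_def by (intro mons_sum) (auto simp: mons_def v split: if_splits)
    moreover have "y_degree z = snd (\<Sum>f\<in>F. rep (c f) f)"
      by (simp add: z_def y_degree_sum v snd_sum snd_rep)
    moreover have "subst_mon g z = fst (\<Sum>f\<in>F. rep (c f) f)"
      by (simp add: z_def subst_mon_sum v fst_sum fst_rep)
    ultimately show ?thesis using c[symmetric] by auto
  qed
  moreover have "g (Inl i) \<in> H 0" if "i \<in> {1..card F0}" for i
    using bij_betwE[OF h0] that F(2)[of "h0 i" 0] by (auto simp: g_def F0_def)
  moreover have "g (Inr j) \<in> H e" if "j \<in> {0..q}" for j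
    using bij_betwE[OF h1] that F(2)[of "h1 j" 1] unfolding range by (auto simp: g_def F1_def)
  ultimately show ?thesis using that e(1) by blast
qed

end

section \<open>Graded rings and their homogeneous primes\<close>

lemma (in cring) idealI_closed:
  assumes "I \<subseteq> carrier R" "\<zero> \<in> I" "\<And>x y. x \<in> I \<Longrightarrow> y \<in> I \<Longrightarrow> x \<oplus> y \<in> I"
    and mult: "\<And>x r. x \<in> I \<Longrightarrow> r \<in> carrier R \<Longrightarrow> r \<otimes> x \<in> I"
  shows "ideal I R"
proof (rule idealI)
  have neg: "\<ominus> x \<in> I" if "x \<in> I" for x
    using mult[OF that, of "\<ominus> \<one>"] assms(1) that by (auto simp: l_minus subset_iff)
  show "subgroup I (add_monoid R)"
    using assms neg by unfold_locales (auto simp: a_inv_def)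
  show "x \<otimes> a \<in> I" "a \<otimes> x \<in> I" if "a \<in> I" "x \<in> carrier R" for a x
    using mult[OF that] assms(1) that m_comm[of a x] by auto
qed (rule ring_axioms)

lemma (in ideal) finsum_mem:
  assumes "finite F" "\<And>i. i \<in> F \<Longrightarrow> f i \<in> I"
  shows "finsum R f F \<in> I"
  using assms
proof (induction F rule: finite_induct)
  case (insert i F)
  then have "finsum R f (insert i F) = f i \<oplus> finsum R f F"
    using a_Hcarr by (intro finsum_insert) auto
  then show ?case using insert by (auto intro: a_closed)
qed (simp add: additive_subgroup.zero_closed additive_subgroup_axioms)

lemma (in primeideal) pow_mem_iff:
  assumes "a \<in> carrier R" "0 < n" shows "a [^] (n::nat) \<in> I \<longleftrightarrow> a \<in> I"
proof
  assume "a [^] n \<in> I"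
  moreover have "a [^] n \<in> I \<longrightarrow> a \<in> I" if "0 < n" for n :: nat
    using that
  proof (induction n rule: nat_induct_non_zero)
    case 1 then show ?case using assms(1) by simp
  next
    case (Suc n)
    then show ?case using I_prime[of "a [^] n" a] assms(1) by auto
  qed
  ultimately show "a \<in> I" using assms(2) by blast
next
  assume "a \<in> I"
  moreover obtain k where "n = Suc k" using assms(2) gr0_implies_Suc by blast
  ultimately show "a [^] n \<in> I" using assms(1) I_l_closed by simp
qed

lemma (in primeideal) one_notin: "\<one> \<notin> I"
  using I_notcarr one_imp_carrier by blast

lemma UN_pairs_const:
  assumes "p \<in> X" "q \<in> Y" "\<And>a b c d. (a, b) \<in> X \<Longrightarrow> (c, d) \<in> Y \<Longrightarrow> g a b c d = Z"
  shows "(\<Union>(a, b)\<in>X. \<Union>(c, d)\<in>Y. g a b c d) = Z"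
proof -
  have "(\<Union>(a, b)\<in>X. \<Union>(c, d)\<in>Y. g a b c d) = (\<Union>x\<in>X. \<Union>y\<in>Y. Z)"
    using assms(3) by (intro SUP_cong refl) (auto split: prod.splits)
  then show ?thesis using assms(1,2) by auto
qed

text \<open>
  The projections \<open>comp n\<close> to the graded pieces are part of the data, because they are explicit in the
  examples.  The last two axioms make every element the sum of its finitely many nonzero components.
\<close>

locale graded_ring = cring S for S :: "('a, 'm) ring_scheme" (structure) +
  fixes A :: "nat \<Rightarrow> 'a set" and comp :: "nat \<Rightarrow> 'a \<Rightarrow> 'a"
  assumes A_sub: "x \<in> A n \<Longrightarrow> x \<in> carrier S"
    and A_one: "\<one> \<in> A 0"
    and A_zero: "\<zero> \<in> A n"
    and A_add: "x \<in> A n \<Longrightarrow> y \<in> A n \<Longrightarrow> x \<oplus> y \<in> A n"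
    and A_mult: "x \<in> A m \<Longrightarrow> y \<in> A n \<Longrightarrow> x \<otimes> y \<in> A (m + n)"
    and comp_in: "x \<in> carrier S \<Longrightarrow> comp n x \<in> A n"
    and comp_add: "x \<in> carrier S \<Longrightarrow> y \<in> carrier S \<Longrightarrow> comp n (x \<oplus> y) = comp n x \<oplus> comp n y"
    and comp_hom: "x \<in> A m \<Longrightarrow> comp n x = (if n = m then x else \<zero>)"
    and comp_finite: "x \<in> carrier S \<Longrightarrow> finite {n. comp n x \<noteq> \<zero>}"
    and comp_ext: "x \<in> carrier S \<Longrightarrow> y \<in> carrier S \<Longrightarrow> (\<And>n. comp n x = comp n y) \<Longrightarrow> x = y"
begin

lemma comp_closed [simp]: "x \<in> carrier S \<Longrightarrow> comp n x \<in> carrier S"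
  using comp_in A_sub by blast

lemma comp_zero [simp]: "comp n \<zero> = \<zero>"
  using comp_hom[OF A_zero[of 0], of n] by (simp split: if_splits)

lemma comp_finsum:
  assumes "finite F" "\<And>i. i \<in> F \<Longrightarrow> f i \<in> carrier S"
  shows "comp n (finsum S f F) = finsum S (\<lambda>i. comp n (f i)) F"
  using assms
proof (induction F rule: finite_induct)
  case (insert i F)
  then have 1: "finsum S f (insert i F) = f i \<oplus> finsum S f F"
    and 2: "finsum S (\<lambda>i. comp n (f i)) (insert i F) = comp n (f i) \<oplus> finsum S (\<lambda>i. comp n (f i)) F"
    by (auto intro!: finsum_insert)
  have "finsum S f F \<in> carrier S" using insert by (intro finsum_closed) auto
  then show ?case unfolding 1 2 using insert by (simp add: comp_add)
qed simp

lemma sum_comps: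
  assumes "x \<in> carrier S" "finite F" "{n. comp n x \<noteq> \<zero>} \<subseteq> F"
  shows "finsum S (\<lambda>n. comp n x) F = x"
proof (rule comp_ext)
  fix n
  have "comp n (finsum S (\<lambda>n. comp n x) F) = finsum S (\<lambda>i. if n = i then comp n x else \<zero>) F"
    using assms by (simp add: comp_finsum comp_hom[OF comp_in[OF assms(1)]] cong: if_cong)
  also have "\<dots> = comp n x"
  proof (cases "n \<in> F")
    case True
    then show ?thesis using assms by (intro finsum_singleton) auto
  next
    case False
    then have "comp n x = \<zero>" using assms(3) by blast
    moreover have "finsum S (\<lambda>i. if n = i then comp n x else \<zero>) F = finsum S (\<lambda>i. \<zero>) F"
      using False by (intro finsum_cong') auto
    ultimately show ?thesis by simp
  qed
  finally show "comp n (finsum S (\<lambda>n. comp n x) F) = comp n x" .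
qed (use assms in \<open>auto intro!: finsum_closed\<close>)

lemma comp_induct:
  assumes x: "x \<in> carrier S" and "Q \<zero>"
    and "\<And>y z. y \<in> carrier S \<Longrightarrow> z \<in> carrier S \<Longrightarrow> Q y \<Longrightarrow> Q z \<Longrightarrow> Q (y \<oplus> z)"
    and "\<And>n. Q (comp n x)"
  shows "Q x"
proof -
  have "Q (finsum S (\<lambda>n. comp n x) F)" if "finite F" for F
    using that
  proof (induction F rule: finite_induct)
    case (insert i F)
    have "finsum S (\<lambda>n. comp n x) (insert i F) = comp i x \<oplus> finsum S (\<lambda>n. comp n x) F"
      using insert x by (intro finsum_insert) auto
    moreover have "finsum S (\<lambda>n. comp n x) F \<in> carrier S" using x by (intro finsum_closed) auto
    ultimately show ?case using insert x assms(3,4) by simp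
  qed (use assms(2) in simp)
  from this[OF comp_finite[OF x]] show ?thesis using sum_comps[OF x comp_finite[OF x]] by simp
qed

lemma comp_mult:
  assumes a: "a \<in> A m" and x: "x \<in> carrier S"
  shows "comp n (a \<otimes> x) = (if m \<le> n then a \<otimes> comp (n - m) x else \<zero>)"
  using x
proof (rule comp_induct)
  fix y z assume yz: "y \<in> carrier S" "z \<in> carrier S"
    "comp n (a \<otimes> y) = (if m \<le> n then a \<otimes> comp (n - m) y else \<zero>)"
    "comp n (a \<otimes> z) = (if m \<le> n then a \<otimes> comp (n - m) z else \<zero>)"
  then show "comp n (a \<otimes> (y \<oplus> z)) = (if m \<le> n then a \<otimes> comp (n - m) (y \<oplus> z) else \<zero>)"
    using A_sub[OF a] by (auto simp: r_distr comp_add)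
next
  fix j
  have "a \<otimes> comp j x \<in> A (m + j)" by (rule A_mult[OF a comp_in[OF x]])
  then show "comp n (a \<otimes> comp j x) = (if m \<le> n then a \<otimes> comp (n - m) (comp j x) else \<zero>)"
    using comp_hom comp_hom[OF comp_in[OF x, of j]] A_sub[OF a] by auto
qed (use A_sub[OF a] in simp)

lemma ideal_comp_mem:
  assumes "ideal I S" "x \<in> carrier S" "\<And>n. comp n x \<in> I"
  shows "x \<in> I"
proof -
  interpret I: ideal I S by fact
  show ?thesis
    by (rule comp_induct[OF assms(2), of "\<lambda>x. x \<in> I"])
       (auto intro: I.a_closed assms(3) simp: additive_subgroup.zero_closed I.additive_subgroup_axioms)
qed

lemma homogeneous_ideal_iff:
  assumes I: "ideal I S"
  shows "homogeneous_ideal S A I \<longleftrightarrow> (\<forall>x\<in>I. \<forall>n. comp n x \<in> I)"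
proof
  interpret I: ideal I S by fact
  have sub: "I \<inter> homog_elems A \<subseteq> carrier S" using I.a_subset by blast
  assume hom: "homogeneous_ideal S A I"
  define X where "X = {x \<in> carrier S. \<forall>n. comp n x \<in> I}"
  have "ideal X S"
  proof (rule idealI_closed)
    show "r \<otimes> x \<in> X" if x: "x \<in> X" and r: "r \<in> carrier S" for x r
    proof -
      have xc: "x \<in> carrier S" using x by (simp add: X_def)
      have "\<forall>n. comp n (r \<otimes> x) \<in> I"
        using r
      proof (rule comp_induct)
        fix m
        show "\<forall>n. comp n (comp m r \<otimes> x) \<in> I"
          using x r by (auto simp: comp_mult[OF comp_in[OF r] xc] X_def I.I_l_closed
              additive_subgroup.zero_closed I.additive_subgroup_axioms)
      qed (use xc in \<open>auto simp: l_distr comp_add intro: I.a_closed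
              simp: additive_subgroup.zero_closed I.additive_subgroup_axioms\<close>)
      then show ?thesis using xc r by (simp add: X_def)
    qed
  qed (auto simp: X_def comp_add additive_subgroup.zero_closed I.additive_subgroup_axioms I.a_closed)
  moreover have "I \<inter> homog_elems A \<subseteq> X"
    using I.a_subset by (auto simp: X_def homog_elems_def comp_hom
        additive_subgroup.zero_closed I.additive_subgroup_axioms)
  ultimately have "genideal S (I \<inter> homog_elems A) \<subseteq> X" by (auto simp: genideal_def)
  then show "\<forall>x\<in>I. \<forall>n. comp n x \<in> I"
    using hom unfolding homogeneous_ideal_def X_def by blast
next
  interpret I: ideal I S by fact
  have sub: "I \<inter> homog_elems A \<subseteq> carrier S" using I.a_subset by blast
  assume comps: "\<forall>x\<in>I. \<forall>n. comp n x \<in> I"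
  have "I \<subseteq> genideal S (I \<inter> homog_elems A)"
  proof
    fix x assume x: "x \<in> I"
    then have "comp n x \<in> I \<inter> homog_elems A" for n
      using comps comp_in[of x n] I.a_subset by (auto simp: homog_elems_def)
    then have "comp n x \<in> genideal S (I \<inter> homog_elems A)" for n
      using genideal_self[OF sub] by blast
    then show "x \<in> genideal S (I \<inter> homog_elems A)"
      using ideal_comp_mem[OF genideal_ideal[OF sub]] x I.a_subset by blast
  qed
  moreover have "genideal S (I \<inter> homog_elems A) \<subseteq> I"
    by (rule genideal_minimal[OF I]) auto
  ultimately show "homogeneous_ideal S A I" using I by (auto simp: homogeneous_ideal_def)
qed

lemma homogeneous_primeidealI:
  assumes I: "ideal I S" and comps: "\<And>x n. x \<in> I \<Longrightarrow> comp n x \<in> I" and ne: "I \<noteq> carrier S"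
    and prime: "\<And>m n a b. a \<in> A m \<Longrightarrow> b \<in> A n \<Longrightarrow> a \<otimes> b \<in> I \<Longrightarrow> a \<in> I \<or> b \<in> I"
  shows "primeideal I S"
proof (rule primeidealI[OF I is_cring])
  interpret I: ideal I S by fact
  have z: "\<zero> \<in> I" by (simp add: additive_subgroup.zero_closed I.additive_subgroup_axioms)
  show "carrier S \<noteq> I" using ne by simp
  fix x y assume x: "x \<in> carrier S" and y: "y \<in> carrier S" and xy: "x \<otimes> y \<in> I"
  show "x \<in> I \<or> y \<in> I"
  proof (rule ccontr)
    assume contr: "\<not> (x \<in> I \<or> y \<in> I)"
    have ex: "\<exists>m. comp m x \<notin> I \<and> (\<forall>i<m. comp i x \<in> I)" if "x \<in> carrier S" "x \<notin> I" for x
    proof -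
      have "\<exists>m. comp m x \<notin> I" using ideal_comp_mem[OF I] that by blast
      then show ?thesis using exists_least_iff[of "\<lambda>m. comp m x \<notin> I"] by blast
    qed
    obtain m where m: "comp m x \<notin> I" "\<And>i. i < m \<Longrightarrow> comp i x \<in> I" using ex x contr by blast
    obtain n where n: "comp n y \<notin> I" "\<And>i. i < n \<Longrightarrow> comp i y \<in> I" using ex y contr by blast
    \<comment> \<open>in degree \<open>m + n\<close> only the product of the lowest components outside \<open>I\<close> survives modulo \<open>I\<close>\<close>
    define F where "F = {i. comp i x \<noteq> \<zero>}"
    define t where "t i = (if i \<le> m + n then comp i x \<otimes> comp (m + n - i) y else \<zero>)" for i
    have F: "finite F" "m \<in> F" using comp_finite[OF x] m(1) z by (auto simp: F_def)
    have t: "t i \<in> carrier S" for i using x y by (simp add: t_def)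
    have "x \<otimes> y = finsum S (\<lambda>i. comp i x) F \<otimes> y"
      using sum_comps[OF x F(1)] by (simp add: F_def)
    also have "\<dots> = finsum S (\<lambda>i. comp i x \<otimes> y) F"
      using x y F by (intro finsum_ldistr) auto
    finally have "comp (m + n) (x \<otimes> y) = finsum S t F"
      using x y F by (simp add: comp_finsum comp_mult[OF comp_in[OF x]] t_def[abs_def])
    then have "finsum S t F \<in> I" using comps[OF xy] by metis
    moreover have "finsum S t F = t m \<oplus> finsum S t (F - {m})"
      using F t by (metis Diff_iff Pi_I finite_Diff finsum_insert insert_Diff singletonI)
    moreover have rest: "finsum S t (F - {m}) \<in> I"
    proof (rule I.finsum_mem)
      fix i assume "i \<in> F - {m}"
      then consider "i < m" | "m < i" "i \<le> m + n" | "m + n < i" by fastforce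
      then show "t i \<in> I"
      proof cases
        case 1 then show ?thesis using m(2)[OF 1] y by (simp add: t_def I.I_r_closed)
      next
        case 2 then show ?thesis using n(2)[of "m + n - i"] x by (simp add: t_def I.I_l_closed)
      qed (simp add: t_def z)
    qed (use F in auto)
    moreover have "t m = (t m \<oplus> finsum S t (F - {m})) \<ominus> finsum S t (F - {m})"
      using t I.a_Hcarr[OF rest] by (simp add: a_minus_def a_assoc r_neg)
    ultimately have "t m \<in> I"
      using I.a_closed[of "finsum S t F" "\<ominus> finsum S t (F - {m})"]
        additive_subgroup.a_inv_closed[OF I.additive_subgroup_axioms] by (metis a_minus_def)
    then have "comp m x \<in> I \<or> comp n y \<in> I"
      using prime[OF comp_in[OF x] comp_in[OF y]] by (simp add: t_def)
    then show False using m n by blast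
  qed
qed

subsection \<open>Fractions\<close>

lemma hpairs_iff: "(a, b) \<in> hpairs A P \<longleftrightarrow> (\<exists>n. a \<in> A n \<and> b \<in> A n) \<and> b \<notin> P"
  by (simp add: hpairs_def)

lemma homog_elems_mult: "x \<in> homog_elems A \<Longrightarrow> y \<in> homog_elems A \<Longrightarrow> x \<otimes> y \<in> homog_elems A"
  using A_mult unfolding homog_elems_def by blast

lemma homog_elems_closed: "x \<in> homog_elems A \<Longrightarrow> x \<in> carrier S"
  using A_sub unfolding homog_elems_def by blast

lemma one_homog: "\<one> \<in> homog_elems A"
  using A_one unfolding homog_elems_def by blast

context
  fixes P assumes P: "primeideal P S"
begin

interpretation P: primeideal P S by (rule P)

lemma hfrac_eq_iff:
  assumes "(a, b) \<in> hpairs A P" "(a', b') \<in> hpairs A P"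
  shows "hfrac S A P a b = hfrac S A P a' b' \<longleftrightarrow>
    (\<exists>u\<in>homog_elems A - P. u \<otimes> (a \<otimes> b') = u \<otimes> (a' \<otimes> b))"
proof
  assume "hfrac S A P a b = hfrac S A P a' b'"
  moreover have "(a', b') \<in> hfrac S A P a' b'"
    using assms(2) one_homog P.one_notin by (auto simp: hfrac_def)
  ultimately have "(a', b') \<in> hfrac S A P a b" by simp
  then show "\<exists>u\<in>homog_elems A - P. u \<otimes> (a \<otimes> b') = u \<otimes> (a' \<otimes> b)" by (simp add: hfrac_def)
next
  have sub: "hfrac S A P a b \<subseteq> hfrac S A P a' b'"
    if u: "u \<in> homog_elems A - P" "u \<otimes> (a \<otimes> b') = u \<otimes> (a' \<otimes> b)"
      and ab: "(a, b) \<in> hpairs A P" "(a', b') \<in> hpairs A P" for a b a' b' u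
  proof
    fix z assume z: "z \<in> hfrac S A P a b"
    obtain c d where [simp]: "z = (c, d)" by (cases z)
    obtain v where v: "v \<in> homog_elems A - P" "v \<otimes> (a \<otimes> d) = v \<otimes> (c \<otimes> b)" "(c, d) \<in> hpairs A P"
      using z by (auto simp: hfrac_def)
    have cl: "a \<in> carrier S" "b \<in> carrier S" "a' \<in> carrier S" "b' \<in> carrier S" "c \<in> carrier S"
      "d \<in> carrier S" "u \<in> carrier S" "v \<in> carrier S" and bh: "b \<in> homog_elems A - P"
      using u v ab A_sub homog_elems_closed by (auto simp: hpairs_iff homog_elems_def)
    have "(u \<otimes> v \<otimes> b) \<otimes> (a' \<otimes> d) = (v \<otimes> d) \<otimes> (u \<otimes> (a' \<otimes> b))"
      using cl by (simp add: m_ac)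
    also have "\<dots> = (u \<otimes> b') \<otimes> (v \<otimes> (a \<otimes> d))"
      unfolding u(2)[symmetric] using cl by (simp add: m_ac)
    also have "\<dots> = (u \<otimes> v \<otimes> b) \<otimes> (c \<otimes> b')"
      unfolding v(2) using cl by (simp add: m_ac)
    finally have "(u \<otimes> v \<otimes> b) \<otimes> (a' \<otimes> d) = (u \<otimes> v \<otimes> b) \<otimes> (c \<otimes> b')" .
    moreover have "u \<otimes> v \<otimes> b \<in> homog_elems A - P"
      using u v bh cl P.I_prime by (metis DiffD1 DiffD2 DiffI homog_elems_mult m_closed)
    ultimately show "z \<in> hfrac S A P a' b'" using v(3) by (auto simp: hfrac_def)
  qed
  assume "\<exists>u\<in>homog_elems A - P. u \<otimes> (a \<otimes> b') = u \<otimes> (a' \<otimes> b)"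
  then obtain u where u: "u \<in> homog_elems A - P" "u \<otimes> (a \<otimes> b') = u \<otimes> (a' \<otimes> b)" by blast
  show "hfrac S A P a b = hfrac S A P a' b'"
    using sub[OF u assms] sub[OF u(1) u(2)[symmetric] assms(2,1)] by blast
qed

lemma hfrac_self: "(a, b) \<in> hpairs A P \<Longrightarrow> (a, b) \<in> hfrac S A P a b"
  using one_homog P.one_notin by (auto simp: hfrac_def)

lemma hfrac_mem: "(a', b') \<in> hfrac S A P a b \<Longrightarrow> (a, b) \<in> hpairs A P \<Longrightarrow>
    (a', b') \<in> hpairs A P \<and> hfrac S A P a' b' = hfrac S A P a b"
  using hfrac_eq_iff[of a b a' b'] by (auto simp: hfrac_def)

lemma hpairs_mult:
  assumes "(a, b) \<in> hpairs A P" "(c, d) \<in> hpairs A P"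
  shows "(a \<otimes> c, b \<otimes> d) \<in> hpairs A P"
  using assms A_mult P.I_prime A_sub unfolding hpairs_iff by blast

lemma hpairs_add:
  assumes "(a, b) \<in> hpairs A P" "(c, d) \<in> hpairs A P"
  shows "(a \<otimes> d \<oplus> c \<otimes> b, b \<otimes> d) \<in> hpairs A P"
proof -
  obtain m n where h: "a \<in> A m" "b \<in> A m" "c \<in> A n" "d \<in> A n" "b \<notin> P" "d \<notin> P"
    using assms by (auto simp: hpairs_iff)
  have "c \<otimes> b \<in> A (m + n)" using A_mult[OF h(3,2)] by (simp add: add.commute)
  then have "a \<otimes> d \<oplus> c \<otimes> b \<in> A (m + n)" using A_add[OF A_mult[OF h(1,4)]] by blast
  moreover have "b \<otimes> d \<in> A (m + n)" by (rule A_mult[OF h(2,4)])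
  moreover have "b \<otimes> d \<notin> P" using h P.I_prime A_sub by blast
  ultimately show ?thesis by (auto simp: hpairs_iff)
qed

lemma hfrac_mult:
  assumes ab: "(a, b) \<in> hpairs A P" and cd: "(c, d) \<in> hpairs A P"
  shows "hfrac S A P a b \<otimes>\<^bsub>homog_localization S A P\<^esub> hfrac S A P c d = hfrac S A P (a \<otimes> c) (b \<otimes> d)"
proof -
  have "hfrac S A P (a' \<otimes> c') (b' \<otimes> d') = hfrac S A P (a \<otimes> c) (b \<otimes> d)"
    if x: "(a', b') \<in> hfrac S A P a b" and y: "(c', d') \<in> hfrac S A P c d" for a' b' c' d'
  proof -
    have x': "(a', b') \<in> hpairs A P" "hfrac S A P a' b' = hfrac S A P a b" using hfrac_mem[OF x ab] by auto
    have y': "(c', d') \<in> hpairs A P" "hfrac S A P c' d' = hfrac S A P c d" using hfrac_mem[OF y cd] by auto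
    obtain u where u: "u \<in> homog_elems A - P" "u \<otimes> (a' \<otimes> b) = u \<otimes> (a \<otimes> b')"
      using x' hfrac_eq_iff[OF x'(1) ab] by blast
    obtain v where v: "v \<in> homog_elems A - P" "v \<otimes> (c' \<otimes> d) = v \<otimes> (c \<otimes> d')"
      using y' hfrac_eq_iff[OF y'(1) cd] by blast
    have cl: "a \<in> carrier S" "b \<in> carrier S" "c \<in> carrier S" "d \<in> carrier S" "a' \<in> carrier S"
      "b' \<in> carrier S" "c' \<in> carrier S" "d' \<in> carrier S" "u \<in> carrier S" "v \<in> carrier S"
      using ab cd x' y' u v A_sub homog_elems_closed by (auto simp: hpairs_iff)
    have "(u \<otimes> v) \<otimes> ((a' \<otimes> c') \<otimes> (b \<otimes> d)) = (u \<otimes> (a' \<otimes> b)) \<otimes> (v \<otimes> (c' \<otimes> d))"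
      using cl by (simp add: m_ac)
    also have "\<dots> = (u \<otimes> v) \<otimes> ((a \<otimes> c) \<otimes> (b' \<otimes> d'))"
      unfolding u v using cl by (simp add: m_ac)
    finally have "(u \<otimes> v) \<otimes> ((a' \<otimes> c') \<otimes> (b \<otimes> d)) = (u \<otimes> v) \<otimes> ((a \<otimes> c) \<otimes> (b' \<otimes> d'))" .
    moreover have "u \<otimes> v \<in> homog_elems A - P"
      using u v cl P.I_prime homog_elems_mult by blast
    ultimately show ?thesis
      using hfrac_eq_iff[OF hpairs_mult[OF x'(1) y'(1)] hpairs_mult[OF ab cd]] by blast
  qed
  note eq = this
  show ?thesis
    by (simp add: homog_localization_def)
       (rule UN_pairs_const[OF hfrac_self[OF ab] hfrac_self[OF cd] eq])
qed

lemma hfrac_add: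
  assumes ab: "(a, b) \<in> hpairs A P" and cd: "(c, d) \<in> hpairs A P"
  shows "hfrac S A P a b \<oplus>\<^bsub>homog_localization S A P\<^esub> hfrac S A P c d
    = hfrac S A P (a \<otimes> d \<oplus> c \<otimes> b) (b \<otimes> d)"
proof -
  have "hfrac S A P (a' \<otimes> d' \<oplus> c' \<otimes> b') (b' \<otimes> d') = hfrac S A P (a \<otimes> d \<oplus> c \<otimes> b) (b \<otimes> d)"
    if x: "(a', b') \<in> hfrac S A P a b" and y: "(c', d') \<in> hfrac S A P c d" for a' b' c' d'
  proof -
    have x': "(a', b') \<in> hpairs A P" "hfrac S A P a' b' = hfrac S A P a b" using hfrac_mem[OF x ab] by auto
    have y': "(c', d') \<in> hpairs A P" "hfrac S A P c' d' = hfrac S A P c d" using hfrac_mem[OF y cd] by auto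
    obtain u where u: "u \<in> homog_elems A - P" "u \<otimes> (a' \<otimes> b) = u \<otimes> (a \<otimes> b')"
      using x' hfrac_eq_iff[OF x'(1) ab] by blast
    obtain v where v: "v \<in> homog_elems A - P" "v \<otimes> (c' \<otimes> d) = v \<otimes> (c \<otimes> d')"
      using y' hfrac_eq_iff[OF y'(1) cd] by blast
    have cl: "a \<in> carrier S" "b \<in> carrier S" "c \<in> carrier S" "d \<in> carrier S" "a' \<in> carrier S"
      "b' \<in> carrier S" "c' \<in> carrier S" "d' \<in> carrier S" "u \<in> carrier S" "v \<in> carrier S"
      using ab cd x' y' u v A_sub homog_elems_closed by (auto simp: hpairs_iff)
    have "(u \<otimes> v) \<otimes> ((a' \<otimes> d' \<oplus> c' \<otimes> b') \<otimes> (b \<otimes> d))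
        = (v \<otimes> d \<otimes> d') \<otimes> (u \<otimes> (a' \<otimes> b)) \<oplus> (u \<otimes> b \<otimes> b') \<otimes> (v \<otimes> (c' \<otimes> d))"
      using cl by (simp add: m_ac l_distr r_distr)
    also have "\<dots> = (u \<otimes> v) \<otimes> ((a \<otimes> d \<oplus> c \<otimes> b) \<otimes> (b' \<otimes> d'))"
      unfolding u v using cl by (simp add: m_ac l_distr r_distr)
    finally have "(u \<otimes> v) \<otimes> ((a' \<otimes> d' \<oplus> c' \<otimes> b') \<otimes> (b \<otimes> d))
        = (u \<otimes> v) \<otimes> ((a \<otimes> d \<oplus> c \<otimes> b) \<otimes> (b' \<otimes> d'))" .
    moreover have "u \<otimes> v \<in> homog_elems A - P"
      using u v cl P.I_prime homog_elems_mult by blast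
    ultimately show ?thesis
      using hfrac_eq_iff[OF hpairs_add[OF x'(1) y'(1)] hpairs_add[OF ab cd]] by blast
  qed
  note eq = this
  show ?thesis
    by (simp add: homog_localization_def)
       (rule UN_pairs_const[OF hfrac_self[OF ab] hfrac_self[OF cd] eq])
qed

end

lemma homog_localization_cases:
  assumes "X \<in> carrier (homog_localization S A P)"
  obtains a b where "(a, b) \<in> hpairs A P" "X = hfrac S A P a b"
  using assms by (auto simp: homog_localization_def)

lemma hfrac_closed: "(a, b) \<in> hpairs A P \<Longrightarrow> hfrac S A P a b \<in> carrier (homog_localization S A P)"
  by (force simp: homog_localization_def)

end

lemma openin_Proj_topology: "openin (Proj_topology S A) U \<longleftrightarrow> Proj_open S A U"
  unfolding Proj_topology_def using istopology_Proj_open[of S A] topology_inverse' by metis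

lemma Proj_open_sub: "Proj_open S A U \<Longrightarrow> U \<subseteq> Proj_points S A"
  by (auto simp: Proj_open_def)

lemma topspace_Proj [simp]: "topspace (Proj_topology S A) = Proj_points S A"
proof -
  have "Proj_open S A (Proj_points S A)"
    unfolding Proj_open_def
  proof (intro exI[of _ "carrier S"] conjI)
    have "\<not> carrier S \<subseteq> P" if "P \<in> Proj_points S A" for P
    proof -
      interpret primeideal P S using that by (simp add: Proj_points_def)
      show ?thesis using I_notcarr a_subset by blast
    qed
    then show "Proj_points S A = {P \<in> Proj_points S A. \<not> carrier S \<subseteq> P}" by blast
  qed auto
  then show ?thesis
    unfolding topspace_def openin_Proj_topology using Proj_open_sub by blast
qed

section \<open>Proj of a Veronese subring\<close>

text \<open>
  The map \<open>h\<close> identifies \<open>B\<close> with the subring of \<open>S\<close> of elements whose degrees are multiples of \<open>k\<close>.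
  A homogeneous prime of \<open>S\<close> contains a homogeneous element if and only if it contains its \<open>k\<close>-th
  power, which lies in this subring; and a fraction \<open>a / b\<close> equals \<open>a b\<^bsup>k-1\<^esup> / b\<^sup>k\<close>.  For these two
  reasons contraction along \<open>h\<close> is an isomorphism of the spectra.
\<close>

locale veronese = S: graded_ring S A comp + B: cring B
  for S :: "('a, 'm) ring_scheme" and A comp and B :: "('b, 'n) ring_scheme" +
  fixes A' :: "nat \<Rightarrow> 'b set" and k :: nat and h :: "'b \<Rightarrow> 'a"
  assumes hom: "h \<in> ring_hom B S" and inj: "inj_on h (carrier B)" and k: "0 < k"
    and A'_sub: "A' n \<subseteq> carrier B" and image_A': "h ` A' n = A (k * n)"
    and comp_h: "b \<in> carrier B \<Longrightarrow> \<not> k dvd n \<Longrightarrow> comp n (h b) = \<zero>\<^bsub>S\<^esub>"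
begin

lemma h_closed: "b \<in> carrier B \<Longrightarrow> h b \<in> carrier S"
  using ring_hom_closed[OF hom] .

lemma h_add: "b \<in> carrier B \<Longrightarrow> c \<in> carrier B \<Longrightarrow> h (b \<oplus>\<^bsub>B\<^esub> c) = h b \<oplus>\<^bsub>S\<^esub> h c"
  and h_mult: "b \<in> carrier B \<Longrightarrow> c \<in> carrier B \<Longrightarrow> h (b \<otimes>\<^bsub>B\<^esub> c) = h b \<otimes>\<^bsub>S\<^esub> h c"
  and h_one: "h \<one>\<^bsub>B\<^esub> = \<one>\<^bsub>S\<^esub>"
  using ring_hom_add[OF hom] ring_hom_mult[OF hom] ring_hom_one[OF hom] by auto

lemma h_zero: "h \<zero>\<^bsub>B\<^esub> = \<zero>\<^bsub>S\<^esub>"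
  using h_add[of "\<zero>\<^bsub>B\<^esub>" "\<zero>\<^bsub>B\<^esub>"] h_closed[of "\<zero>\<^bsub>B\<^esub>"] by simp

lemma h_eq_iff: "b \<in> carrier B \<Longrightarrow> c \<in> carrier B \<Longrightarrow> h b = h c \<longleftrightarrow> b = c"
  using inj by (auto dest: inj_onD)

lemma h_A': "b \<in> A' n \<Longrightarrow> h b \<in> A (k * n)" and A'_closed: "b \<in> A' n \<Longrightarrow> b \<in> carrier B"
  using image_A' A'_sub by blast+

lemma A_multiple: "x \<in> A (k * n) \<Longrightarrow> \<exists>b\<in>A' n. x = h b"
  using image_A' by blast

lemma A'_iff: "b \<in> carrier B \<Longrightarrow> b \<in> A' n \<longleftrightarrow> h b \<in> A (k * n)"
  using A_multiple h_eq_iff A'_closed h_A' by metis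

definition comp' :: "nat \<Rightarrow> 'b \<Rightarrow> 'b" where
  "comp' n b = (SOME b'. b' \<in> A' n \<and> h b' = comp (k * n) (h b))"

lemma comp': assumes "b \<in> carrier B" shows "comp' n b \<in> A' n" "h (comp' n b) = comp (k * n) (h b)"
proof -
  have "\<exists>b'. b' \<in> A' n \<and> h b' = comp (k * n) (h b)"
    using A_multiple[OF S.comp_in[OF h_closed[OF assms]]] by metis
  from someI_ex[OF this] show "comp' n b \<in> A' n" "h (comp' n b) = comp (k * n) (h b)"
    by (auto simp: comp'_def)
qed

lemma comp'_closed [simp]: "b \<in> carrier B \<Longrightarrow> comp' n b \<in> carrier B"
  using comp'(1) A'_closed by blast

sublocale B: graded_ring B A' comp'
proof
  show "\<one>\<^bsub>B\<^esub> \<in> A' 0" by (simp add: A'_iff h_one S.A_one)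
  show "\<zero>\<^bsub>B\<^esub> \<in> A' n" for n by (simp add: A'_iff h_zero S.A_zero)
  show "x \<oplus>\<^bsub>B\<^esub> y \<in> A' n" if "x \<in> A' n" "y \<in> A' n" for x y n
    using S.A_add[OF h_A'[OF that(1)] h_A'[OF that(2)]] A'_closed[OF that(1)] A'_closed[OF that(2)]
    by (simp add: A'_iff h_add)
  show "x \<otimes>\<^bsub>B\<^esub> y \<in> A' (m + n)" if "x \<in> A' m" "y \<in> A' n" for x y m n
    using S.A_mult[OF h_A'[OF that(1)] h_A'[OF that(2)]] A'_closed[OF that(1)] A'_closed[OF that(2)]
    by (simp add: A'_iff h_mult distrib_left)
  show "comp' n (x \<oplus>\<^bsub>B\<^esub> y) = comp' n x \<oplus>\<^bsub>B\<^esub> comp' n y" if "x \<in> carrier B" "y \<in> carrier B" for x y n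
    using that by (subst h_eq_iff[symmetric]) (auto simp: h_add h_closed S.comp_add comp'(2))
  show "comp' n x = (if n = m then x else \<zero>\<^bsub>B\<^esub>)" if "x \<in> A' m" for x m n
    using that A'_closed[OF that] comp'[OF A'_closed[OF that], of n] S.comp_hom[OF h_A'[OF that], of "k * n"] k
    by (subst h_eq_iff[symmetric]) (auto simp: h_zero A'_closed)
  show "finite {n. comp' n x \<noteq> \<zero>\<^bsub>B\<^esub>}" if "x \<in> carrier B" for x
  proof (rule inj_on_finite)
    show "inj_on ((*) k) {n. comp' n x \<noteq> \<zero>\<^bsub>B\<^esub>}" using k by (auto simp: inj_on_def)
    show "(*) k ` {n. comp' n x \<noteq> \<zero>\<^bsub>B\<^esub>} \<subseteq> {n. comp n (h x) \<noteq> \<zero>\<^bsub>S\<^esub>}"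
    proof -
      have "comp (k * n) (h x) = \<zero>\<^bsub>S\<^esub> \<Longrightarrow> comp' n x = \<zero>\<^bsub>B\<^esub>" for n
        using h_eq_iff[of "comp' n x" "\<zero>\<^bsub>B\<^esub>"] that by (simp add: comp'(2) h_zero)
      then show ?thesis by auto
    qed
    show "finite {n. comp n (h x) \<noteq> \<zero>\<^bsub>S\<^esub>}" by (rule S.comp_finite[OF h_closed[OF that]])
  qed
  show "x = y" if x: "x \<in> carrier B" and y: "y \<in> carrier B" and eq: "\<And>n. comp' n x = comp' n y" for x y
  proof -
    have "comp n (h x) = comp n (h y)" for n
    proof (cases "k dvd n")
      case True
      then obtain j where "n = k * j" by blast
      then show ?thesis using comp'(2)[OF x, of j] comp'(2)[OF y, of j] eq by simp
    qed (simp add: comp_h x y)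
    then show ?thesis using S.comp_ext[OF h_closed[OF x] h_closed[OF y]] h_eq_iff x y by blast
  qed
qed (use A'_closed comp' in auto)

definition contract :: "'a set \<Rightarrow> 'b set" where
  "contract P = {b \<in> carrier B. h b \<in> P}"

lemma contract_iff: "b \<in> carrier B \<Longrightarrow> b \<in> contract P \<longleftrightarrow> h b \<in> P"
  by (simp add: contract_def)

definition root :: "'a \<Rightarrow> 'b" where
  "root a = (SOME b. b \<in> carrier B \<and> h b = a [^]\<^bsub>S\<^esub> k)"

lemma A_pow: "a \<in> A n \<Longrightarrow> a [^]\<^bsub>S\<^esub> (j::nat) \<in> A (j * n)"
proof (induction j)
  case (Suc j)
  then show ?case using S.A_mult[of "a [^]\<^bsub>S\<^esub> j" "j * n" a n] by (simp add: add.commute)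
qed (simp add: S.A_one)

lemma root:
  assumes "a \<in> A n" shows "root a \<in> A' n" "h (root a) = a [^]\<^bsub>S\<^esub> k" "root a \<in> carrier B"
proof -
  have "\<exists>b. b \<in> carrier B \<and> h b = a [^]\<^bsub>S\<^esub> k"
    using A_multiple[OF A_pow[OF assms]] A'_closed by metis
  from someI_ex[OF this] show *: "h (root a) = a [^]\<^bsub>S\<^esub> k" "root a \<in> carrier B"
    by (auto simp: root_def)
  then show "root a \<in> A' n" using A'_iff A_pow[OF assms] by simp
qed

lemma Proj_pointsD:
  assumes "P \<in> Proj_points S A"
  shows "primeideal P S" "\<And>x n. x \<in> P \<Longrightarrow> comp n x \<in> P" "\<exists>n a. 1 \<le> n \<and> a \<in> A n \<and> a \<notin> P"
proof -
  show prime: "primeideal P S" using assms by (simp add: Proj_points_def)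
  show "comp n x \<in> P" if "x \<in> P" for x n
    using assms that S.homogeneous_ideal_iff[of P] by (auto simp: Proj_points_def homogeneous_ideal_def)
  show "\<exists>n a. 1 \<le> n \<and> a \<in> A n \<and> a \<notin> P" using assms by (force simp: Proj_points_def)
qed

lemma root_mem_iff:
  assumes P: "P \<in> Proj_points S A" and a: "a \<in> A n"
  shows "root a \<in> contract P \<longleftrightarrow> a \<in> P"
  using primeideal.pow_mem_iff[OF Proj_pointsD(1)[OF P] S.A_sub[OF a] k] root[OF a]
  by (simp add: contract_iff)

lemma contract_in_Proj:
  assumes P: "P \<in> Proj_points S A" shows "contract P \<in> Proj_points B A'"
proof -
  interpret P: primeideal P S by (rule Proj_pointsD(1)[OF P])
  have I: "ideal (contract P) B"
    by (rule B.idealI_closed)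
       (auto simp: contract_def h_zero h_add h_mult h_closed additive_subgroup.zero_closed
          P.additive_subgroup_axioms P.a_closed P.I_l_closed)
  have "primeideal (contract P) B"
  proof (rule primeidealI[OF I B.is_cring])
    show "carrier B \<noteq> contract P" using P.one_notin by (metis B.one_closed contract_iff h_one)
    show "a \<in> contract P \<or> b \<in> contract P"
      if "a \<in> carrier B" "b \<in> carrier B" "a \<otimes>\<^bsub>B\<^esub> b \<in> contract P" for a b
      using that P.I_prime[of "h a" "h b"] by (auto simp: contract_iff h_mult h_closed)
  qed
  moreover have "homogeneous_ideal B A' (contract P)"
    unfolding B.homogeneous_ideal_iff[OF I]
    using Proj_pointsD(2)[OF P] comp' A'_closed by (auto simp: contract_def)
  moreover have "\<not> (\<Union>n\<in>{1..}. A' n) \<subseteq> contract P"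
    using Proj_pointsD(3)[OF P] root_mem_iff[OF P] root(1) by fastforce
  ultimately show ?thesis by (simp add: Proj_points_def)
qed

lemma contract_inj: "inj_on contract (Proj_points S A)"
proof (rule inj_onI)
  have "P \<subseteq> P'" if P: "P \<in> Proj_points S A" and P': "P' \<in> Proj_points S A"
    and eq: "contract P = contract P'" for P P'
  proof
    interpret P: primeideal P S by (rule Proj_pointsD(1)[OF P])
    fix x assume x: "x \<in> P"
    have "comp n x \<in> P'" for n
    proof -
      have c: "comp n x \<in> A n" using x P.a_Hcarr S.comp_in by blast
      have "comp n x \<in> P" by (rule Proj_pointsD(2)[OF P x])
      then show ?thesis using root_mem_iff[OF P c] root_mem_iff[OF P' c] eq by simp
    qed
    then show "x \<in> P'"
      by (rule S.ideal_comp_mem[OF primeideal.axioms(1)[OF Proj_pointsD(1)[OF P']] P.a_Hcarr[OF x]])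
  qed
  then show "P = P'" if "P \<in> Proj_points S A" "P' \<in> Proj_points S A" "contract P = contract P'" for P P'
    using that by blast
qed

text \<open>
  The homogeneous prime above \<open>Q\<close>.  A homogeneous \<open>a\<close> belongs to it if and only if \<open>a\<^sup>k\<close> lies in the
  image of \<open>Q\<close>, but closure under addition is immediate for the following condition: all products of
  \<open>a\<close> with homogeneous elements that land in the subring lie in the image of \<open>Q\<close>.
\<close>

definition extend :: "'b set \<Rightarrow> 'a set" where
  "extend Q = {x \<in> carrier S. \<forall>m n. \<forall>c\<in>A m. k dvd m + n \<longrightarrow> comp n x \<otimes>\<^bsub>S\<^esub> c \<in> h ` Q}"

lemma extend_in_Proj_contract:
  assumes Q: "Q \<in> Proj_points B A'"
  shows "extend Q \<in> Proj_points S A \<and> contract (extend Q) = Q"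
proof -
  interpret Q: primeideal Q B using Q by (simp add: Proj_points_def)
  have Qcomp: "comp' n b \<in> Q" if "b \<in> Q" for b n
    using Q that B.homogeneous_ideal_iff[of Q] by (auto simp: Proj_points_def homogeneous_ideal_def)
  have Qirr: "\<exists>n b. 1 \<le> n \<and> b \<in> A' n \<and> b \<notin> Q" using Q by (force simp: Proj_points_def)
  have hQ: "h b \<in> h ` Q \<longleftrightarrow> b \<in> Q" if "b \<in> carrier B" for b
    using that h_eq_iff Q.a_Hcarr by (auto simp: image_iff)
  have hQ0: "\<zero>\<^bsub>S\<^esub> \<in> h ` Q"
    using h_zero additive_subgroup.zero_closed[OF Q.additive_subgroup_axioms] by (metis imageI)
  have hQadd: "x \<oplus>\<^bsub>S\<^esub> y \<in> h ` Q" if xy: "x \<in> h ` Q" "y \<in> h ` Q" for x y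
  proof -
    obtain b c where b: "b \<in> Q" "x = h b" and c: "c \<in> Q" "y = h c" using xy by blast
    have "x \<oplus>\<^bsub>S\<^esub> y = h (b \<oplus>\<^bsub>B\<^esub> c)" using b c Q.a_Hcarr by (simp add: h_add)
    then show ?thesis using Q.a_closed[OF b(1) c(1)] by simp
  qed
  have I: "ideal (extend Q) S"
  proof (rule S.idealI_closed)
    show zero: "\<zero>\<^bsub>S\<^esub> \<in> extend Q" using hQ0 S.A_sub by (auto simp: extend_def)
    show add: "x \<oplus>\<^bsub>S\<^esub> y \<in> extend Q" if "x \<in> extend Q" "y \<in> extend Q" for x y
      using that S.A_sub by (auto simp: extend_def S.comp_add S.l_distr intro: hQadd)
    show "r \<otimes>\<^bsub>S\<^esub> x \<in> extend Q" if x: "x \<in> extend Q" and r: "r \<in> carrier S" for x r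
      using r
    proof (rule S.comp_induct)
      have xc: "x \<in> carrier S" using x by (simp add: extend_def)
      show "\<zero>\<^bsub>S\<^esub> \<otimes>\<^bsub>S\<^esub> x \<in> extend Q" using zero xc by simp
      show "(y \<oplus>\<^bsub>S\<^esub> z) \<otimes>\<^bsub>S\<^esub> x \<in> extend Q"
        if "y \<in> carrier S" "z \<in> carrier S" "y \<otimes>\<^bsub>S\<^esub> x \<in> extend Q" "z \<otimes>\<^bsub>S\<^esub> x \<in> extend Q" for y z
        using that xc add by (simp add: S.l_distr)
      fix i
      let ?a = "comp i r"
      have a: "?a \<in> A i" by (rule S.comp_in[OF r])
      have "comp n (?a \<otimes>\<^bsub>S\<^esub> x) \<otimes>\<^bsub>S\<^esub> c \<in> h ` Q" if c: "c \<in> A m" and dvd: "k dvd m + n" for m n c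
      proof (cases "i \<le> n")
        case True
        have "k dvd (i + m) + (n - i)" using dvd True by (simp add: add.commute)
        moreover have "?a \<otimes>\<^bsub>S\<^esub> c \<in> A (i + m)" by (rule S.A_mult[OF a c])
        ultimately have "comp (n - i) x \<otimes>\<^bsub>S\<^esub> (?a \<otimes>\<^bsub>S\<^esub> c) \<in> h ` Q"
          using x unfolding extend_def by blast
        moreover have "comp n (?a \<otimes>\<^bsub>S\<^esub> x) \<otimes>\<^bsub>S\<^esub> c = comp (n - i) x \<otimes>\<^bsub>S\<^esub> (?a \<otimes>\<^bsub>S\<^esub> c)"
          unfolding S.comp_mult[OF a xc] if_P[OF True]
          using xc r S.A_sub[OF c] by (simp add: S.m_ac)
        ultimately show ?thesis by simp
      next
        case False
        then show ?thesis using S.A_sub[OF c] hQ0 by (simp add: S.comp_mult[OF a xc])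
      qed
      then show "?a \<otimes>\<^bsub>S\<^esub> x \<in> extend Q" using xc r by (simp add: extend_def)
    qed
  qed (auto simp: extend_def)
  have comps: "comp n x \<in> extend Q" if "x \<in> extend Q" for x n
    using that S.A_sub hQ0 S.comp_hom[OF S.comp_in, of x]
    by (auto simp: extend_def)
  have mem_extend: "h b \<in> extend Q \<longleftrightarrow> b \<in> Q" if b: "b \<in> carrier B" for b
  proof
    assume ext: "h b \<in> extend Q"
    show "b \<in> Q"
    proof (rule B.ideal_comp_mem[OF Q.is_ideal b])
      fix n
      have "k dvd 0 + k * n" by simp
      then have "comp (k * n) (h b) \<otimes>\<^bsub>S\<^esub> \<one>\<^bsub>S\<^esub> \<in> h ` Q"
        using ext S.A_one unfolding extend_def by blast
      then have "h (comp' n b) \<in> h ` Q" using b by (simp add: comp'(2)[OF b] h_closed)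
      then show "comp' n b \<in> Q" using hQ comp'(1)[OF b] A'_closed by blast
    qed
  next
    assume bQ: "b \<in> Q"
    have "comp n (h b) \<otimes>\<^bsub>S\<^esub> c \<in> h ` Q" if c: "c \<in> A m" and dvd: "k dvd m + n" for m n c
    proof (cases "k dvd n")
      case True
      then obtain i where i: "n = k * i" by blast
      have "k dvd m" using dvd True by (simp add: dvd_add_left_iff)
      then obtain j where "m = k * j" by blast
      then obtain c' where c': "c' \<in> A' j" "c = h c'" using A_multiple c by blast
      have "comp n (h b) \<otimes>\<^bsub>S\<^esub> c = h (comp' i b \<otimes>\<^bsub>B\<^esub> c')"
        using h_mult[OF comp'_closed[OF b] A'_closed[OF c'(1)]] c'(2) by (simp add: comp'(2)[OF b] i)
      moreover have "comp' i b \<otimes>\<^bsub>B\<^esub> c' \<in> Q"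
        using Qcomp[OF bQ] A'_closed[OF c'(1)] by (rule Q.I_r_closed)
      ultimately show ?thesis by blast
    next
      case False
      then show ?thesis using S.A_sub[OF c] hQ0 by (simp add: comp_h[OF b])
    qed
    then show "h b \<in> extend Q" using h_closed[OF b] by (simp add: extend_def)
  qed
  obtain n b where nb: "1 \<le> n" "b \<in> A' n" "b \<notin> Q" using Qirr by blast
  then have hb: "h b \<in> A (k * n)" "h b \<notin> extend Q" "1 \<le> k * n"
    using h_A' mem_extend A'_closed k by auto
  have "primeideal (extend Q) S"
  proof (rule S.homogeneous_primeidealI[OF I comps])
    show "extend Q \<noteq> carrier S" using hb S.A_sub by blast
    fix m n a b assume a: "a \<in> A m" and b: "b \<in> A n" and ab: "a \<otimes>\<^bsub>S\<^esub> b \<in> extend Q"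
    show "a \<in> extend Q \<or> b \<in> extend Q"
    proof (rule ccontr)
      assume contr: "\<not> (a \<in> extend Q \<or> b \<in> extend Q)"
      have witness: "\<exists>i c q. c \<in> A i \<and> q \<in> carrier B \<and> q \<notin> Q \<and> a \<otimes>\<^bsub>S\<^esub> c = h q \<and> k dvd m + i"
        if a: "a \<in> A m" and notin: "a \<notin> extend Q" for a m
      proof -
        obtain i j c where c: "c \<in> A i" "k dvd i + j" "comp j a \<otimes>\<^bsub>S\<^esub> c \<notin> h ` Q"
          using notin S.A_sub[OF a] unfolding extend_def by blast
        have "j = m" using c hQ0 S.A_sub[OF c(1)] S.comp_hom[OF a, of j] by (auto split: if_splits)
        then have ac: "a \<otimes>\<^bsub>S\<^esub> c \<notin> h ` Q" "k dvd m + i"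
          using c S.comp_hom[OF a, of j] by (auto simp: add.commute)
        then obtain l where "m + i = k * l" by blast
        then obtain q where "q \<in> A' l" "a \<otimes>\<^bsub>S\<^esub> c = h q"
          using A_multiple S.A_mult[OF a c(1)] by metis
        then show ?thesis using ac c(1) A'_closed by blast
      qed
      obtain i c q where c: "c \<in> A i" "q \<in> carrier B" "q \<notin> Q" "a \<otimes>\<^bsub>S\<^esub> c = h q" "k dvd m + i"
        using witness[OF a] contr by blast
      obtain i' c' q' where c': "c' \<in> A i'" "q' \<in> carrier B" "q' \<notin> Q" "b \<otimes>\<^bsub>S\<^esub> c' = h q'" "k dvd n + i'"
        using witness[OF b] contr by blast
      have cl: "a \<in> carrier S" "b \<in> carrier S" "c \<in> carrier S" "c' \<in> carrier S"
        using a b c c' S.A_sub by blast+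
      have "h (q \<otimes>\<^bsub>B\<^esub> q') = (a \<otimes>\<^bsub>S\<^esub> b) \<otimes>\<^bsub>S\<^esub> (c \<otimes>\<^bsub>S\<^esub> c')"
        using c c' cl by (simp add: h_mult flip: c(4) c'(4)) (simp add: S.m_ac)
      also have "a \<otimes>\<^bsub>S\<^esub> b = comp (m + n) (a \<otimes>\<^bsub>S\<^esub> b)"
        using S.comp_hom[OF S.A_mult[OF a b]] by simp
      also have "comp (m + n) (a \<otimes>\<^bsub>S\<^esub> b) \<otimes>\<^bsub>S\<^esub> (c \<otimes>\<^bsub>S\<^esub> c') \<in> h ` Q"
      proof -
        have "k dvd (m + i) + (n + i')" using c(5) c'(5) by (rule dvd_add)
        then have "k dvd (i + i') + (m + n)" by (simp add: ac_simps)
        then show ?thesis using ab S.A_mult[OF c(1) c'(1)] unfolding extend_def by blast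
      qed
      finally have "q \<otimes>\<^bsub>B\<^esub> q' \<in> Q" using hQ c c' by simp
      then show False using Q.I_prime c c' by blast
    qed
  qed
  moreover have "homogeneous_ideal S A (extend Q)"
    unfolding S.homogeneous_ideal_iff[OF I] using comps by blast
  moreover have "\<not> (\<Union>n\<in>{1..}. A n) \<subseteq> extend Q" using hb by fastforce
  moreover have "contract (extend Q) = Q"
    using mem_extend Q.a_Hcarr by (auto simp: contract_def)
  ultimately show ?thesis by (simp add: Proj_points_def)
qed

lemma contract_image: "contract ` Proj_points S A = Proj_points B A'"
  using contract_in_Proj extend_in_Proj_contract by (metis image_eqI image_subsetI subsetI subset_antisym)

lemma Proj_open_contract_preimage:
  assumes "Proj_open B A' V"
  shows "Proj_open S A {P \<in> Proj_points S A. contract P \<in> V}"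
proof -
  obtain T where T: "T \<subseteq> carrier B" "V = {Q \<in> Proj_points B A'. \<not> T \<subseteq> Q}"
    using assms by (auto simp: Proj_open_def)
  have "{P \<in> Proj_points S A. contract P \<in> V} = {P \<in> Proj_points S A. \<not> h ` T \<subseteq> P}"
    using T contract_in_Proj by (auto simp: contract_def subset_iff)
  moreover have "h ` T \<subseteq> carrier S" using T(1) h_closed by blast
  ultimately show ?thesis unfolding Proj_open_def by blast
qed

lemma Proj_open_contract_image:
  assumes "Proj_open S A U"
  shows "Proj_open B A' (contract ` U)"
proof -
  obtain T where T: "T \<subseteq> carrier S" "U = {P \<in> Proj_points S A. \<not> T \<subseteq> P}"
    using assms by (auto simp: Proj_open_def)
  define T' where "T' = {root (comp n t) | n t. t \<in> T}"
  have "T' \<subseteq> contract P \<longleftrightarrow> T \<subseteq> P" if P: "P \<in> Proj_points S A" for P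
  proof -
    have "root (comp n t) \<in> contract P \<longleftrightarrow> comp n t \<in> P" if "t \<in> T" for t n
      by (rule root_mem_iff[OF P S.comp_in]) (use T(1) that in auto)
    then have "T' \<subseteq> contract P \<longleftrightarrow> (\<forall>t\<in>T. \<forall>n. comp n t \<in> P)"
      unfolding T'_def subset_iff mem_Collect_eq by metis
    also have "\<dots> \<longleftrightarrow> (\<forall>t\<in>T. t \<in> P)"
    proof (rule ball_cong[OF refl])
      fix t assume "t \<in> T"
      then have "t \<in> carrier S" using T(1) by auto
      from S.ideal_comp_mem[OF primeideal.axioms(1)[OF Proj_pointsD(1)[OF P]] this]
      show "(\<forall>n. comp n t \<in> P) \<longleftrightarrow> t \<in> P" using Proj_pointsD(2)[OF P] by metis
    qed
    also have "\<dots> \<longleftrightarrow> T \<subseteq> P" by auto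
    finally show ?thesis .
  qed
  then have "U = {P \<in> Proj_points S A. \<not> T' \<subseteq> contract P}"
    unfolding T(2) by blast
  then have "contract ` U = {Q \<in> Proj_points B A'. \<not> T' \<subseteq> Q}"
    unfolding contract_image[symmetric] by blast
  moreover have "T' \<subseteq> carrier B"
    unfolding T'_def using T(1) root(3)[OF S.comp_in] by blast
  ultimately show ?thesis unfolding Proj_open_def by blast
qed

lemma contract_homeomorphism:
  "homeomorphic_map (Proj_topology S A) (Proj_topology B A') contract"
proof (rule bijective_open_imp_homeomorphic_map)
  show "continuous_map (Proj_topology S A) (Proj_topology B A') contract"
    using contract_in_Proj Proj_open_contract_preimage
    by (auto simp: continuous_map_def openin_Proj_topology)
  show "open_map (Proj_topology S A) (Proj_topology B A') contract"
    using Proj_open_contract_image by (simp add: open_map_def openin_Proj_topology)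
qed (use contract_image contract_inj in auto)

end

context veronese
begin

abbreviation stalk_S :: "'a set \<Rightarrow> ('a \<times> 'a) set ring" where
  "stalk_S \<equiv> homog_localization S A"

abbreviation stalk_B :: "'b set \<Rightarrow> ('b \<times> 'b) set ring" where
  "stalk_B \<equiv> homog_localization B A'"

definition stalk_map :: "'a set \<Rightarrow> ('b \<times> 'b) set \<Rightarrow> ('a \<times> 'a) set" where
  "stalk_map P X = (\<Union>(a, b)\<in>X. hfrac S A P (h a) (h b))"

lemma contract_prime: "P \<in> Proj_points S A \<Longrightarrow> primeideal (contract P) B"
  using contract_in_Proj by (simp add: Proj_points_def)

lemma hpairs_h: "(a, b) \<in> hpairs A' (contract P) \<Longrightarrow> (h a, h b) \<in> hpairs A P"
  unfolding S.hpairs_iff B.hpairs_iff using h_A' A'_closed contract_iff by blast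

lemma stalk_map_hfrac:
  assumes P: "P \<in> Proj_points S A" and ab: "(a, b) \<in> hpairs A' (contract P)"
  shows "stalk_map P (hfrac B A' (contract P) a b) = hfrac S A P (h a) (h b)"
proof -
  note p = Proj_pointsD(1)[OF P] and q = contract_prime[OF P]
  have eq: "hfrac S A P (h a') (h b') = hfrac S A P (h a) (h b)"
    if x: "(a', b') \<in> hfrac B A' (contract P) a b" for a' b'
  proof -
    have x': "(a', b') \<in> hpairs A' (contract P)"
      "hfrac B A' (contract P) a' b' = hfrac B A' (contract P) a b"
      using B.hfrac_mem[OF q x ab] by auto
    obtain u where u: "u \<in> homog_elems A' - contract P" "u \<otimes>\<^bsub>B\<^esub> (a' \<otimes>\<^bsub>B\<^esub> b) = u \<otimes>\<^bsub>B\<^esub> (a \<otimes>\<^bsub>B\<^esub> b')"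
      using x' B.hfrac_eq_iff[OF q x'(1) ab] by blast
    have cl: "a \<in> carrier B" "b \<in> carrier B" "a' \<in> carrier B" "b' \<in> carrier B" "u \<in> carrier B"
      using ab x' u A'_closed B.homog_elems_closed by (auto simp: B.hpairs_iff)
    have "h u \<in> homog_elems A - P"
      using u(1) cl(5) h_A' contract_iff[of u P] by (auto simp: homog_elems_def)
    moreover have "h u \<otimes>\<^bsub>S\<^esub> (h a' \<otimes>\<^bsub>S\<^esub> h b) = h u \<otimes>\<^bsub>S\<^esub> (h a \<otimes>\<^bsub>S\<^esub> h b')"
      using arg_cong[OF u(2), of h] cl by (simp add: h_mult)
    ultimately show ?thesis using S.hfrac_eq_iff[OF p hpairs_h[OF x'(1)] hpairs_h[OF ab]] by blast
  qed
  have "stalk_map P (hfrac B A' (contract P) a b)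
      = (\<Union>x\<in>hfrac B A' (contract P) a b. hfrac S A P (h a) (h b))"
    unfolding stalk_map_def by (intro SUP_cong refl) (auto simp: eq split: prod.splits)
  then show ?thesis using B.hfrac_self[OF q ab] by auto
qed

text \<open>
  Numerator and denominator of the expansion \<open>a / b = a b\<^bsup>k-1\<^esup> / b\<^sup>k\<close>, moved to \<open>B\<close>.
\<close>

lemma hfrac_root:
  assumes P: "P \<in> Proj_points S A" and ab: "a \<in> A n" "b \<in> A n" "b \<notin> P"
  obtains a' b' where "a' \<in> A' n" "b' \<in> A' n" "h a' = a \<otimes>\<^bsub>S\<^esub> b [^]\<^bsub>S\<^esub> (k - 1)" "h b' = b [^]\<^bsub>S\<^esub> k"
proof -
  have "a \<otimes>\<^bsub>S\<^esub> b [^]\<^bsub>S\<^esub> (k - 1) \<in> A (n + (k - 1) * n)"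
    by (rule S.A_mult[OF ab(1) A_pow[OF ab(2)]])
  moreover have "n + (k - 1) * n = k * n" using k by (cases k) auto
  ultimately obtain a' where "a' \<in> A' n" "h a' = a \<otimes>\<^bsub>S\<^esub> b [^]\<^bsub>S\<^esub> (k - 1)" using A_multiple by metis
  then show ?thesis using that root(1,2)[OF ab(2)] by blast
qed

lemma hfrac_root_eq:
  assumes P: "P \<in> Proj_points S A" and ab: "a \<in> A n" "b \<in> A n" "b \<notin> P"
    and a'b': "a' \<in> A' n" "b' \<in> A' n" "h a' = a \<otimes>\<^bsub>S\<^esub> b [^]\<^bsub>S\<^esub> (k - 1)" "h b' = b [^]\<^bsub>S\<^esub> k"
  shows "(a', b') \<in> hpairs A' (contract P)"
    and "stalk_map P (hfrac B A' (contract P) a' b') = hfrac S A P a b"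
proof -
  note p = Proj_pointsD(1)[OF P]
  have cl: "a \<in> carrier S" "b \<in> carrier S" using ab S.A_sub by auto
  have "b [^]\<^bsub>S\<^esub> k \<notin> P" using primeideal.pow_mem_iff[OF p cl(2) k] ab(3) by simp
  then show pair: "(a', b') \<in> hpairs A' (contract P)"
    using a'b' A'_closed contract_iff unfolding B.hpairs_iff by metis
  have "b [^]\<^bsub>S\<^esub> k = b [^]\<^bsub>S\<^esub> (k - 1) \<otimes>\<^bsub>S\<^esub> b"
    using k by (cases k) auto
  then have "h a' \<otimes>\<^bsub>S\<^esub> b = a \<otimes>\<^bsub>S\<^esub> h b'" using a'b' cl by (simp add: S.m_assoc)
  moreover have "h a' \<in> carrier S" "h b' \<in> carrier S" using a'b' cl by auto
  ultimately have "\<one>\<^bsub>S\<^esub> \<otimes>\<^bsub>S\<^esub> (h a' \<otimes>\<^bsub>S\<^esub> b) = \<one>\<^bsub>S\<^esub> \<otimes>\<^bsub>S\<^esub> (a \<otimes>\<^bsub>S\<^esub> h b')" using cl by simp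
  moreover have "\<one>\<^bsub>S\<^esub> \<in> homog_elems A - P"
    using S.one_homog primeideal.one_notin[OF p] by blast
  ultimately have "hfrac S A P (h a') (h b') = hfrac S A P a b"
    using S.hfrac_eq_iff[OF p hpairs_h[OF pair], of a b] ab unfolding S.hpairs_iff by blast
  then show "stalk_map P (hfrac B A' (contract P) a' b') = hfrac S A P a b"
    by (simp add: stalk_map_hfrac[OF P pair])
qed

lemma stalk_map_bij:
  assumes P: "P \<in> Proj_points S A"
  shows "bij_betw (stalk_map P) (carrier (stalk_B (contract P)))
    (carrier (stalk_S P))"
proof -
  note p = Proj_pointsD(1)[OF P] and q = contract_prime[OF P]
  have "inj_on (stalk_map P) (carrier (stalk_B (contract P)))"
  proof (rule inj_onI)
    fix X Y assume "X \<in> carrier (stalk_B (contract P))"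
      "Y \<in> carrier (stalk_B (contract P))" and eq: "stalk_map P X = stalk_map P Y"
    then obtain a b c d where X: "(a, b) \<in> hpairs A' (contract P)" "X = hfrac B A' (contract P) a b"
      and Y: "(c, d) \<in> hpairs A' (contract P)" "Y = hfrac B A' (contract P) c d"
      using B.homog_localization_cases by metis
    have "hfrac S A P (h a) (h b) = hfrac S A P (h c) (h d)"
      using eq by (simp add: X Y stalk_map_hfrac[OF P])
    then obtain u where u: "u \<in> homog_elems A - P"
      "u \<otimes>\<^bsub>S\<^esub> (h a \<otimes>\<^bsub>S\<^esub> h d) = u \<otimes>\<^bsub>S\<^esub> (h c \<otimes>\<^bsub>S\<^esub> h b)"
      using S.hfrac_eq_iff[OF p hpairs_h[OF X(1)] hpairs_h[OF Y(1)]] by blast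
    then obtain n where n: "u \<in> A n" by (auto simp: homog_elems_def)
    have cl: "a \<in> carrier B" "b \<in> carrier B" "c \<in> carrier B" "d \<in> carrier B" "u \<in> carrier S"
      using X Y A'_closed S.A_sub[OF n] by (auto simp: B.hpairs_iff)
    note hcl = cl(1-4)[THEN h_closed]
    have "u [^]\<^bsub>S\<^esub> k = u [^]\<^bsub>S\<^esub> (k - 1) \<otimes>\<^bsub>S\<^esub> u" using k by (cases k) auto
    then have "u [^]\<^bsub>S\<^esub> k \<otimes>\<^bsub>S\<^esub> (h a \<otimes>\<^bsub>S\<^esub> h d) = u [^]\<^bsub>S\<^esub> k \<otimes>\<^bsub>S\<^esub> (h c \<otimes>\<^bsub>S\<^esub> h b)"
      using u(2) hcl cl(5) by (simp add: S.m_assoc)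
    then have "h (root u \<otimes>\<^bsub>B\<^esub> (a \<otimes>\<^bsub>B\<^esub> d)) = h (root u \<otimes>\<^bsub>B\<^esub> (c \<otimes>\<^bsub>B\<^esub> b))"
      using cl(1-4) root[OF n] by (simp add: h_mult)
    then have "root u \<otimes>\<^bsub>B\<^esub> (a \<otimes>\<^bsub>B\<^esub> d) = root u \<otimes>\<^bsub>B\<^esub> (c \<otimes>\<^bsub>B\<^esub> b)"
      using cl(1-4) root[OF n] h_eq_iff by simp
    moreover have "root u \<in> homog_elems A' - contract P"
      using root(1)[OF n] root_mem_iff[OF P n] u(1) by (auto simp: homog_elems_def)
    ultimately show "X = Y"
      unfolding X Y using B.hfrac_eq_iff[OF q X(1) Y(1)] by blast
  qed
  moreover have "stalk_map P ` carrier (stalk_B (contract P))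
      = carrier (stalk_S P)"
  proof (intro subset_antisym subsetI)
    fix Z assume "Z \<in> stalk_map P ` carrier (stalk_B (contract P))"
    then obtain a b where "(a, b) \<in> hpairs A' (contract P)" "Z = stalk_map P (hfrac B A' (contract P) a b)"
      using B.homog_localization_cases by blast
    then show "Z \<in> carrier (stalk_S P)"
      using stalk_map_hfrac[OF P] S.hfrac_closed hpairs_h by metis
  next
    fix Z assume "Z \<in> carrier (stalk_S P)"
    then obtain a b n where ab: "a \<in> A n" "b \<in> A n" "b \<notin> P" "Z = hfrac S A P a b"
      using S.homog_localization_cases S.hpairs_iff by metis
    obtain a' b' where a'b': "a' \<in> A' n" "b' \<in> A' n" "h a' = a \<otimes>\<^bsub>S\<^esub> b [^]\<^bsub>S\<^esub> (k - 1)" "h b' = b [^]\<^bsub>S\<^esub> k"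
      by (rule hfrac_root[OF P ab(1-3)])
    then show "Z \<in> stalk_map P ` carrier (stalk_B (contract P))"
      using hfrac_root_eq[OF P ab(1-3) a'b'] ab(4) B.hfrac_closed by (metis imageI)
  qed
  ultimately show ?thesis by (simp add: bij_betw_def)
qed

lemma stalk_map_ring_hom:
  assumes P: "P \<in> Proj_points S A"
  shows "stalk_map P \<in> ring_hom (stalk_B (contract P)) (stalk_S P)"
proof (rule ring_hom_memI)
  note p = Proj_pointsD(1)[OF P] and q = contract_prime[OF P]
  show "stalk_map P X \<in> carrier (stalk_S P)"
    if "X \<in> carrier (stalk_B (contract P))" for X
    using that stalk_map_bij[OF P] by (auto simp: bij_betw_def)
  have one: "(\<one>\<^bsub>B\<^esub>, \<one>\<^bsub>B\<^esub>) \<in> hpairs A' (contract P)"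
    using B.A_one primeideal.one_notin[OF q] by (auto simp: B.hpairs_iff)
  show "stalk_map P \<one>\<^bsub>stalk_B (contract P)\<^esub> = \<one>\<^bsub>stalk_S P\<^esub>"
    using stalk_map_hfrac[OF P one] by (simp add: homog_localization_def h_one)
  fix X Y assume "X \<in> carrier (stalk_B (contract P))"
    "Y \<in> carrier (stalk_B (contract P))"
  then obtain a b c d where X: "(a, b) \<in> hpairs A' (contract P)" "X = hfrac B A' (contract P) a b"
    and Y: "(c, d) \<in> hpairs A' (contract P)" "Y = hfrac B A' (contract P) c d"
    using B.homog_localization_cases by metis
  have cl: "a \<in> carrier B" "b \<in> carrier B" "c \<in> carrier B" "d \<in> carrier B"
    using X Y A'_closed by (auto simp: B.hpairs_iff)
  show "stalk_map P (X \<otimes>\<^bsub>stalk_B (contract P)\<^esub> Y)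
      = stalk_map P X \<otimes>\<^bsub>stalk_S P\<^esub> stalk_map P Y"
    unfolding X(2) Y(2) B.hfrac_mult[OF q X(1) Y(1)] stalk_map_hfrac[OF P X(1)] stalk_map_hfrac[OF P Y(1)]
      stalk_map_hfrac[OF P B.hpairs_mult[OF q X(1) Y(1)]] S.hfrac_mult[OF p hpairs_h[OF X(1)] hpairs_h[OF Y(1)]]
    using cl by (simp add: h_mult)
  show "stalk_map P (X \<oplus>\<^bsub>stalk_B (contract P)\<^esub> Y)
      = stalk_map P X \<oplus>\<^bsub>stalk_S P\<^esub> stalk_map P Y"
    unfolding X(2) Y(2) B.hfrac_add[OF q X(1) Y(1)] stalk_map_hfrac[OF P X(1)] stalk_map_hfrac[OF P Y(1)]
      stalk_map_hfrac[OF P B.hpairs_add[OF q X(1) Y(1)]] S.hfrac_add[OF p hpairs_h[OF X(1)] hpairs_h[OF Y(1)]]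
    using cl by (simp add: h_mult h_add)
qed

definition pre :: "'b set set \<Rightarrow> 'a set set" where
  "pre V = {P \<in> Proj_points S A. contract P \<in> V}"

definition sections_map :: "'b set set \<Rightarrow> ('b set \<Rightarrow> ('b \<times> 'b) set) \<Rightarrow> 'a set \<Rightarrow> ('a \<times> 'a) set" where
  "sections_map V s = (\<lambda>P\<in>pre V. stalk_map P (s (contract P)))"

text \<open>
  A local representation \<open>a / b\<close> over \<open>V'\<close> becomes the representation \<open>h a / h b\<close> over the preimage.
\<close>

lemma sections_map_closed:
  assumes V: "Proj_open B A' V" and s: "s \<in> carrier (Proj_sections B A' V)"
  shows "sections_map V s \<in> carrier (Proj_sections S A (pre V))"
proof -
  have sE: "s \<in> (\<Pi>\<^sub>E Q\<in>V. carrier (stalk_B Q))"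
    and loc: "\<And>Q. Q \<in> V \<Longrightarrow> \<exists>V' n a b. Proj_open B A' V' \<and> Q \<in> V' \<and> V' \<subseteq> V \<and> a \<in> A' n \<and> b \<in> A' n \<and>
          (\<forall>Q\<in>V'. b \<notin> Q \<and> s Q = hfrac B A' Q a b)"
    using s by (auto simp: Proj_sections_def)
  have "sections_map V s \<in> (\<Pi>\<^sub>E P\<in>pre V. carrier (stalk_S P))"
  proof (rule PiE_I)
    fix P assume P: "P \<in> pre V"
    then have "s (contract P) \<in> carrier (stalk_B (contract P))"
      using sE by (auto simp: pre_def)
    then show "sections_map V s P \<in> carrier (stalk_S P)"
      using P stalk_map_bij[of P] by (auto simp: sections_map_def pre_def bij_betw_def)
  qed (simp add: sections_map_def)
  moreover have "\<exists>U n a b. Proj_open S A U \<and> P \<in> U \<and> U \<subseteq> pre V \<and> a \<in> A n \<and> b \<in> A n \<and>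
          (\<forall>P\<in>U. b \<notin> P \<and> sections_map V s P = hfrac S A P a b)" if P: "P \<in> pre V" for P
  proof -
    have "contract P \<in> V" using P by (simp add: pre_def)
    from loc[OF this] obtain V' n a b where V': "Proj_open B A' V'" "contract P \<in> V'" "V' \<subseteq> V" "a \<in> A' n" "b \<in> A' n"
      and "\<forall>Q\<in>V'. b \<notin> Q \<and> s Q = hfrac B A' Q a b"
      by (elim exE conjE)
    note eq = bspec[OF this(6)]
    have "h b \<notin> P' \<and> sections_map V s P' = hfrac S A P' (h a) (h b)" if P': "P' \<in> pre V'" for P'
    proof -
      have pt: "P' \<in> Proj_points S A" "contract P' \<in> V'" using P' by (auto simp: pre_def)
      have "(a, b) \<in> hpairs A' (contract P')" using V' eq[OF pt(2)] by (auto simp: B.hpairs_iff)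
      moreover have "P' \<in> pre V" using pt V'(3) by (auto simp: pre_def)
      ultimately show ?thesis
        using eq[OF pt(2)] contract_iff[OF A'_closed[OF V'(5)], of P'] stalk_map_hfrac[OF pt(1)]
        by (simp add: sections_map_def)
    qed
    moreover have "Proj_open S A (pre V')"
      using Proj_open_contract_preimage[OF V'(1)] by (simp add: pre_def)
    moreover have "P \<in> pre V'" "pre V' \<subseteq> pre V" using P V' by (auto simp: pre_def)
    ultimately show ?thesis using h_A'[OF V'(4)] h_A'[OF V'(5)] by blast
  qed
  ultimately show ?thesis by (simp add: Proj_sections_def)
qed

lemma extend_contract: "P \<in> Proj_points S A \<Longrightarrow> extend (contract P) = P"
  using extend_in_Proj_contract contract_in_Proj contract_inj by (metis inj_onD)

text \<open>
  Injectivity is that of the stalk maps.  For surjectivity, the stalkwise preimages are locally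
  fractions by \<open>hfrac_root\<close>, and \<open>contract\<close> is an open map.
\<close>

lemma sections_map_bij:
  assumes V: "Proj_open B A' V"
  shows "bij_betw (sections_map V) (carrier (Proj_sections B A' V)) (carrier (Proj_sections S A (pre V)))"
proof -
  have pts: "\<And>Q. Q \<in> V \<Longrightarrow> Q \<in> Proj_points B A'" using Proj_open_sub[OF V] by blast
  then have ext: "\<And>Q. Q \<in> V \<Longrightarrow> extend Q \<in> pre V \<and> contract (extend Q) = Q"
    using extend_in_Proj_contract by (auto simp: pre_def)
  have carr: "carrier (Proj_sections B A' V) \<subseteq> (\<Pi>\<^sub>E Q\<in>V. carrier (stalk_B Q))"
    by (auto simp: Proj_sections_def)
  have "inj_on (sections_map V) (carrier (Proj_sections B A' V))"
  proof (rule inj_onI)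
    fix s t assume s: "s \<in> carrier (Proj_sections B A' V)" and t: "t \<in> carrier (Proj_sections B A' V)"
      and eq: "sections_map V s = sections_map V t"
    have sE: "s \<in> (\<Pi>\<^sub>E Q\<in>V. carrier (stalk_B Q))"
      and tE: "t \<in> (\<Pi>\<^sub>E Q\<in>V. carrier (stalk_B Q))" using s t carr by auto
    show "s = t"
    proof (rule PiE_ext[OF sE tE])
      fix Q assume Q: "Q \<in> V"
      let ?P = "extend Q"
      have P: "?P \<in> pre V" "contract ?P = Q" "?P \<in> Proj_points S A"
        using ext[OF Q] by (auto simp: pre_def)
      have "stalk_map ?P (s Q) = stalk_map ?P (t Q)"
        using fun_cong[OF eq, of ?P] P by (simp add: sections_map_def)
      moreover have "inj_on (stalk_map ?P) (carrier (stalk_B Q))"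
        using stalk_map_bij[OF P(3)] P(2) by (simp add: bij_betw_def)
      ultimately show "s Q = t Q" using sE tE Q by (auto dest: inj_onD)
    qed
  qed
  moreover have "\<exists>s\<in>carrier (Proj_sections B A' V). sections_map V s = t"
    if t: "t \<in> carrier (Proj_sections S A (pre V))" for t
  proof -
    have tE: "t \<in> (\<Pi>\<^sub>E P\<in>pre V. carrier (stalk_S P))"
      and loc: "\<And>P. P \<in> pre V \<Longrightarrow> \<exists>U n a b. Proj_open S A U \<and> P \<in> U \<and> U \<subseteq> pre V \<and> a \<in> A n \<and> b \<in> A n \<and>
          (\<forall>P\<in>U. b \<notin> P \<and> t P = hfrac S A P a b)"
      using t by (auto simp: Proj_sections_def)
    define s where "s = (\<lambda>Q\<in>V. inv_into (carrier (stalk_B Q)) (stalk_map (extend Q)) (t (extend Q)))"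
    have s: "s Q \<in> carrier (stalk_B Q) \<and> stalk_map (extend Q) (s Q) = t (extend Q)"
      if Q: "Q \<in> V" for Q
    proof -
      have P: "extend Q \<in> pre V" "contract (extend Q) = Q" "extend Q \<in> Proj_points S A"
        using ext[OF Q] by (auto simp: pre_def)
      have "t (extend Q) \<in> stalk_map (extend Q) ` carrier (stalk_B Q)"
        using stalk_map_bij[OF P(3)] P tE by (auto simp: bij_betw_def)
      then show ?thesis using Q by (simp add: s_def inv_into_into f_inv_into_f)
    qed
    have st: "sections_map V s = t"
    proof (rule extensionalityI[of _ "pre V"])
      fix P assume P: "P \<in> pre V"
      then have "contract P \<in> V" "P \<in> Proj_points S A" by (auto simp: pre_def)
      then show "sections_map V s P = t P"
        using s[of "contract P"] P by (simp add: sections_map_def extend_contract)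
    qed (use tE in \<open>auto simp: sections_map_def PiE_def\<close>)
    have "\<exists>V' n a b. Proj_open B A' V' \<and> Q \<in> V' \<and> V' \<subseteq> V \<and> a \<in> A' n \<and> b \<in> A' n \<and>
          (\<forall>Q\<in>V'. b \<notin> Q \<and> s Q = hfrac B A' Q a b)" if Q: "Q \<in> V" for Q
    proof -
      have P: "extend Q \<in> pre V" "contract (extend Q) = Q" using ext[OF Q] by auto
      obtain U n a b where U: "Proj_open S A U" "extend Q \<in> U" "U \<subseteq> pre V" and ab: "a \<in> A n" "b \<in> A n"
        and "\<forall>P\<in>U. b \<notin> P \<and> t P = hfrac S A P a b"
        using loc[OF P(1)] by (elim exE conjE)
      note eq = bspec[OF this(6)]
      have pt: "P \<in> Proj_points S A" "contract P \<in> V" if "P \<in> U" for P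
        using U(3) that by (auto simp: pre_def)
      obtain a' b' where a'b': "a' \<in> A' n" "b' \<in> A' n" "h a' = a \<otimes>\<^bsub>S\<^esub> b [^]\<^bsub>S\<^esub> (k - 1)" "h b' = b [^]\<^bsub>S\<^esub> k"
        using hfrac_root[OF pt(1)[OF U(2)] ab] eq[OF U(2)] by blast
      have "b' \<notin> contract P \<and> s (contract P) = hfrac B A' (contract P) a' b'" if "P \<in> U" for P
      proof -
        have bP: "b \<notin> P" using eq[OF that] by blast
        note root = hfrac_root_eq[OF pt(1)[OF that] ab bP a'b']
        have "stalk_map P (s (contract P)) = hfrac S A P a b"
          using s[OF pt(2)[OF that]] eq[OF that] by (simp add: extend_contract[OF pt(1)[OF that]])
        then have eq': "stalk_map P (s (contract P)) = stalk_map P (hfrac B A' (contract P) a' b')"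
          by (simp only: root(2))
        have "inj_on (stalk_map P) (carrier (stalk_B (contract P)))"
          using stalk_map_bij[OF pt(1)[OF that]] by (simp add: bij_betw_def)
        then have "s (contract P) = hfrac B A' (contract P) a' b'"
          using eq' s[OF pt(2)[OF that]] B.hfrac_closed[OF root(1)] by (metis inj_onD)
        then show ?thesis using root(1) by (simp add: B.hpairs_iff)
      qed
      then have "\<forall>Q\<in>contract ` U. b' \<notin> Q \<and> s Q = hfrac B A' Q a' b'" by blast
      moreover have "Proj_open B A' (contract ` U)" by (rule Proj_open_contract_image[OF U(1)])
      moreover have "Q \<in> contract ` U" "contract ` U \<subseteq> V"
        using U(2) P(2) pt(2) by (auto simp: image_iff)
      ultimately show ?thesis using a'b'(1,2) by blast
    qed
    moreover have "s \<in> (\<Pi>\<^sub>E Q\<in>V. carrier (stalk_B Q))"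
    proof (rule PiE_I)
      show "s Q \<in> carrier (stalk_B Q)" if "Q \<in> V" for Q using s[OF that] by blast
      show "s Q = undefined" if "Q \<notin> V" for Q using that by (simp add: s_def)
    qed
    ultimately have "s \<in> carrier (Proj_sections B A' V)" by (simp add: Proj_sections_def)
    then show ?thesis using st by blast
  qed
  ultimately show ?thesis
    using sections_map_closed[OF V] by (auto simp: bij_betw_def)
qed

lemma sections_map_ring_iso:
  assumes V: "Proj_open B A' V"
  shows "sections_map V \<in> ring_iso (Proj_sections B A' V) (Proj_sections S A (pre V))"
proof -
  have E: "s (contract P) \<in> carrier (stalk_B (contract P))"
    if "s \<in> carrier (Proj_sections B A' V)" "P \<in> pre V" for s P
    using that by (auto simp: Proj_sections_def pre_def)
  have pt: "P \<in> Proj_points S A" "contract P \<in> V" if "P \<in> pre V" for P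
    using that by (auto simp: pre_def)
  have "sections_map V \<in> ring_hom (Proj_sections B A' V) (Proj_sections S A (pre V))"
  proof (rule ring_hom_memI)
    show "sections_map V s \<in> carrier (Proj_sections S A (pre V))"
      if "s \<in> carrier (Proj_sections B A' V)" for s
      by (rule sections_map_closed[OF V that])
    show "sections_map V (s \<otimes>\<^bsub>Proj_sections B A' V\<^esub> t)
        = sections_map V s \<otimes>\<^bsub>Proj_sections S A (pre V)\<^esub> sections_map V t"
      if "s \<in> carrier (Proj_sections B A' V)" "t \<in> carrier (Proj_sections B A' V)" for s t
      using that pt E ring_hom_mult[OF stalk_map_ring_hom]
      by (auto simp: sections_map_def Proj_sections_def[of _ _ "pre V"] Proj_sections_def[of _ _ V] intro!: restrict_ext)
    show "sections_map V (s \<oplus>\<^bsub>Proj_sections B A' V\<^esub> t)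
        = sections_map V s \<oplus>\<^bsub>Proj_sections S A (pre V)\<^esub> sections_map V t"
      if "s \<in> carrier (Proj_sections B A' V)" "t \<in> carrier (Proj_sections B A' V)" for s t
      using that pt E ring_hom_add[OF stalk_map_ring_hom]
      by (auto simp: sections_map_def Proj_sections_def[of _ _ "pre V"] Proj_sections_def[of _ _ V] intro!: restrict_ext)
    show "sections_map V \<one>\<^bsub>Proj_sections B A' V\<^esub> = \<one>\<^bsub>Proj_sections S A (pre V)\<^esub>"
      using pt ring_hom_one[OF stalk_map_ring_hom]
      by (auto simp: sections_map_def Proj_sections_def intro!: restrict_ext)
  qed
  then show ?thesis using sections_map_bij[OF V] by (simp add: ring_iso_def)
qed

theorem Proj_isomorphic:
  assumes \<iota>: "\<And>c. \<iota>' c \<in> A' 0" "\<And>c. h (\<iota>' c) = \<iota> c"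
  shows "cspace_isomorphic (Proj S A \<iota>) (Proj B A' \<iota>')"
proof -
  have pre_eq: "{P \<in> topspace (top_of (Proj S A \<iota>)). contract P \<in> V} = pre V" for V
    by (simp add: Proj_def pre_def)
  have "sections_map V (\<lambda>Q\<in>V. hfrac B A' Q (\<iota>' c) \<one>\<^bsub>B\<^esub>) = (\<lambda>P\<in>pre V. hfrac S A P (\<iota> c) \<one>\<^bsub>S\<^esub>)" for V c
    unfolding sections_map_def
  proof (rule restrict_ext)
    fix P assume P: "P \<in> pre V"
    then have pt: "P \<in> Proj_points S A" "contract P \<in> V" by (auto simp: pre_def)
    have "(\<iota>' c, \<one>\<^bsub>B\<^esub>) \<in> hpairs A' (contract P)"
      using \<iota>(1) B.A_one primeideal.one_notin[OF contract_prime[OF pt(1)]] by (auto simp: B.hpairs_iff)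
    from stalk_map_hfrac[OF pt(1) this]
    show "stalk_map P ((\<lambda>Q\<in>V. hfrac B A' Q (\<iota>' c) \<one>\<^bsub>B\<^esub>) (contract P)) = hfrac S A P (\<iota> c) \<one>\<^bsub>S\<^esub>"
      using pt \<iota>(2) by (simp add: h_one)
  qed
  moreover have "sections_map W (restrict s W) = restrict (sections_map V s) (pre W)" if "W \<subseteq> V" for V W s
  proof (rule ext)
    show "sections_map W (restrict s W) P = restrict (sections_map V s) (pre W) P" for P
      using that by (cases "P \<in> pre W") (auto simp: sections_map_def pre_def)
  qed
  ultimately show ?thesis
    unfolding cspace_isomorphic_def Let_def pre_eq
    using contract_homeomorphism sections_map_ring_iso
    by (intro exI[of _ contract] exI[of _ sections_map])
       (simp add: Proj_def openin_Proj_topology pre_def[symmetric])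
qed

end

section \<open>The section ring of a hypertoric variety\<close>

locale hypertoric = toric_arrangement N d a
  for N :: "'n monoid" and d a +
  fixes r :: "nat \<Rightarrow> int"
begin

abbreviation XY :: "(nat + nat) cpoly ring" where "XY \<equiv> poly_ring (xy_vars d)"
abbreviation I :: "(nat + nat) cpoly set" where "I \<equiv> moment_ideal N d a"
abbreviation M :: "(nat + nat) cpoly set ring" where "M \<equiv> moment_ring N d a"
abbreviation S :: "((nat + nat) cpoly set, nat \<Rightarrow> (nat + nat) cpoly set) up_ring" where
  "S \<equiv> section_ring N d a r"

definition residue_of :: "(nat + nat) cpoly \<Rightarrow> (nat + nat) cpoly set" where
  "residue_of f = I +>\<^bsub>XY\<^esub> f"

lemma xy_ring_eq: "xy_ring d = XY"
  by (simp add: xy_ring_def xy_vars_def)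

lemma M_eq: "M = XY Quot I"
  by (simp add: moment_ring_def xy_ring_eq)

lemma prime_I: "primeideal I XY"
  unfolding moment_ideal_eq by (rule xy.relation_ideal_prime)

lemma ideal_I: "ideal I XY"
  using prime_I primeideal.axioms(1) by blast

sublocale M: cring M
  unfolding M_eq by (rule ideal.quotient_is_cring[OF ideal_I cring_poly_ring])

lemma residue_of_hom: "residue_of \<in> ring_hom XY M"
  unfolding M_eq residue_of_def[abs_def] by (rule ideal.rcos_ring_hom[OF ideal_I])

lemma residue_of_closed: "f \<in> carrier XY \<Longrightarrow> residue_of f \<in> carrier M"
  and residue_of_add: "f \<in> carrier XY \<Longrightarrow> g \<in> carrier XY \<Longrightarrow> residue_of (f + g) = residue_of f \<oplus>\<^bsub>M\<^esub> residue_of g"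
  and residue_of_mult: "f \<in> carrier XY \<Longrightarrow> g \<in> carrier XY \<Longrightarrow> residue_of (f * g) = residue_of f \<otimes>\<^bsub>M\<^esub> residue_of g"
  and residue_of_1: "residue_of 1 = \<one>\<^bsub>M\<^esub>"
  using ring_hom_closed[OF residue_of_hom] ring_hom_add[OF residue_of_hom] ring_hom_mult[OF residue_of_hom]
    ring_hom_one[OF residue_of_hom] by auto

lemma residue_of_0: "residue_of 0 = \<zero>\<^bsub>M\<^esub>"
  using residue_of_add[of 0 0] residue_of_closed[of 0] by simp

lemma residue_of_uminus: "f \<in> carrier XY \<Longrightarrow> residue_of (- f) = \<ominus>\<^bsub>M\<^esub> residue_of f"
  using residue_of_add[of "- f" f] residue_of_closed poly_ring_uminus[of f] M.minus_equality[of "residue_of (- f)" "residue_of f"]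
  by (simp add: residue_of_0)

lemma residue_of_sum: "(\<And>i. i \<in> A \<Longrightarrow> h i \<in> carrier XY) \<Longrightarrow> finite A \<Longrightarrow>
    residue_of (sum h A) = finsum M (\<lambda>i. residue_of (h i)) A"
proof (induction A rule: infinite_finite_induct)
  case (insert i A)
  have "finsum M (\<lambda>i. residue_of (h i)) (insert i A) = residue_of (h i) \<oplus>\<^bsub>M\<^esub> finsum M (\<lambda>i. residue_of (h i)) A"
    using insert by (intro M.finsum_insert) (auto intro: residue_of_closed)
  moreover have "residue_of (h i + sum h A) = residue_of (h i) \<oplus>\<^bsub>M\<^esub> residue_of (sum h A)"
    using insert by (intro residue_of_add poly_ring_sum) auto
  ultimately show ?case using insert by simp
qed (auto simp: residue_of_0)

lemma residue_of_eq_0_iff: assumes "f \<in> carrier XY" shows "residue_of f = \<zero>\<^bsub>M\<^esub> \<longleftrightarrow> f \<in> I"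
proof -
  interpret I: ideal I XY by (rule ideal_I)
  have "\<zero>\<^bsub>M\<^esub> = I" by (simp add: M_eq FactRing_def)
  then show ?thesis
    using ideal.rcos_const_imp_mem[OF ideal_I] assms I.a_rcos_const by (auto simp: residue_of_def)
qed

definition H :: "nat \<Rightarrow> (nat + nat) mon set" where
  "H n = {m \<in> mons (xy_vars d). torus_weight N d a m = (\<lambda>l\<in>Lambda N d a. int n * i_star N d a r l)}"

lemma H_iff: "m \<in> H n \<longleftrightarrow> m \<in> mons (xy_vars d) \<and>
    (\<forall>l\<in>Lambda N d a. (\<Sum>i<d. coef (xy_diff d m) i * l i) = int n * (\<Sum>i<d. r i * l i))"
proof -
  have iff: "restrict F X = restrict G X \<longleftrightarrow> (\<forall>l\<in>X. F l = G l)" for F G :: "(nat \<Rightarrow> int) \<Rightarrow> int" and X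
    by (metis restrict_apply' restrict_ext)
  have "(\<Sum>i<d. coef (xy_diff d m) i * l i)
      = (\<Sum>i<d. (int (coef m (Inl i)) - int (coef m (Inr i))) * l i)" for l
    by (intro sum.cong) (simp_all add: coef_xy_diff)
  then show ?thesis
    by (simp add: H_def torus_weight_def i_star_def iff)
qed

sublocale H: graded_exponents "xy_vars d" H
proof
  show "finite (xy_vars d)" by (simp add: xy_vars_def)
  show "H k \<subseteq> mons (xy_vars d)" for k by (auto simp: H_def)
  show "0 \<in> H 0" by (simp add: H_iff coef_xy_diff)
  show "m + n \<in> H (k + l)" if "m \<in> H k" "n \<in> H l" for m n k l
    using that by (auto simp: H_iff mons_add xy_diff_add lookup_add distrib_right sum.distrib)
  show "n \<in> H l" if "m \<in> H k" "m + n \<in> H (k + l)" for m n k l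
  proof -
    have "supp n \<subseteq> supp (m + n)" by (auto simp: in_keys_iff lookup_add)
    then have "n \<in> mons (xy_vars d)" using that(2) by (auto simp: H_iff mons_def)
    then show ?thesis
      using that by (auto simp: H_iff xy_diff_add lookup_add distrib_right sum.distrib)
  qed
  have "least_mon d (\<Sum>i<d. single i (r i)) \<in> H 1"
    unfolding H_iff
  proof (intro conjI ballI least_mon_mons)
    fix l :: "nat \<Rightarrow> int"
    have "coef (\<Sum>i<d. single i (r i)) i = (if i < d then r i else 0)" for i
      by (simp add: lookup_sum lookup_single when_def)
    moreover from this have "supp (\<Sum>i<d. single i (r i)) \<subseteq> {..<d}"
      by (auto simp: in_keys_iff split: if_splits)
    ultimately show "(\<Sum>i<d. coef (xy_diff d (least_mon d (\<Sum>i<d. single i (r i)))) i * l i)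
        = int 1 * (\<Sum>i<d. r i * l i)"
      by (simp add: xy_diff_least_mon)
  qed
  then show "H 1 \<noteq> {}" by blast
qed

text \<open>
  The weight under the torus depends on the weight under the full torus alone.
\<close>

lemma H_cong: "m \<in> H n \<Longrightarrow> m' \<in> mons (xy_vars d) \<Longrightarrow> xy_diff d m' = xy_diff d m \<Longrightarrow> m' \<in> H n"
  by (simp add: H_iff)

definition weight_polys :: "nat \<Rightarrow> (nat + nat) cpoly set" where
  "weight_polys n = {f. supp f \<subseteq> H n}"

lemma weight_polys_sub: "f \<in> weight_polys n \<Longrightarrow> f \<in> carrier XY"
  using H.H_sub by (auto simp: weight_polys_def in_poly_ring_iff)

lemma section_pieces_eq: "section_pieces N d a r n = residue_of ` weight_polys n"
proof -
  have "{f \<in> carrier (xy_ring d). \<forall>m\<in>supp f. torus_weight N d a m = (\<lambda>l\<in>Lambda N d a. int n * i_star N d a r l)}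
      = weight_polys n"
    unfolding xy_ring_eq by (auto simp: weight_polys_def in_poly_ring_iff H_def)
  then show ?thesis
    by (simp add: section_pieces_def weight_part_def xy_ring_eq residue_of_def[abs_def])
qed

lemma weight_polys_add: "f \<in> weight_polys n \<Longrightarrow> g \<in> weight_polys n \<Longrightarrow> f + g \<in> weight_polys n"
  using Poly_Mapping.keys_add[of f g] by (auto simp: weight_polys_def)

lemma weight_polys_uminus: "f \<in> weight_polys n \<Longrightarrow> - f \<in> weight_polys n"
  by (simp add: weight_polys_def)

lemma weight_polys_mult: "f \<in> weight_polys m \<Longrightarrow> g \<in> weight_polys n \<Longrightarrow> f * g \<in> weight_polys (m + n)"
proof -
  assume f: "f \<in> weight_polys m" and g: "g \<in> weight_polys n"
  have "x \<in> H (m + n)" if x: "x \<in> supp (f * g)" for x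
  proof -
    obtain y z where "x = y + z" "y \<in> supp f" "z \<in> supp g" using keys_mult[of f g] x by blast
    then show ?thesis using f g H.H_add[of y m z n] by (auto simp: weight_polys_def)
  qed
  then show ?thesis by (auto simp: weight_polys_def)
qed

lemma weight_polys_01: "0 \<in> weight_polys n" "1 \<in> weight_polys 0"
  by (auto simp: weight_polys_def H.H_0)

lemma piece_closed: "x \<in> section_pieces N d a r n \<Longrightarrow> x \<in> carrier M"
  unfolding section_pieces_eq using weight_polys_sub residue_of_closed by blast

lemma piece_zero: "\<zero>\<^bsub>M\<^esub> \<in> section_pieces N d a r n" and piece_one: "\<one>\<^bsub>M\<^esub> \<in> section_pieces N d a r 0"
  unfolding section_pieces_eq using weight_polys_01 residue_of_0 residue_of_1 by (metis imageI)+

lemma piece_add: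
  assumes "x \<in> section_pieces N d a r n" "y \<in> section_pieces N d a r n"
  shows "x \<oplus>\<^bsub>M\<^esub> y \<in> section_pieces N d a r n"
proof -
  obtain f g where "f \<in> weight_polys n" "g \<in> weight_polys n" "x = residue_of f" "y = residue_of g"
    using assms unfolding section_pieces_eq by blast
  moreover from this have "x \<oplus>\<^bsub>M\<^esub> y = residue_of (f + g)" by (simp add: residue_of_add weight_polys_sub)
  ultimately show ?thesis unfolding section_pieces_eq using weight_polys_add by blast
qed

lemma piece_uminus:
  assumes "x \<in> section_pieces N d a r n"
  shows "\<ominus>\<^bsub>M\<^esub> x \<in> section_pieces N d a r n"
proof -
  obtain f where f: "f \<in> weight_polys n" "x = residue_of f" using assms unfolding section_pieces_eq by blast
  have "\<ominus>\<^bsub>M\<^esub> x = residue_of (- f)" using residue_of_uminus[OF weight_polys_sub[OF f(1)]] f(2) by simp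
  then show ?thesis unfolding section_pieces_eq using weight_polys_uminus[OF f(1)] by blast
qed

lemma piece_mult:
  assumes "x \<in> section_pieces N d a r m" "y \<in> section_pieces N d a r n"
  shows "x \<otimes>\<^bsub>M\<^esub> y \<in> section_pieces N d a r (m + n)"
proof -
  obtain f g where "f \<in> weight_polys m" "g \<in> weight_polys n" "x = residue_of f" "y = residue_of g"
    using assms unfolding section_pieces_eq by blast
  moreover from this have "x \<otimes>\<^bsub>M\<^esub> y = residue_of (f * g)" by (simp add: residue_of_mult weight_polys_sub)
  ultimately show ?thesis unfolding section_pieces_eq using weight_polys_mult by blast
qed

lemma piece_finsum:
  assumes "finite A" "\<And>i. i \<in> A \<Longrightarrow> h i \<in> section_pieces N d a r n"
  shows "finsum M h A \<in> section_pieces N d a r n"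
  using assms
proof (induction A rule: finite_induct)
  case (insert i A)
  then have "finsum M h (insert i A) = h i \<oplus>\<^bsub>M\<^esub> finsum M h A"
    by (intro M.finsum_insert) (auto intro: piece_closed)
  then show ?case using insert piece_add by simp
qed (simp add: piece_zero)

lemma section_carrier: "carrier S = {f \<in> up M. \<forall>k. f k \<in> section_pieces N d a r k}"
  by (simp add: section_ring_def UP_def)

lemma section_closed: "f \<in> carrier S \<Longrightarrow> f k \<in> carrier M"
  by (auto simp: section_carrier intro: piece_closed)

lemma section_up: "f \<in> carrier S \<Longrightarrow> f \<in> up M"
  by (simp add: section_carrier)

lemma section_ops:
  assumes "f \<in> carrier S" "g \<in> carrier S"
  shows "f \<oplus>\<^bsub>S\<^esub> g = (\<lambda>n. f n \<oplus>\<^bsub>M\<^esub> g n)"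
    and "f \<otimes>\<^bsub>S\<^esub> g = (\<lambda>n. finsum M (\<lambda>i. f i \<otimes>\<^bsub>M\<^esub> g (n - i)) {..n})"
  using assms[THEN section_up] by (simp_all add: section_ring_def UP_def)

lemma section_zero_one:
  "\<zero>\<^bsub>S\<^esub> = (\<lambda>_. \<zero>\<^bsub>M\<^esub>)" "\<one>\<^bsub>S\<^esub> = (\<lambda>i. if i = 0 then \<one>\<^bsub>M\<^esub> else \<zero>\<^bsub>M\<^esub>)"
  by (simp_all add: section_ring_def UP_def)

sublocale S: cring S
proof -
  interpret U: UP_cring M "UP M" by unfold_locales simp
  let ?C = "{f \<in> carrier (UP M). \<forall>k. f k \<in> section_pieces N d a r k}"
  have "subring ?C (UP M)"
  proof (rule U.subringI)
    show "?C \<subseteq> carrier (UP M)" by blast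
    show "\<one>\<^bsub>UP M\<^esub> \<in> ?C"
      using U.P.one_closed by (auto simp: piece_one piece_zero UP_def)
    show "\<ominus>\<^bsub>UP M\<^esub> h \<in> ?C" if h: "h \<in> ?C" for h
    proof -
      have c: "h \<in> carrier (UP M)" "\<ominus>\<^bsub>UP M\<^esub> h \<in> carrier (UP M)" using h by auto
      have "(\<ominus>\<^bsub>UP M\<^esub> h) k = \<ominus>\<^bsub>M\<^esub> h k" for k
        using U.coeff_a_inv[OF c(1), of k] c by (simp add: UP_def)
      then show ?thesis using h c piece_uminus by simp
    qed
    show "h1 \<otimes>\<^bsub>UP M\<^esub> h2 \<in> ?C" if h: "h1 \<in> ?C" "h2 \<in> ?C" for h1 h2
    proof -
      have c: "h1 \<in> carrier (UP M)" "h2 \<in> carrier (UP M)" using h by auto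
      have "(h1 \<otimes>\<^bsub>UP M\<^esub> h2) k = finsum M (\<lambda>i. h1 i \<otimes>\<^bsub>M\<^esub> h2 (k - i)) {..k}" for k
        using c by (simp add: UP_def)
      moreover have "finsum M (\<lambda>i. h1 i \<otimes>\<^bsub>M\<^esub> h2 (k - i)) {..k} \<in> section_pieces N d a r k" for k
      proof (rule piece_finsum)
        show "h1 i \<otimes>\<^bsub>M\<^esub> h2 (k - i) \<in> section_pieces N d a r k" if "i \<in> {..k}" for i
          using piece_mult[of "h1 i" i "h2 (k - i)" "k - i"] h that by simp
      qed simp
      ultimately show ?thesis using U.P.m_closed[OF c] by simp
    qed
    show "h1 \<oplus>\<^bsub>UP M\<^esub> h2 \<in> ?C" if h: "h1 \<in> ?C" "h2 \<in> ?C" for h1 h2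
    proof -
      have c: "h1 \<in> carrier (UP M)" "h2 \<in> carrier (UP M)" using h by auto
      have "(h1 \<oplus>\<^bsub>UP M\<^esub> h2) k = h1 k \<oplus>\<^bsub>M\<^esub> h2 k" for k
        using c by (simp add: UP_def)
      then show ?thesis using U.P.a_closed[OF c] h piece_add by simp
    qed
  qed
  then have "subcring ?C (UP M)" by (rule U.P.subcringI')
  moreover have "?C \<subseteq> carrier (UP M)" by blast
  ultimately show "cring S" unfolding section_ring_def using U.P.subcring_iff by blast
qed

abbreviation A :: "nat \<Rightarrow> (nat \<Rightarrow> (nat + nat) cpoly set) set" where
  "A \<equiv> section_grading N d a r"

definition section_comp :: "nat \<Rightarrow> (nat \<Rightarrow> (nat + nat) cpoly set) \<Rightarrow> nat \<Rightarrow> (nat + nat) cpoly set" where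
  "section_comp n f = (\<lambda>j. if j = n then f j else \<zero>\<^bsub>M\<^esub>)"

lemma A_iff: "f \<in> A n \<longleftrightarrow> f \<in> carrier S \<and> (\<forall>j. j \<noteq> n \<longrightarrow> f j = \<zero>\<^bsub>M\<^esub>)"
  by (simp add: section_grading_def)

lemma section_comp_closed: "f \<in> carrier S \<Longrightarrow> section_comp n f \<in> carrier S"
proof -
  assume f: "f \<in> carrier S"
  have piece: "section_comp n f k \<in> section_pieces N d a r k" for k
    using f piece_zero by (simp add: section_comp_def section_carrier)
  have "bound \<zero>\<^bsub>M\<^esub> n (section_comp n f)"
    by (rule bound.intro) (simp add: section_comp_def)
  then have "section_comp n f \<in> up M" using piece_closed[OF piece] by (auto simp: up_def)
  then show ?thesis using piece by (simp add: section_carrier)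
qed

sublocale graded: graded_ring S A section_comp
proof
  show "x \<in> carrier S" if "x \<in> A n" for x n using that by (simp only: A_iff)
  show "\<one>\<^bsub>S\<^esub> \<in> A 0" by (simp add: A_iff section_zero_one(2)[symmetric]) (simp add: section_zero_one)
  show "\<zero>\<^bsub>S\<^esub> \<in> A n" for n using S.zero_closed by (simp add: A_iff section_zero_one)
  show "x \<oplus>\<^bsub>S\<^esub> y \<in> A n" if "x \<in> A n" "y \<in> A n" for x y n
    using that S.a_closed[of x y] by (auto simp: A_iff section_ops)
  show "x \<otimes>\<^bsub>S\<^esub> y \<in> A (m + n)" if x: "x \<in> A m" and y: "y \<in> A n" for x y m n
  proof -
    have c: "x \<in> carrier S" "y \<in> carrier S" using x y by (auto simp: A_iff)
    have "(x \<otimes>\<^bsub>S\<^esub> y) j = \<zero>\<^bsub>M\<^esub>" if j: "j \<noteq> m + n" for j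
    proof -
      have "x i \<otimes>\<^bsub>M\<^esub> y (j - i) = \<zero>\<^bsub>M\<^esub>" if "i \<le> j" for i
      proof (cases "i = m")
        case True
        then have "j - i \<noteq> n" using j that by auto
        then show ?thesis using y section_closed[OF c(1)] by (simp add: A_iff)
      next
        case False
        then show ?thesis using x section_closed[OF c(2)] by (simp add: A_iff)
      qed
      then have "finsum M (\<lambda>i. x i \<otimes>\<^bsub>M\<^esub> y (j - i)) {..j} = finsum M (\<lambda>i. \<zero>\<^bsub>M\<^esub>) {..j}"
        by (intro M.finsum_cong') auto
      then show ?thesis by (simp add: section_ops[OF c])
    qed
    then show ?thesis using S.m_closed[OF c] by (simp add: A_iff)
  qed
  show "section_comp n x \<in> A n" if "x \<in> carrier S" for x n
    using section_comp_closed[OF that, of n] by (auto simp: A_iff section_comp_def)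
  show "section_comp n (x \<oplus>\<^bsub>S\<^esub> y) = section_comp n x \<oplus>\<^bsub>S\<^esub> section_comp n y"
    if "x \<in> carrier S" "y \<in> carrier S" for x y n
    unfolding section_ops(1)[OF that] section_ops(1)[OF that[THEN section_comp_closed]]
    using that by (simp add: section_comp_def fun_eq_iff)
  show "section_comp n x = (if n = m then x else \<zero>\<^bsub>S\<^esub>)" if "x \<in> A m" for x m n
    using that by (auto simp: A_iff section_comp_def section_zero_one fun_eq_iff)
  show "finite {n. section_comp n x \<noteq> \<zero>\<^bsub>S\<^esub>}" if x: "x \<in> carrier S" for x
  proof -
    obtain n where n: "bound \<zero>\<^bsub>M\<^esub> n x" using section_up[OF x] by (auto simp: up_def)
    have "{k. section_comp k x \<noteq> \<zero>\<^bsub>S\<^esub>} \<subseteq> {..n}"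
    proof
      fix k assume k: "k \<in> {k. section_comp k x \<noteq> \<zero>\<^bsub>S\<^esub>}"
      have "x k \<noteq> \<zero>\<^bsub>M\<^esub>"
      proof
        assume "x k = \<zero>\<^bsub>M\<^esub>"
        then have "section_comp k x = \<zero>\<^bsub>S\<^esub>" by (simp add: section_comp_def section_zero_one(1) fun_eq_iff)
        then show False using k by simp
      qed
      then show "k \<in> {..n}" using bound.bound[OF n, of k] by (metis atMost_iff not_less)
    qed
    then show ?thesis by (rule finite_subset) simp
  qed
  show "x = y" if "\<And>n. section_comp n x = section_comp n y" for x y
  proof
    fix n show "x n = y n" using fun_cong[OF that[of n], of n] by (simp add: section_comp_def)
  qed
qed

end

section \<open>The well-poised embedding\<close>

text \<open>
  The coordinates of the embedding: the variable \<open>v\<close> is sent to the monomial \<open>g v\<close>, times the \<open>e\<close>-th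
  power of the grading variable if \<open>v\<close> has degree one.
\<close>

locale hypertoric_generators = hypertoric N d a r
  for N :: "'n monoid" and d a r +
  fixes e p q :: nat and g :: "nat + nat \<Rightarrow> (nat + nat) mon"
  assumes e: "0 < e" and g0: "i \<in> {1..p} \<Longrightarrow> g (Inl i) \<in> H 0" and g1: "j \<in> {0..q} \<Longrightarrow> g (Inr j) \<in> H e"
    and generate: "m \<in> H (e * n) \<Longrightarrow> \<exists>z\<in>mons (zy_vars p q). y_degree z = n \<and> subst_mon g z = m"
begin

abbreviation V :: "(nat + nat) set" where "V \<equiv> zy_vars p q"

lemma subst_in_H: assumes "z \<in> mons V" shows "subst_mon g z \<in> H (e * y_degree z)"
proof -
  have "rep (coef z v) (g v) \<in> H (e * (case v of Inl i \<Rightarrow> 0 | Inr j \<Rightarrow> coef z v))" if "v \<in> supp z" for v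
  proof -
    have "v \<in> V" using that assms by (auto simp: mons_def)
    then show ?thesis
      using H.H_rep[of "g v" 0 "coef z v"] H.H_rep[of "g v" e "coef z v"] g0 g1
      by (auto simp: zy_vars_def mult.commute split: sum.splits)
  qed
  then have "subst_mon g z \<in> H (\<Sum>v\<in>supp z. e * (case v of Inl i \<Rightarrow> 0 | Inr j \<Rightarrow> coef z v))"
    unfolding subst_mon_def by (intro H.H_sum) auto
  then show ?thesis by (simp add: y_degree_def sum_distrib_left)
qed

text \<open>
  The index \<open>d\<close> is free, since \<open>xy_diff d\<close> is supported on the indices below \<open>d\<close>, and it records the
  degree.
\<close>

definition character :: "(nat + nat) mon \<Rightarrow> (nat \<Rightarrow>\<^sub>0 int)" where
  "character z = xy_diff d (subst_mon g z) + single d (int (y_degree z))"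

definition y_exponents :: "(nat + nat) mon \<Rightarrow> nat mon" where
  "y_exponents z = y_part d (subst_mon g z)"

definition lift_xy_mon :: "nat \<Rightarrow> (nat + nat) mon" where
  "lift_xy_mon i = (SOME z. z \<in> mons V \<and> y_degree z = 0 \<and> subst_mon g z = xy_mon i)"

lemma character_eq_iff:
  "character z = character z' \<longleftrightarrow>
    xy_diff d (subst_mon g z) = xy_diff d (subst_mon g z') \<and> y_degree z = y_degree z'"
proof
  assume eq: "character z = character z'"
  have c: "coef (character z) i = (if i = d then int (y_degree z) else coef (xy_diff d (subst_mon g z)) i)" for z i
    by (auto simp: character_def lookup_add lookup_single coef_xy_diff)
  have "coef (character z) i = coef (character z') i" for i using eq by simp
  then have *: "(if i = d then int (y_degree z) else coef (xy_diff d (subst_mon g z)) i)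
      = (if i = d then int (y_degree z') else coef (xy_diff d (subst_mon g z')) i)" for i
    unfolding c .
  have "coef (xy_diff d (subst_mon g z)) i = coef (xy_diff d (subst_mon g z')) i" for i
    using *[of i] by (cases "i = d") (simp_all add: coef_xy_diff)
  then show "xy_diff d (subst_mon g z) = xy_diff d (subst_mon g z') \<and> y_degree z = y_degree z'"
    using *[of d] by (auto intro: poly_mapping_eqI)
qed (simp add: character_def)

lemma xy_mon_in_H0: "i < d \<Longrightarrow> xy_mon i \<in> H (e * 0)"
  using H_cong[of 0 0 "xy_mon i"] H.H_0 xy.u[of i] by simp

lemma lift_xy_mon:
  assumes "i < d"
  shows "lift_xy_mon i \<in> mons V" "y_degree (lift_xy_mon i) = 0" "subst_mon g (lift_xy_mon i) = xy_mon i"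
proof -
  have "\<exists>z. z \<in> mons V \<and> y_degree z = 0 \<and> subst_mon g z = xy_mon i"
    using generate[OF xy_mon_in_H0[OF assms]] by blast
  from someI_ex[OF this] show "lift_xy_mon i \<in> mons V" "y_degree (lift_xy_mon i) = 0"
    "subst_mon g (lift_xy_mon i) = xy_mon i" by (auto simp: lift_xy_mon_def)
qed

sublocale Z: hypertoric_monomials V d character y_exponents "linear_relations N d a" lift_xy_mon
proof
  show "character (m + n) = character m + character n" for m n
    by (simp add: character_def subst_mon_add xy_diff_add y_degree_add single_add)
  show "y_exponents (m + n) = y_exponents m + y_exponents n" for m n
    by (simp add: y_exponents_def subst_mon_add y_part_add)
  show "supp (y_exponents m) \<subseteq> {..<d}" for m by (simp add: y_exponents_def supp_y_part)
  show "relation_space d (linear_relations N d a)" by (rule xy.W)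
  show "(\<lambda>k. if k = i then 1 else 0) \<notin> linear_relations N d a" if "i < d" for i
    by (rule xy.unit_notin_W[OF that])
  show "lift_xy_mon i \<in> mons V" if "i < d" for i by (rule lift_xy_mon(1)[OF that])
  show "character (lift_xy_mon i) = 0" if "i < d" for i
    using lift_xy_mon(2,3)[OF that] xy.u(2)[OF that] by (simp add: character_def)
  show "y_exponents (lift_xy_mon i) = single i 1" if "i < d" for i
    using lift_xy_mon(3)[OF that] xy.u(3)[OF that] by (simp add: y_exponents_def)
  show "\<exists>m0\<in>mons V. character m0 = character m \<and> (\<forall>n\<in>mons V. character n = character m \<longrightarrow>
      (\<forall>i. coef (y_exponents m0) i \<le> coef (y_exponents n) i))" if m: "m \<in> mons V" for m
  proof -
    let ?l = "least_mon d (xy_diff d (subst_mon g m))"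
    have diff: "xy_diff d ?l = xy_diff d (subst_mon g m)"
      by (rule xy_diff_least_mon[OF supp_xy_diff])
    have "?l \<in> H (e * y_degree m)"
      by (rule H_cong[OF subst_in_H[OF m] least_mon_mons diff])
    then obtain z where z: "z \<in> mons V" "y_degree z = y_degree m" "subst_mon g z = ?l"
      using generate by blast
    have "coef (y_exponents z) i \<le> coef (y_exponents n) i" if "character n = character m" for n i
      using least_mon_le[of d "subst_mon g n" i] that z(3) by (simp add: character_eq_iff y_exponents_def)
    then show ?thesis using z diff by (intro bexI[of _ z]) (auto simp: character_eq_iff)
  qed
qed

abbreviation J :: "(nat + nat) cpoly set" where "J \<equiv> Z.relation_ideal"

text \<open>
  A monomial of degree \<open>n\<close> in the \<open>y\<close>-variables contributes to the coefficient of degree \<open>e * n\<close>.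
\<close>

definition \<Psi> :: "(nat + nat) cpoly \<Rightarrow> (nat + nat) cpoly Polynomial.poly" where
  "\<Psi> = eval_pm (\<lambda>c. Polynomial.monom (const c) 0)
     (\<lambda>z. Polynomial.monom (mono (subst_mon g z)) (e * y_degree z))"

lemma \<Psi>_evaluation: "evaluation (\<lambda>c. Polynomial.monom (const c) 0)
    (\<lambda>z. Polynomial.monom (mono (subst_mon g z) :: (nat + nat) cpoly) (e * y_degree z))"
  by unfold_locales
    (auto simp: const_add const_mult Polynomial.add_monom Polynomial.mult_monom subst_mon_add mono_add
      y_degree_add distrib_left Polynomial.monom_eq_1)

lemmas \<Psi>_simps =
  evaluation.ev_0[OF \<Psi>_evaluation, folded \<Psi>_def]
  evaluation.ev_1[OF \<Psi>_evaluation, folded \<Psi>_def]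
  evaluation.ev_add[OF \<Psi>_evaluation, folded \<Psi>_def]
  evaluation.ev_mult[OF \<Psi>_evaluation, folded \<Psi>_def]
  evaluation.ev_sum[OF \<Psi>_evaluation, folded \<Psi>_def]

lemma \<Psi>_single: "\<Psi> (single z c) = Polynomial.monom (single (subst_mon g z) c) (e * y_degree z)"
  unfolding \<Psi>_def evaluation.ev_term[OF \<Psi>_evaluation]
  by (simp add: Polynomial.mult_monom const_times_mono)

lemma coeff_\<Psi>: "Polynomial.coeff (\<Psi> f) n
    = (\<Sum>z | z \<in> supp f \<and> e * y_degree z = n. single (subst_mon g z) (coef f z))"
proof -
  have "\<Psi> f = (\<Sum>z\<in>supp f. \<Psi> (single z (coef f z)))"
    by (simp only: \<Psi>_simps(5)[symmetric] sum_terms)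
  then have "Polynomial.coeff (\<Psi> f) n
      = (\<Sum>z\<in>supp f. if e * y_degree z = n then single (subst_mon g z) (coef f z) else 0)"
    by (simp add: \<Psi>_single Polynomial.coeff_sum)
  then show ?thesis by (simp add: sum.inter_filter)
qed

lemma coeff_\<Psi>_weight:
  assumes "f \<in> carrier (poly_ring V)"
  shows "Polynomial.coeff (\<Psi> f) n \<in> weight_polys n"
proof -
  have mem: "single (subst_mon g z) (coef f z) \<in> weight_polys n" if "z \<in> supp f" "e * y_degree z = n" for z
    using subst_in_H[of z] that assms by (auto simp: weight_polys_def in_poly_ring_iff)
  have sum: "sum h A \<in> weight_polys n" if "\<And>z. z \<in> A \<Longrightarrow> h z \<in> weight_polys n" for h and A :: "(nat + nat) mon set"
    using that by (induction A rule: infinite_finite_induct) (auto simp: weight_polys_01 weight_polys_add)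
  show ?thesis unfolding coeff_\<Psi> by (rule sum) (use mem in auto)
qed

lemma coeff_\<Psi>_carrier: "f \<in> carrier (poly_ring V) \<Longrightarrow> Polynomial.coeff (\<Psi> f) n \<in> carrier XY"
  using coeff_\<Psi>_weight weight_polys_sub by blast

definition \<theta> :: "(nat + nat) cpoly \<Rightarrow> nat \<Rightarrow> (nat + nat) cpoly set" where
  "\<theta> f = (\<lambda>n. residue_of (Polynomial.coeff (\<Psi> f) n))"

lemma \<theta>_closed: assumes f: "f \<in> carrier (poly_ring V)" shows "\<theta> f \<in> carrier S"
proof -
  have piece: "\<theta> f k \<in> section_pieces N d a r k" for k
    unfolding section_pieces_eq \<theta>_def using coeff_\<Psi>_weight[OF f] by blast
  have "bound \<zero>\<^bsub>M\<^esub> (Polynomial.degree (\<Psi> f)) (\<theta> f)"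
    by (rule bound.intro) (simp add: \<theta>_def Polynomial.coeff_eq_0 residue_of_0)
  then have "\<theta> f \<in> up M" using piece_closed[OF piece] by (auto simp: up_def)
  then show ?thesis using piece by (simp add: section_carrier)
qed

lemma \<theta>_hom: "\<theta> \<in> ring_hom (poly_ring V) S"
proof (rule ring_hom_memI)
  show "\<theta> f \<in> carrier S" if "f \<in> carrier (poly_ring V)" for f by (rule \<theta>_closed[OF that])
  show "\<theta> \<one>\<^bsub>poly_ring V\<^esub> = \<one>\<^bsub>S\<^esub>"
    by (auto simp: fun_eq_iff \<theta>_def \<Psi>_simps section_zero_one residue_of_1 residue_of_0)
  fix f h assume f: "f \<in> carrier (poly_ring V)" and h: "h \<in> carrier (poly_ring V)"
  show "\<theta> (f \<oplus>\<^bsub>poly_ring V\<^esub> h) = \<theta> f \<oplus>\<^bsub>S\<^esub> \<theta> h"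
    unfolding section_ops(1)[OF \<theta>_closed[OF f] \<theta>_closed[OF h]]
    using f h by (simp add: \<theta>_def \<Psi>_simps residue_of_add coeff_\<Psi>_carrier)
  have "residue_of (\<Sum>i\<le>n. Polynomial.coeff (\<Psi> f) i * Polynomial.coeff (\<Psi> h) (n - i))
      = finsum M (\<lambda>i. residue_of (Polynomial.coeff (\<Psi> f) i * Polynomial.coeff (\<Psi> h) (n - i))) {..n}" for n
    using f h by (intro residue_of_sum) (auto intro: poly_ring_mult coeff_\<Psi>_carrier)
  then show "\<theta> (f \<otimes>\<^bsub>poly_ring V\<^esub> h) = \<theta> f \<otimes>\<^bsub>S\<^esub> \<theta> h"
    unfolding section_ops(2)[OF \<theta>_closed[OF f] \<theta>_closed[OF h]]
    using f h by (simp add: \<theta>_def \<Psi>_simps Polynomial.coeff_mult residue_of_mult coeff_\<Psi>_carrier)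
qed

text \<open>
  By \<open>moment_ideal_eq\<close> the vanishing of \<open>\<theta> f\<close> is the vanishing of the fibre sums of all coefficients
  of \<open>\<Psi> f\<close>, and these are the fibre sums of \<open>f\<close> itself.
\<close>

lemma \<theta>_eq_0_iff:
  assumes f: "f \<in> carrier (poly_ring V)"
  shows "\<theta> f = \<zero>\<^bsub>S\<^esub> \<longleftrightarrow> f \<in> J"
proof -
  obtain K c where P: "presents d (linear_relations N d a) K c" using xy.ex_presents by blast
  define l where "l = (\<lambda>i. lin_form K (c i))"
  have I_eq: "I = xy.fibre_ideal l" and J_eq: "J = Z.fibre_ideal l"
    unfolding moment_ideal_eq xy.relation_ideal_eq[OF P] Z.relation_ideal_eq[OF P] l_def by auto
  have sum: "xy.fibre_sum l \<gamma> (Polynomial.coeff (\<Psi> f) n)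
      = (\<Sum>z | z \<in> supp f \<and> e * y_degree z = n \<and> xy_diff d (subst_mon g z) = \<gamma>.
          const (coef f z) * lpow d l (y_exponents z))" for \<gamma> n
  proof -
    have "xy.fibre_sum l \<gamma> (Polynomial.coeff (\<Psi> f) n)
        = (\<Sum>z | z \<in> supp f \<and> e * y_degree z = n. if xy_diff d (subst_mon g z) = \<gamma>
            then const (coef f z) * lpow d l (y_exponents z) else 0)"
      unfolding coeff_\<Psi> xy.fibre_sum_sum xy.fibre_sum_single y_exponents_def ..
    also have "\<dots> = (\<Sum>z | z \<in> {z \<in> supp f. e * y_degree z = n} \<and> xy_diff d (subst_mon g z) = \<gamma>.
          const (coef f z) * lpow d l (y_exponents z))"
      by (subst sum.inter_filter) auto
    finally show ?thesis by (simp add: conj_assoc)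
  qed
  have eq: "xy.fibre_sum l (xy_diff d (subst_mon g z)) (Polynomial.coeff (\<Psi> f) (e * y_degree z))
      = Z.fibre_sum l (character z) f" for z
    unfolding sum Z.fibre_sum_def using e by (intro sum.cong) (auto simp: character_eq_iff)
  have "\<theta> f = \<zero>\<^bsub>S\<^esub> \<longleftrightarrow> (\<forall>n. Polynomial.coeff (\<Psi> f) n \<in> I)"
    by (simp add: \<theta>_def section_zero_one fun_eq_iff residue_of_eq_0_iff coeff_\<Psi>_carrier[OF f])
  also have "\<dots> \<longleftrightarrow> (\<forall>n \<gamma>. xy.fibre_sum l \<gamma> (Polynomial.coeff (\<Psi> f) n) = 0)"
    using coeff_\<Psi>_carrier[OF f] by (simp add: I_eq xy.fibre_ideal_def)
  also have "\<dots> \<longleftrightarrow> (\<forall>\<gamma>. Z.fibre_sum l \<gamma> f = 0)"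
  proof
    assume 0: "\<forall>n \<gamma>. xy.fibre_sum l \<gamma> (Polynomial.coeff (\<Psi> f) n) = 0"
    show "\<forall>\<gamma>. Z.fibre_sum l \<gamma> f = 0"
    proof
      fix \<gamma>
      show "Z.fibre_sum l \<gamma> f = 0"
      proof (cases "\<exists>z. character z = \<gamma>")
        case True then show ?thesis using 0 eq by metis
      next
        case False
        then have "{z \<in> supp f. character z = \<gamma>} = {}" by auto
        then show ?thesis unfolding Z.fibre_sum_def by (simp only: sum.empty)
      qed
    qed
  next
    assume 0: "\<forall>\<gamma>. Z.fibre_sum l \<gamma> f = 0"
    show "\<forall>n \<gamma>. xy.fibre_sum l \<gamma> (Polynomial.coeff (\<Psi> f) n) = 0"
    proof (intro allI)
      fix n \<gamma>
      show "xy.fibre_sum l \<gamma> (Polynomial.coeff (\<Psi> f) n) = 0"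
      proof (cases "\<exists>z. e * y_degree z = n \<and> xy_diff d (subst_mon g z) = \<gamma>")
        case True then show ?thesis using 0 eq by metis
      next
        case False
        then have "{z \<in> supp f. e * y_degree z = n \<and> xy_diff d (subst_mon g z) = \<gamma>} = {}" by auto
        then show ?thesis unfolding sum by (simp only: sum.empty)
      qed
    qed
  qed
  also have "\<dots> \<longleftrightarrow> f \<in> J" using f by (simp add: J_eq Z.fibre_ideal_def)
  finally show ?thesis .
qed

lemma \<theta>_image: "\<theta> ` zy_grading p q n = A (e * n)"
proof (intro subset_antisym subsetI)
  fix s assume "s \<in> \<theta> ` zy_grading p q n"
  then obtain f where f: "f \<in> carrier (poly_ring V)" "\<forall>m\<in>supp f. y_degree m = n" "s = \<theta> f"
    by (auto simp: zy_grading_def)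
  have "\<theta> f j = \<zero>\<^bsub>M\<^esub>" if "j \<noteq> e * n" for j
  proof -
    have "{z \<in> supp f. e * y_degree z = j} = {}" using f(2) that by auto
    then have "Polynomial.coeff (\<Psi> f) j = 0" unfolding coeff_\<Psi> by (simp only: sum.empty)
    then show ?thesis by (simp add: \<theta>_def residue_of_0)
  qed
  then show "s \<in> A (e * n)" using \<theta>_closed[OF f(1)] f(3) by (simp add: A_iff)
next
  fix s assume s: "s \<in> A (e * n)"
  then have "s (e * n) \<in> section_pieces N d a r (e * n)" by (simp add: A_iff section_carrier)
  then obtain h where h: "supp h \<subseteq> H (e * n)" "s (e * n) = residue_of h"
    by (auto simp: section_pieces_eq weight_polys_def)
  have "\<forall>m\<in>supp h. \<exists>z. z \<in> mons V \<and> y_degree z = n \<and> subst_mon g z = m"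
    using generate h(1) by blast
  from bchoice[OF this] obtain z
    where z: "\<forall>m\<in>supp h. z m \<in> mons V \<and> y_degree (z m) = n \<and> subst_mon g (z m) = m" ..
  define f where "f = (\<Sum>m\<in>supp h. single (z m) (coef h m))"
  have f: "f \<in> carrier (poly_ring V)" unfolding f_def using z by (intro poly_ring_sum term_in_poly_ring) blast
  have "y_degree x = n" if "x \<in> supp f" for x
  proof -
    have "x \<in> (\<Union>m\<in>supp h. supp (single (z m) (coef h m)))"
      using that unfolding f_def by (rule subsetD[OF Poly_Mapping.keys_sum])
    then show ?thesis using z by (auto split: if_splits)
  qed
  then have fn: "f \<in> zy_grading p q n" using f by (simp add: zy_grading_def)
  have "\<Psi> f = (\<Sum>m\<in>supp h. Polynomial.monom (single m (coef h m)) (e * n))"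
    unfolding f_def \<Psi>_simps(5) using z by (intro sum.cong) (auto simp: \<Psi>_single)
  then have "Polynomial.coeff (\<Psi> f) j = (if j = e * n then h else 0)" for j
    by (simp add: Polynomial.coeff_sum sum_terms)
  then have "\<theta> f j = s j" for j
    using s h(2) by (simp add: \<theta>_def A_iff residue_of_0)
  then have "s = \<theta> f" by auto
  then show "s \<in> \<theta> ` zy_grading p q n" using fn by blast
qed

text \<open>
  The degree in the \<open>y\<close>-variables is constant on fibres.
\<close>

lemma homogeneous_J: "homogeneous_ideal (poly_ring V) (zy_grading p q) J"
proof -
  obtain K c where P: "presents d (linear_relations N d a) K c" using xy.ex_presents by blast
  note J_eq = Z.relation_ideal_eq[OF P]
  have part: "part (\<lambda>z. y_degree z = n) f \<in> J" if f: "f \<in> J" for f n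
  proof -
    have "Z.fibre_sum l \<gamma> (part (\<lambda>z. y_degree z = n) f) = 0" if "Z.fibre_sum l \<gamma> f = 0" for l \<gamma>
    proof (cases "\<exists>z. character z = \<gamma> \<and> y_degree z = n")
      case True
      then have "y_degree z = n" if "character z = \<gamma>" for z using that character_eq_iff by metis
      then have "Z.fibre_sum l \<gamma> (part (\<lambda>z. y_degree z = n) f) = Z.fibre_sum l \<gamma> f"
        unfolding Z.fibre_sum_part Z.fibre_sum_def[of l \<gamma> f] by (intro sum.cong) auto
      then show ?thesis using that by simp
    next
      case False
      then show ?thesis unfolding Z.fibre_sum_part by (intro sum.neutral) auto
    qed
    then show ?thesis using f by (auto simp: J_eq Z.fibre_ideal_def part_in_poly_ring)
  qed
  let ?T = "J \<inter> homog_elems (zy_grading p q)"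
  have T: "?T \<subseteq> carrier (poly_ring V)" using poly_ring_idealD(1)[OF Z.ideal_relation_ideal] by blast
  have "J \<subseteq> genideal (poly_ring V) ?T"
  proof
    fix f assume f: "f \<in> J"
    have "part (\<lambda>z. y_degree z = n) f \<in> zy_grading p q n" for n
      using f poly_ring_idealD(1)[OF Z.ideal_relation_ideal]
      by (auto simp: zy_grading_def supp_part intro: part_in_poly_ring)
    then have "part (\<lambda>z. y_degree z = n) f \<in> genideal (poly_ring V) ?T" for n
      using part[OF f] by (intro genideal_mem[OF T]) (auto simp: homog_elems_def)
    then have "(\<Sum>n\<in>y_degree ` supp f. part (\<lambda>z. y_degree z = n) f) \<in> genideal (poly_ring V) ?T"
      by (rule poly_ring_idealD(7)[OF genideal_is_ideal[OF T]])
    then show "f \<in> genideal (poly_ring V) ?T" by (simp only: sum_parts)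
  qed
  moreover have "genideal (poly_ring V) ?T \<subseteq> J" by (rule genideal_le[OF Z.ideal_relation_ideal]) blast
  ultimately show ?thesis using Z.ideal_relation_ideal by (auto simp: homogeneous_ideal_def)
qed

lemma Proj_iso: "cspace_isomorphic (hypertoric_variety N d a r) (Proj_mod p q J)"
proof -
  let ?P = "poly_ring V"
  interpret P: cring ?P by (rule cring_poly_ring)
  interpret \<theta>: ring_hom_ring ?P S \<theta> by unfold_locales (rule \<theta>_hom)
  have ker: "a_kernel ?P S \<theta> = J"
  proof (rule Set.set_eqI)
    fix f
    have "f \<in> a_kernel ?P S \<theta> \<longleftrightarrow> f \<in> carrier ?P \<and> \<theta> f = \<zero>\<^bsub>S\<^esub>"
      unfolding a_kernel_def' by (simp only: mem_Collect_eq)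
    also have "\<dots> \<longleftrightarrow> f \<in> carrier ?P \<and> f \<in> J"
      by (rule conj_cong[OF refl \<theta>_eq_0_iff])
    also have "\<dots> \<longleftrightarrow> f \<in> J"
      using poly_ring_idealD(1)[OF Z.ideal_relation_ideal] by fast
    finally show "f \<in> a_kernel ?P S \<theta> \<longleftrightarrow> f \<in> J" .
  qed
  define h where "h = (\<lambda>X. the_elem (\<theta> ` X))"
  define B where "B = ?P Quot J"
  define B' where "B' n = (\<lambda>f. J +>\<^bsub>?P\<^esub> f) ` zy_grading p q n" for n
  have h: "h (J +>\<^bsub>?P\<^esub> f) = \<theta> f" if "f \<in> carrier ?P" for f
    unfolding h_def using \<theta>.the_elem_simp[OF that] by (simp add: ker)
  have zy: "zy_grading p q n \<subseteq> carrier ?P" for n by (auto simp: zy_grading_def)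
  have cosets: "carrier B = (\<lambda>f. J +>\<^bsub>?P\<^esub> f) ` carrier ?P"
    by (auto simp: B_def FactRing_def A_RCOSETS_def')
  interpret veronese S A section_comp B B' e h
  proof (intro veronese.intro veronese_axioms.intro graded.graded_ring_axioms)
    show "cring B" unfolding B_def by (rule ideal.quotient_is_cring[OF Z.ideal_relation_ideal cring_poly_ring])
    show "h \<in> ring_hom B S" unfolding h_def B_def using \<theta>.the_elem_hom by (simp add: ker)
    show "inj_on h (carrier B)" unfolding h_def B_def using \<theta>.the_elem_inj by (auto simp: ker inj_on_def)
    show "0 < e" by (rule e)
    show "B' n \<subseteq> carrier B" for n unfolding B'_def cosets using zy by blast
    show "h ` B' n = A (e * n)" for n
    proof -
      have "h ` B' n = \<theta> ` zy_grading p q n"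
        unfolding B'_def image_image using zy by (intro image_cong refl h) blast
      then show ?thesis by (simp add: \<theta>_image)
    qed
    show "section_comp n (h b) = \<zero>\<^bsub>S\<^esub>" if b: "b \<in> carrier B" and n: "\<not> e dvd n" for b n
    proof -
      obtain f where f: "f \<in> carrier ?P" "b = J +>\<^bsub>?P\<^esub> f" using b unfolding cosets by blast
      have "{z \<in> supp f. e * y_degree z = n} = {}" using n by auto
      then have "Polynomial.coeff (\<Psi> f) n = 0" unfolding coeff_\<Psi> by (simp only: sum.empty)
      then show ?thesis
        unfolding f(2) h[OF f(1)] by (simp add: section_comp_def \<theta>_def residue_of_0 section_zero_one fun_eq_iff)
    qed
  qed
  let ?\<iota> = "\<lambda>c. up_ring.monom (UP (moment_ring N d a)) (moment_ideal N d a +>\<^bsub>xy_ring d\<^esub> const c) 0"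
  have "cspace_isomorphic (Proj S A ?\<iota>) (Proj B B' (\<lambda>c. J +>\<^bsub>?P\<^esub> const c))"
  proof (rule Proj_isomorphic)
    fix c
    have "const c \<in> zy_grading p q 0" by (auto simp: zy_grading_def const_def split: if_splits)
    then show "J +>\<^bsub>?P\<^esub> const c \<in> B' 0" unfolding B'_def by blast
    have "\<theta> (const c) n = ?\<iota> c n" for n
      using residue_of_closed[of "const c"]
      by (simp add: \<theta>_def const_def[of c, where 'v = "nat + nat"] \<Psi>_single UP_def xy_ring_eq residue_of_0 flip: residue_of_def)
    then show "h (J +>\<^bsub>?P\<^esub> const c) = ?\<iota> c" by (auto simp: h)
  qed
  then show ?thesis
    unfolding hypertoric_variety_def Proj_mod_def Let_def B_def B'_def[abs_def] .
qed

theorem well_poised_embedding: "has_well_poised_embedding (hypertoric_variety N d a r)"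
  unfolding has_well_poised_embedding_def
  using homogeneous_J Z.relation_ideal_well_poised Proj_iso by blast

end

theorem corollary5p14:
  fixes N :: "'n monoid" and d :: nat and a :: "nat \<Rightarrow> 'n" and r :: "nat \<Rightarrow> int"
  assumes "finite_rank_lattice N"
    and "\<forall>i<d. a i \<in> carrier N \<and> a i \<noteq> \<one>\<^bsub>N\<^esub>"
    and "full_rank N d a"
  shows "has_well_poised_embedding (hypertoric_variety N d a r)"
proof -
  interpret hypertoric N d a r by unfold_locales (use assms in auto)
  obtain e p q g where "0 < e"
    "\<And>i. i \<in> {1..p} \<Longrightarrow> g (Inl i) \<in> H 0" "\<And>j. j \<in> {0..q} \<Longrightarrow> g (Inr j) \<in> H e"
    "\<And>m n. m \<in> H (e * n) \<Longrightarrow> \<exists>z\<in>mons (zy_vars p q). y_degree z = n \<and> subst_mon g z = m"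
    using H.exists_degree_one_generators by metis
  then interpret hypertoric_generators N d a r e p q g by unfold_locales
  show ?thesis by (rule well_poised_embedding)
qed

end
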